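(* Let $\alpha$ be a countable infinite ordinal and $\tau$ a countably infinite order type. If $\tau$ is not of the form $\omega+k$ or $k+\omega^*$ for some natural number $k$, then \[\langle {}^\alpha 2,<_{\mathrm{lex}}\rangle \not\rightarrow (\tau)^\tau.\] Moreover, if $\tau$ is of the form $\omega+k$ or $k+\omega^*$ for some natural number $k$, then \[\langle {}^\alpha 2,<_{\mathrm{lex}}\rangle \rightarrow (\tau)^\tau \iff \omega\rightarrow(\omega)^\omega.\]
   Context: Work in ZF (without the Axiom of Choice). For an ordinal $\alpha$, ${}^\alpha 2$ is the set of functions $\alpha\to\{0,1\}$ with the lexicographic order $<_{\mathrm{lex}}$ ($x<_{\mathrm{lex}}y$ iff $x(\delta)<y(\delta)$ for $\delta$ least with $x(\delta)\ne y(\delta)$). Order types are isomorphism classes of linear orders; $\omega^*$ is the reverse of $\omega$; $+$ denotes concatenation. For a linear order $L$ (in particular an ordinal) and order type $\sigma$, $[L]^\sigma$ is the set of subsets of $L$ of induced order type $\sigma$. $L\rightarrow(\sigma)^\tau$ means: for every $F:[L]^\tau\to\{0,1\}$ there is $H\in[L]^\sigma$ with $F$ constant on $[H]^\tau$; $\not\rightarrow$ is its negation. *)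

theory Defs
  imports Main
begin

text \<open>
  HOL validates the axiom of choice, which refutes \<open>\<omega> \<rightarrow> (\<omega>)\<^sup>\<omega>\<close>.  A theorem of choiceless ZF
  is therefore rendered as a statement true in every model of first-order ZF: a type \<open>'v\<close> with a
  binary relation \<open>\<^bold>\<in>\<close> satisfying the ZF axioms.  Separation and Replacement are schemas
  over first-order formulas with parameters; if they were stated for arbitrary HOL predicates, every
  model would inherit choice from HOL.

  HOL sets over \<open>'v\<close> play the role of classes.  Whatever has to \<^emph>\<open>exist\<close> in the sense of ZF
  (functions, isomorphisms, colourings, homogeneous sets) is quantified over elements of \<open>'v\<close>.
\<close>

datatype fm = FMem nat nat | FEq nat nat | FNeg fm | FConj fm fm | FAll nat fm

primrec sat :: "('v \<Rightarrow> 'v \<Rightarrow> bool) \<Rightarrow> (nat \<Rightarrow> 'v) \<Rightarrow> fm \<Rightarrow> bool" where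
  "sat E s (FMem i j) \<longleftrightarrow> E (s i) (s j)"
| "sat E s (FEq i j) \<longleftrightarrow> s i = s j"
| "sat E s (FNeg p) \<longleftrightarrow> \<not> sat E s p"
| "sat E s (FConj p q) \<longleftrightarrow> sat E s p \<and> sat E s q"
| "sat E s (FAll i p) \<longleftrightarrow> (\<forall>a. sat E (s(i := a)) p)"

text \<open>In the two schemas the variables other than 0 (and 1) carry the parameters.\<close>

class zf =
  fixes mem :: "'a \<Rightarrow> 'a \<Rightarrow> bool"  (infix "\<^bold>\<in>" 50)
  assumes extensionality: "(\<And>z. z \<^bold>\<in> x \<longleftrightarrow> z \<^bold>\<in> y) \<Longrightarrow> x = y"
    and foundation: "z \<^bold>\<in> x \<Longrightarrow> \<exists>y. y \<^bold>\<in> x \<and> \<not> (\<exists>w. w \<^bold>\<in> y \<and> w \<^bold>\<in> x)"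
    and pairing: "\<exists>z. \<forall>w. w \<^bold>\<in> z \<longleftrightarrow> w = x \<or> w = y"
    and union: "\<exists>u. \<forall>z. z \<^bold>\<in> u \<longleftrightarrow> (\<exists>y. z \<^bold>\<in> y \<and> y \<^bold>\<in> x)"
    and power_set: "\<exists>p. \<forall>z. z \<^bold>\<in> p \<longleftrightarrow> (\<forall>w. w \<^bold>\<in> z \<longrightarrow> w \<^bold>\<in> x)"
    and infinity: "\<exists>x. (\<exists>e. e \<^bold>\<in> x \<and> (\<forall>z. \<not> z \<^bold>\<in> e)) \<and>
          (\<forall>y. y \<^bold>\<in> x \<longrightarrow> (\<exists>t. t \<^bold>\<in> x \<and> (\<forall>w. w \<^bold>\<in> t \<longleftrightarrow> w \<^bold>\<in> y \<or> w = y)))"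
    and separation: "\<exists>b. \<forall>x. x \<^bold>\<in> b \<longleftrightarrow> x \<^bold>\<in> a \<and> sat mem (s(0 := x)) p"
    and replacement:
      "(\<And>x y z. x \<^bold>\<in> a \<Longrightarrow> sat mem (s(0 := x, 1 := y)) p \<Longrightarrow> sat mem (s(0 := x, 1 := z)) p \<Longrightarrow> y = z)
        \<Longrightarrow> \<exists>b. \<forall>y. y \<^bold>\<in> b \<longleftrightarrow> (\<exists>x. x \<^bold>\<in> a \<and> sat mem (s(0 := x, 1 := y)) p)"

definition elts :: "'v::zf \<Rightarrow> 'v set" where
  "elts x = {z. z \<^bold>\<in> x}"

lemma elts_inject: "elts x = elts y \<longleftrightarrow> x = y"
  unfolding elts_def by (auto intro: extensionality)

definition zero :: "'v::zf" where
  "zero = (THE e. elts e = {})"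

definition upair :: "'v::zf \<Rightarrow> 'v \<Rightarrow> 'v" where
  "upair x y = (THE z. elts z = {x, y})"

definition one :: "'v::zf" where
  "one = upair zero zero"

lemma elts_zero: "elts zero = {}"
proof -
  obtain e :: 'a where "elts e = {}"
    using infinity by (auto simp: elts_def)
  then show ?thesis
    unfolding zero_def by (rule theI) (metis \<open>elts e = {}\<close> elts_inject)
qed

lemma elts_upair: "elts (upair x y) = {x, y}"
proof -
  obtain z where z: "elts z = {x, y}"
    using pairing[of x y] by (auto simp: elts_def)
  then show ?thesis
    unfolding upair_def by (rule theI) (metis z elts_inject)
qed

lemma elts_one: "elts one = {zero}"
  by (simp add: one_def elts_upair)

definition opair :: "'v::zf \<Rightarrow> 'v \<Rightarrow> 'v" where
  "opair x y = upair (upair x x) (upair x y)"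

lemma opair_inject: "opair x y = opair x' y' \<longleftrightarrow> x = x' \<and> y = y'"
proof -
  have u: "upair a b = upair c d \<longleftrightarrow> {a, b} = {c, d}" for a b c d :: 'a
    by (metis elts_inject elts_upair)
  show ?thesis
    unfolding opair_def u by (auto simp: doubleton_eq_iff u)
qed

definition maps :: "'v::zf \<Rightarrow> 'v set \<Rightarrow> 'v set \<Rightarrow> bool" where
  "maps f A B \<longleftrightarrow> elts f \<subseteq> {opair x y | x y. x \<in> A \<and> y \<in> B} \<and>
     (\<forall>x\<in>A. \<exists>!y. opair x y \<^bold>\<in> f)"

definition app :: "'v::zf \<Rightarrow> 'v \<Rightarrow> 'v" where
  "app f x = (THE y. opair x y \<^bold>\<in> f)"

definition bijection :: "'v::zf \<Rightarrow> 'v set \<Rightarrow> 'v set \<Rightarrow> bool" where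
  "bijection f A B \<longleftrightarrow> maps f A B \<and> bij_betw (app f) A B"

definition is_inductive :: "'v::zf \<Rightarrow> bool" where
  "is_inductive I \<longleftrightarrow> zero \<^bold>\<in> I \<and>
     (\<forall>y. y \<^bold>\<in> I \<longrightarrow> (\<exists>t. t \<^bold>\<in> I \<and> elts t = insert y (elts y)))"

definition Omega :: "'v::zf set" where
  "Omega = {n. \<forall>I. is_inductive I \<longrightarrow> n \<^bold>\<in> I}"

definition countably_infinite :: "'v::zf \<Rightarrow> bool" where
  "countably_infinite X \<longleftrightarrow> (\<exists>f. bijection f (elts X) Omega)"

text \<open>A (strict) order is a carrier with a relation; only the restriction of the relation to the
  carrier matters.\<close>

type_synonym 'v ord = "'v set \<times> ('v \<Rightarrow> 'v \<Rightarrow> bool)"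

definition linear :: "'v::zf ord \<Rightarrow> bool" where
  "linear P \<longleftrightarrow> (case P of (A, r) \<Rightarrow>
     (\<forall>x\<in>A. \<not> r x x) \<and>
     (\<forall>x\<in>A. \<forall>y\<in>A. \<forall>z\<in>A. r x y \<longrightarrow> r y z \<longrightarrow> r x z) \<and>
     (\<forall>x\<in>A. \<forall>y\<in>A. x \<noteq> y \<longrightarrow> r x y \<or> r y x))"

definition iso :: "'v::zf ord \<Rightarrow> 'v ord \<Rightarrow> bool" where
  "iso P Q \<longleftrightarrow> (\<exists>f. bijection f (fst P) (fst Q) \<and>
     (\<forall>x\<in>fst P. \<forall>y\<in>fst P. snd P x y \<longleftrightarrow> snd Q (app f x) (app f y)))"

text \<open>The order \<open>(T, R)\<close> given by a set \<open>T\<close> and a set \<open>R\<close> of ordered pairs; order types of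
  sets are represented by such orders, and equality of order types is \<^const>\<open>iso\<close>.\<close>

definition set_ord :: "'v::zf \<Rightarrow> 'v \<Rightarrow> 'v ord" where
  "set_ord T R = (elts T, \<lambda>x y. opair x y \<^bold>\<in> R)"

definition mem_ord :: "'v::zf \<Rightarrow> 'v ord" where
  "mem_ord x = (elts x, (\<^bold>\<in>))"

definition omega :: "'v::zf ord" where
  "omega = (Omega, (\<^bold>\<in>))"

definition rev_ord :: "'v::zf ord \<Rightarrow> 'v ord" where
  "rev_ord P = (fst P, \<lambda>x y. snd P y x)"

definition concat_ord :: "'v::zf ord \<Rightarrow> 'v ord \<Rightarrow> 'v ord" where
  "concat_ord P Q =
     ({opair zero a | a. a \<in> fst P} \<union> {opair one b | b. b \<in> fst Q},
      \<lambda>u v. (\<exists>a a'. u = opair zero a \<and> v = opair zero a' \<and> snd P a a') \<or>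
            (\<exists>b b'. u = opair one b \<and> v = opair one b' \<and> snd Q b b') \<or>
            (\<exists>a b. u = opair zero a \<and> v = opair one b))"

definition ordinal :: "'v::zf \<Rightarrow> bool" where
  "ordinal \<alpha> \<longleftrightarrow> (\<forall>x\<in>elts \<alpha>. elts x \<subseteq> elts \<alpha>) \<and> linear (mem_ord \<alpha>) \<and>
     (\<forall>X. elts X \<subseteq> elts \<alpha> \<and> elts X \<noteq> {} \<longrightarrow> (\<exists>m\<in>elts X. \<forall>x\<in>elts X. x \<noteq> m \<longrightarrow> m \<^bold>\<in> x))"

text \<open>On \<open>2 = {0, {0}}\<close> and on the ordinal \<open>\<alpha>\<close>, \<open>\<^bold>\<in>\<close> is the strict order.\<close>

definition lex_ord :: "'v::zf \<Rightarrow> 'v ord" where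
  "lex_ord \<alpha> = ({x. maps x (elts \<alpha>) {zero, one}},
     \<lambda>x y. \<exists>\<delta>\<in>elts \<alpha>. app x \<delta> \<^bold>\<in> app y \<delta> \<and> (\<forall>\<gamma>\<in>elts \<delta>. app x \<gamma> = app y \<gamma>))"

definition subsets_of_type :: "'v::zf ord \<Rightarrow> 'v ord \<Rightarrow> 'v set" where
  "subsets_of_type L \<sigma> = {H. elts H \<subseteq> fst L \<and> iso (elts H, snd L) \<sigma>}"

definition arrows :: "'v::zf ord \<Rightarrow> 'v ord \<Rightarrow> 'v ord \<Rightarrow> bool" where
  "arrows L \<sigma> \<tau> \<longleftrightarrow> (\<forall>F. maps F (subsets_of_type L \<tau>) {zero, one} \<longrightarrow>
     (\<exists>H\<in>subsets_of_type L \<sigma>. \<exists>c\<in>{zero, one}.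
        \<forall>X\<in>subsets_of_type (elts H, snd L) \<tau>. app F X = c))"

definition exceptional :: "'v::zf ord \<Rightarrow> bool" where
  "exceptional \<tau> \<longleftrightarrow>
     (\<exists>k\<in>Omega. iso \<tau> (concat_ord omega (mem_ord k)) \<or>
                iso \<tau> (concat_ord (mem_ord k) (rev_ord omega)))"

end

theory Submission
  imports Defs
begin

text \<open>
  Let \<open>\<Delta>(x, y)\<close> be the level at which two branches of \<open>\<^sup>\<alpha>2\<close> split.  For \<open>x < y < z\<close> the levels
  \<open>\<Delta>(x, y)\<close> and \<open>\<Delta>(y, z)\<close> differ, and \<open>\<Delta>(x, z)\<close> is the smaller one.  The proof rests on this
  property, which is invariant under reversal of the order, and on a bijection \<open>e\<close> of \<open>\<alpha>\<close> with \<open>\<omega>\<close>.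

  If \<open>\<tau> = \<omega> + k\<close>, let \<open>x\<^sub>0 < x\<^sub>1 < \<dots>\<close> be the \<open>\<omega>\<close>-part of a set \<open>X\<close> of type \<open>\<tau>\<close>.  The levels at which
  the \<open>x\<^sub>n\<close> leave the limit of the sequence form an infinite set, and passing to subsets of \<open>X\<close> of type \<open>\<tau>\<close>
  yields exactly the infinite subsets of it, so a colouring of the infinite subsets of \<open>\<omega>\<close> can be pulled back
  along \<open>e\<close>.  Conversely, the \<open>k\<close> last points of a set of type \<open>\<omega> + k\<close> belong to each of its subsets of
  the same type, so only the \<open>\<omega>\<close>-part has to be thinned out.

  Otherwise, call two points of \<open>X\<close> close if only finitely many points lie between them.  An infinite
  class of close points, cut at the least level where it splits, has one or two infinite pieces, each of
  type \<open>\<omega>\<close> or \<open>\<omega>\<^sup>*\<close>: the ends of \<open>X\<close>.  An end may be replaced by any infinite subset without changing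
  the type of \<open>X\<close>, and by the pigeonhole principle the least \<open>e\<close>-index of a level where it splits can be
  made arbitrarily large.  If there are two ends, colour \<open>X\<close> according to whether the end with the least
  index lies to the left of the one with the second least index; both colours occur below every \<open>X\<close>.  If there is at
  most one end and \<open>\<tau>\<close> is not exceptional, then \<open>X\<close> contains a copy of the rationals, which contains
  copies of \<open>\<tau>\<close> with much freedom: cut \<open>X\<close> at the least level where it splits and
  compare the least \<open>e\<close>-indices of the levels where the two parts split.
\<close>

text \<open>The obstacle is the setting. A HOL set over a model is an arbitrary class, while
  separation, replacement, induction over \<open>Omega\<close> (which may be nonstandard) and the
  existence of least elements are at hand only for definable classes. Hence every predicate comes
  with a proof of \<open>fo\<close> and every function with a proof of \<open>dfun\<close>, and
  recursion has to be simulated inside the model.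

  The model also lacks choice, although infinitely many ends are thinned, or infinitely many
  isomorphisms glued, at the same time. Each such selection is made canonical in one of two ways: by
  uniqueness, as isomorphisms between orders of type at most \<omega> are unique, or by taking the
  element of least index in an enumeration of the set at hand, which exists because \<tau> is
  countable.

  Countability of \<alpha> enters differently. Infinitely many levels may lie below a given level,
  but only finitely many have an index below a given number, so finitely many halvings of an
  infinite set avoid all of these. This is why colours compare indices of levels and not the levels
  themselves.\<close>

definition push :: "'v \<Rightarrow> (nat \<Rightarrow> 'v) \<Rightarrow> nat \<Rightarrow> 'v" where
  "push a s = (\<lambda>n. case n of 0 \<Rightarrow> a | Suc m \<Rightarrow> s m)"

definition merge :: "(nat \<Rightarrow> 'v) \<Rightarrow> (nat \<Rightarrow> 'v) \<Rightarrow> nat \<Rightarrow> 'v" where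
  "merge s ps = (\<lambda>n. if even n then s (n div 2) else ps (n div 2))"

text \<open>
  \<open>fo P\<close> says that \<open>P\<close> is first-order definable with parameters; in the formula the even variables
  stand for the arguments and the odd ones for the parameters.  Quantifiers are treated in de Bruijn
  style: the bound variable becomes \<open>s 0\<close> and the other variables are shifted.
\<close>

definition fo :: "((nat \<Rightarrow> 'v::zf) \<Rightarrow> bool) \<Rightarrow> bool" where
  "fo P \<longleftrightarrow> (\<exists>p ps. \<forall>s. P s \<longleftrightarrow> sat mem (merge s ps) p)"

definition fot :: "((nat \<Rightarrow> 'v::zf) \<Rightarrow> 'v) \<Rightarrow> bool" where
  "fot t \<longleftrightarrow> fo (\<lambda>s. s 0 = t (\<lambda>n. s (Suc n)))"

section \<open>Renaming and binding variables in formulas\<close>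

primrec vars :: "fm \<Rightarrow> nat set" where
  "vars (FMem i j) = {i, j}"
| "vars (FEq i j) = {i, j}"
| "vars (FNeg p) = vars p"
| "vars (FConj p q) = vars p \<union> vars q"
| "vars (FAll i p) = insert i (vars p)"

lemma finite_vars: "finite (vars p)"
  by (induction p) auto

lemma sat_cong: "(\<And>i. i \<in> vars p \<Longrightarrow> s i = t i) \<Longrightarrow> sat E s p \<longleftrightarrow> sat E t p"
proof (induction p arbitrary: s t)
  case (FAll i p)
  have "sat E (s(i := a)) p \<longleftrightarrow> sat E (t(i := a)) p" for a
    by (rule FAll.IH) (use FAll.prems in auto)
  then show ?case by simp
next
  case (FConj p q)
  have "sat E s p \<longleftrightarrow> sat E t p" by (rule FConj.IH) (use FConj.prems in auto)
  moreover have "sat E s q \<longleftrightarrow> sat E t q" by (rule FConj.IH) (use FConj.prems in auto)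
  ultimately show ?case by simp
next
  case (FNeg p)
  have "sat E s p \<longleftrightarrow> sat E t p" by (rule FNeg.IH) (use FNeg.prems in auto)
  then show ?case by simp
qed auto

lemma sat_rename: "\<exists>q. \<forall>s. sat E s q \<longleftrightarrow> sat E (\<lambda>n. s (f n)) p"
proof (induction p arbitrary: f)
  case (FMem i j)
  show ?case by (rule exI[of _ "FMem (f i) (f j)"]) simp
next
  case (FEq i j)
  show ?case by (rule exI[of _ "FEq (f i) (f j)"]) simp
next
  case (FNeg p)
  then obtain q where "\<forall>s. sat E s q \<longleftrightarrow> sat E (\<lambda>n. s (f n)) p" by blast
  then show ?case by (intro exI[of _ "FNeg q"]) simp
next
  case (FConj p p')
  then obtain q q' where "\<forall>s. sat E s q \<longleftrightarrow> sat E (\<lambda>n. s (f n)) p"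
    "\<forall>s. sat E s q' \<longleftrightarrow> sat E (\<lambda>n. s (f n)) p'" by metis
  then show ?case by (intro exI[of _ "FConj q q'"]) simp
next
  case (FAll i p)
  obtain k where k: "k \<notin> f ` vars p"
    using finite_vars by (metis ex_new_if_finite finite_imageI infinite_UNIV_nat)
  obtain q where q: "\<forall>s. sat E s q \<longleftrightarrow> sat E (\<lambda>n. s ((f(i := k)) n)) p" using FAll by blast
  have "sat E (s(k := a)) q \<longleftrightarrow> sat E ((\<lambda>n. s (f n))(i := a)) p" for s a
    unfolding q[rule_format] by (rule sat_cong) (use k in auto)
  then show ?case by (intro exI[of _ "FAll k q"]) simp
qed

lemma sat_push: "\<exists>q. \<forall>s. sat E s q \<longleftrightarrow> (\<forall>a. sat E (push a s) p)"
proof -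
  \<comment> \<open>Variable 0 of \<open>p\<close> becomes the bound variable \<open>k\<close> and
    variable \<open>Suc m\<close> becomes \<open>m\<close>, so \<open>k\<close> has to avoid the
    predecessors of the variables of \<open>p\<close>.\<close>
  obtain k where k: "k \<notin> vars p" "k \<notin> (\<lambda>n. n - 1) ` vars p"
    using finite_vars[of p]
    by (metis Un_iff ex_new_if_finite finite_Un finite_imageI infinite_UNIV_nat)
  let ?g = "\<lambda>n. case n of 0 \<Rightarrow> k | Suc m \<Rightarrow> m"
  obtain q where q: "\<forall>s. sat E s q \<longleftrightarrow> sat E (\<lambda>n. s (?g n)) p" by (rule exE[OF sat_rename])
  have "sat E (s(k := a)) q \<longleftrightarrow> sat E (push a s) p" for s a
    unfolding q[rule_format]
    by (rule sat_cong) (use k in \<open>auto simp: push_def image_iff split: nat.split\<close>)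
  then show ?thesis by (intro exI[of _ "FAll k q"]) simp
qed

section \<open>Closure properties of first-order definability\<close>

named_theorems fo

lemma fo_rename:
  assumes "fo P" shows "fo (\<lambda>s. P (\<lambda>n. s (f n)))"
proof -
  obtain p ps where p: "\<And>s. P s \<longleftrightarrow> sat mem (merge s ps) p" using assms unfolding fo_def by blast
  obtain q where q: "\<forall>s :: nat \<Rightarrow> 'a. sat mem s q \<longleftrightarrow>
      sat mem (\<lambda>n. s (if even n then 2 * f (n div 2) else n)) p" by (rule exE[OF sat_rename])
  have "P (\<lambda>n. s (f n)) \<longleftrightarrow> sat mem (merge s ps) q" for s
    unfolding p q[rule_format] by (rule sat_cong) (auto simp: merge_def)
  then show ?thesis unfolding fo_def by blast
qed

lemma fo_not [fo]: "fo P \<Longrightarrow> fo (\<lambda>s. \<not> P s)"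
  unfolding fo_def by (metis sat.simps(3))

lemma fo_conj [fo]:
  assumes "fo P" "fo Q" shows "fo (\<lambda>s. P s \<and> Q s)"
proof -
  obtain p ps where p: "\<And>s. P s \<longleftrightarrow> sat mem (merge s ps) p" using assms unfolding fo_def by blast
  obtain q qs where q: "\<And>s. Q s \<longleftrightarrow> sat mem (merge s qs) q" using assms unfolding fo_def by blast
  \<comment> \<open>Each conjunct brings its own parameters. They are interleaved: parameter
    \<open>i\<close> of the first becomes variable \<open>2 * (2 * i) + 1\<close>, parameter
    \<open>i\<close> of the second becomes variable \<open>2 * (2 * i + 1) + 1\<close>.\<close>
  let ?rs = "merge ps qs"
  obtain p' where p': "\<forall>s :: nat \<Rightarrow> 'a. sat mem s p' \<longleftrightarrow>
      sat mem (\<lambda>n. s (if even n then n else 2 * (2 * (n div 2)) + 1)) p" by (rule exE[OF sat_rename])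
  obtain q' where q': "\<forall>s :: nat \<Rightarrow> 'a. sat mem s q' \<longleftrightarrow>
      sat mem (\<lambda>n. s (if even n then n else 2 * (2 * (n div 2) + 1) + 1)) q" by (rule exE[OF sat_rename])
  have "P s \<longleftrightarrow> sat mem (merge s ?rs) p'" for s
    unfolding p p'[rule_format] by (rule sat_cong) (auto simp: merge_def elim: oddE)
  moreover have "Q s \<longleftrightarrow> sat mem (merge s ?rs) q'" for s
    unfolding q q'[rule_format] by (rule sat_cong) (auto simp: merge_def elim: oddE)
  ultimately have "P s \<and> Q s \<longleftrightarrow> sat mem (merge s ?rs) (FConj p' q')" for s by simp
  then show ?thesis unfolding fo_def by blast
qed

lemma fo_disj [fo]: "fo P \<Longrightarrow> fo Q \<Longrightarrow> fo (\<lambda>s. P s \<or> Q s)"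
  using fo_not[OF fo_conj[OF fo_not fo_not], of P Q] by simp

lemma fo_imp [fo]: "fo P \<Longrightarrow> fo Q \<Longrightarrow> fo (\<lambda>s. P s \<longrightarrow> Q s)"
  unfolding imp_conv_disj by (intro fo_disj fo_not)

lemma fo_iff [fo]: "fo P \<Longrightarrow> fo Q \<Longrightarrow> fo (\<lambda>s. P s = Q s)"
  unfolding iff_conv_conj_imp by (intro fo_conj fo_imp)

lemma fo_all [fo]:
  assumes "fo (\<lambda>s. Q (s 0) (\<lambda>n. s (Suc n)))" shows "fo (\<lambda>s. \<forall>a. Q a s)"
proof -
  obtain p ps where p: "\<And>s. Q (s 0) (\<lambda>n. s (Suc n)) \<longleftrightarrow> sat mem (merge s ps) p"
    using assms unfolding fo_def by blast
  \<comment> \<open>Binding shifts the arguments by one place, that is by two among the variables,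
    and leaves the parameters where they are; \<open>push\<close> shifts every variable by one. The
    renaming reconciles the two layouts.\<close>
  obtain q where q: "\<forall>s :: nat \<Rightarrow> 'a. sat mem s q \<longleftrightarrow>
      sat mem (\<lambda>n. s (if n = 0 then 0 else if even n then n - 1 else Suc n)) p"
    by (rule exE[OF sat_rename])
  obtain q' where q': "\<forall>s :: nat \<Rightarrow> 'a. sat mem s q' \<longleftrightarrow> (\<forall>a. sat mem (push a s) q)"
    by (rule exE[OF sat_push])
  have "Q a s \<longleftrightarrow> sat mem (push a (merge s ps)) q" for a s
  proof -
    have "Q a s \<longleftrightarrow> sat mem (merge (push a s) ps) p"
      using p[of "push a s"] by (simp add: push_def)
    also have "\<dots> \<longleftrightarrow> sat mem (push a (merge s ps)) q"
      unfolding q[rule_format]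
    proof (rule sat_cong)
      fix i
      show "merge (push a s) ps i
          = push a (merge s ps) (if i = 0 then 0 else if even i then i - 1 else Suc i)"
        by (cases "i = 0"; cases "even i")
           (auto simp: merge_def push_def elim!: evenE oddE split: nat.split, presburger)
    qed
    finally show ?thesis .
  qed
  then have "(\<forall>a. Q a s) \<longleftrightarrow> sat mem (merge s ps) q'" for s
    using q' by simp
  then show ?thesis unfolding fo_def by blast
qed

lemma fo_ex [fo]:
  assumes "fo (\<lambda>s. Q (s 0) (\<lambda>n. s (Suc n)))" shows "fo (\<lambda>s. \<exists>a. Q a s)"
  using fo_not[OF fo_all[of "\<lambda>a s. \<not> Q a s"]] fo_not[OF assms] by simp

lemma fot_var [fo]: "fot (\<lambda>s. s n)"
proof -
  have "s 0 = s (Suc n) \<longleftrightarrow> sat mem (merge s undefined) (FEq 0 (2 * Suc n))" for s :: "nat \<Rightarrow> 'a"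
    by (simp add: merge_def)
  then show ?thesis unfolding fot_def fo_def by blast
qed

lemma fot_const [fo]: "fot (\<lambda>s. c)"
proof -
  have "s 0 = c \<longleftrightarrow> sat mem (merge s (\<lambda>_. c)) (FEq 0 1)" for s :: "nat \<Rightarrow> 'a"
    by (simp add: merge_def)
  then show ?thesis unfolding fot_def fo_def by blast
qed

lemma fo_const [fo]: "fo (\<lambda>s. b)"
proof -
  have "sat mem (merge s undefined) (FEq 0 0)" for s :: "nat \<Rightarrow> 'a" by simp
  then have "fo (\<lambda>s :: nat \<Rightarrow> 'a. True)" unfolding fo_def by blast
  then show ?thesis by (cases b) (use fo_not in fastforce)+
qed

lemma fo_subst:
  assumes P: "fo (\<lambda>s. P (s 0) (\<lambda>n. s (Suc n)))" and t: "fot t"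
  shows "fo (\<lambda>s. P (t s) s)"
proof -
  have "fo (\<lambda>s. \<exists>a. a = t s \<and> P a s)"
    by (intro fo_ex fo_conj P) (use t in \<open>simp add: fot_def\<close>)
  then show ?thesis by simp
qed

lemma fo_lift: "fo P \<Longrightarrow> fo (\<lambda>s. P (\<lambda>n. s (Suc n)))"
  by (rule fo_rename)

lemma fot_lift: 
  assumes "fot t" shows "fot (\<lambda>s. t (\<lambda>n. s (Suc n)))"
  using fo_rename[of "\<lambda>s. s 0 = t (\<lambda>n. s (Suc n))" "\<lambda>n. case n of 0 \<Rightarrow> 0 | Suc m \<Rightarrow> Suc (Suc m)"]
    assms unfolding fot_def by simp

lemma fo1:
  assumes "fo (\<lambda>s. R (s 0))" "fot t" shows "fo (\<lambda>s. R (t s))"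
  by (rule fo_subst[OF _ assms(2)]) (rule assms(1))

text \<open>Reduces definability of a relation between terms to that of the relation between two
  variables. The closure rules for defined notions are mostly instances of \<open>fo1\<close>,
  \<open>fo2\<close> and \<open>fo3\<close>.\<close>

lemma fo2:
  assumes R: "fo (\<lambda>s. R (s 0) (s (Suc 0)))" and t: "fot t" and u: "fot u"
  shows "fo (\<lambda>s. R (t s) (u s))"
proof -
  have "fo (\<lambda>s. R (s 0) (u (\<lambda>n. s (Suc n))))"
  proof (rule fo_subst[of "\<lambda>x s. R (s 0) x"])
    show "fo (\<lambda>s. R (s (Suc 0)) (s 0))"
      using fo_rename[OF R, of "\<lambda>n. case n of 0 \<Rightarrow> Suc 0 | Suc m \<Rightarrow> 0"] by simp
  qed (rule fot_lift[OF u])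
  then show ?thesis by (rule fo_subst[OF _ t])
qed

lemma fo3:
  assumes R: "fo (\<lambda>s. R (s 0) (s (Suc 0)) (s (Suc (Suc 0))))" and t: "fot t" and u: "fot u" and v: "fot v"
  shows "fo (\<lambda>s. R (t s) (u s) (v s))"
proof -
  have 1: "fo (\<lambda>s. R (s (Suc (Suc 0))) (s 0) (s (Suc 0)))"
    using fo_rename[OF R, of "\<lambda>n. case n of 0 \<Rightarrow> Suc (Suc 0) | Suc m \<Rightarrow> m"] by simp
  have "fo (\<lambda>s. R (s 0) (u (\<lambda>n. s (Suc n))) (v (\<lambda>n. s (Suc n))))"
  proof (rule fo_subst[of "\<lambda>x s. R (s 0) x (v (\<lambda>n. s (Suc n)))"])
    show "fo (\<lambda>s. R (s (Suc 0)) (s 0) (v (\<lambda>n. s (Suc (Suc n)))))"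
    proof (rule fo_subst[of "\<lambda>x s. R (s (Suc 0)) (s 0) x"])
      show "fo (\<lambda>s. R (s (Suc (Suc 0))) (s (Suc 0)) (s 0))"
        using fo_rename[OF R, of "\<lambda>n. case n of 0 \<Rightarrow> Suc (Suc 0) | Suc m \<Rightarrow> (case m of 0 \<Rightarrow> Suc 0 | Suc _ \<Rightarrow> 0)"]
        by simp
    qed (rule fot_lift[OF fot_lift[OF v]])
  qed (rule fot_lift[OF u])
  then show ?thesis by (rule fo_subst[OF _ t])
qed

lemma fot1:
  assumes R: "fo (\<lambda>s. s 0 = f (s (Suc 0)))" and t: "fot t"
  shows "fot (\<lambda>s. f (t s))"
  unfolding fot_def by (rule fo2[OF R fot_var fot_lift[OF t]])

lemma fot2:
  assumes R: "fo (\<lambda>s. s 0 = f (s (Suc 0)) (s (Suc (Suc 0))))" and t: "fot t" and u: "fot u"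
  shows "fot (\<lambda>s. f (t s) (u s))"
  unfolding fot_def by (rule fo3[OF R fot_var fot_lift[OF t] fot_lift[OF u]])

lemma fo_mem [fo]: "fot t \<Longrightarrow> fot u \<Longrightarrow> fo (\<lambda>s. t s \<^bold>\<in> u s)"
proof (rule fo2)
  have "s 0 \<^bold>\<in> s (Suc 0) \<longleftrightarrow> sat mem (merge s undefined) (FMem 0 2)" for s :: "nat \<Rightarrow> 'a"
    by (simp add: merge_def)
  then show "fo (\<lambda>s :: nat \<Rightarrow> 'a. s 0 \<^bold>\<in> s (Suc 0))" unfolding fo_def by blast
qed

lemma fo_eq [fo]: "fot t \<Longrightarrow> fot u \<Longrightarrow> fo (\<lambda>s. t s = u s)"
proof (rule fo2)
  have "s 0 = s (Suc 0) \<longleftrightarrow> sat mem (merge s undefined) (FEq 0 2)" for s :: "nat \<Rightarrow> 'a"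
    by (simp add: merge_def)
  then show "fo (\<lambda>s :: nat \<Rightarrow> 'a. s 0 = s (Suc 0))" unfolding fo_def by blast
qed

lemma fo_elts [fo]: "fot t \<Longrightarrow> fot u \<Longrightarrow> fo (\<lambda>s. t s \<in> elts (u s))"
  unfolding elts_def by (simp add: fo_mem)

lemma fo_Collect [fo]: "fo (\<lambda>s. P (t s) s) \<Longrightarrow> fo (\<lambda>s. t s \<in> {x. P x s})" by simp
lemma fo_Int [fo]: "fo (\<lambda>s. t s \<in> A s) \<Longrightarrow> fo (\<lambda>s. t s \<in> B s) \<Longrightarrow> fo (\<lambda>s. t s \<in> A s \<inter> B s)"
  by (simp add: fo_conj)
lemma fo_Un [fo]: "fo (\<lambda>s. t s \<in> A s) \<Longrightarrow> fo (\<lambda>s. t s \<in> B s) \<Longrightarrow> fo (\<lambda>s. t s \<in> A s \<union> B s)"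
  by (simp add: fo_disj)
lemma fo_Diff [fo]: "fo (\<lambda>s. t s \<in> A s) \<Longrightarrow> fo (\<lambda>s. t s \<in> B s) \<Longrightarrow> fo (\<lambda>s. t s \<in> A s - B s)"
  by (simp add: fo_conj fo_not)
lemma fo_insert [fo]: "fot t \<Longrightarrow> fot u \<Longrightarrow> fo (\<lambda>s. t s \<in> A s) \<Longrightarrow> fo (\<lambda>s. t s \<in> insert (u s) (A s))"
  by (simp add: fo_disj fo_eq)
lemma fo_empty [fo]: "fo (\<lambda>s. t s \<in> {})" by (simp add: fo_const)

lemma fo_ball [fo]:
  "fo (\<lambda>s. s 0 \<in> A (\<lambda>n. s (Suc n)) \<longrightarrow> Q (s 0) (\<lambda>n. s (Suc n))) \<Longrightarrow> fo (\<lambda>s. \<forall>x\<in>A s. Q x s)"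
  unfolding Ball_def by (rule fo_all)
lemma fo_bex [fo]:
  "fo (\<lambda>s. s 0 \<in> A (\<lambda>n. s (Suc n)) \<and> Q (s 0) (\<lambda>n. s (Suc n))) \<Longrightarrow> fo (\<lambda>s. \<exists>x\<in>A s. Q x s)"
  unfolding Bex_def by (rule fo_ex)
lemma fo_ex1 [fo]:
  assumes "fo (\<lambda>s. Q (s 0) (\<lambda>n. s (Suc n)))" shows "fo (\<lambda>s. \<exists>!a. Q a s)"
proof -
  have 2: "fo (\<lambda>s. Q (s 0) (\<lambda>n. s (Suc (Suc n))))"
    using fo_rename[OF assms, of "\<lambda>n. case n of 0 \<Rightarrow> 0 | Suc m \<Rightarrow> Suc (Suc m)"] by simp
  show ?thesis unfolding Ex1_def by (intro fo 2 assms)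
qed
lemma fo_subset [fo]:
  "fo (\<lambda>s. s 0 \<in> A (\<lambda>n. s (Suc n)) \<longrightarrow> s 0 \<in> B (\<lambda>n. s (Suc n))) \<Longrightarrow> fo (\<lambda>s. A s \<subseteq> B s)"
  unfolding subset_iff by (rule fo_all)

section \<open>Definite descriptions and definable class functions\<close>

text \<open>The default \<open>zero\<close> replaces the unspecified value that \<open>THE\<close>
  returns when there is no unique witness. That value need not be definable, whereas
  \<open>fot_the0\<close> holds for every definable \<open>P\<close>.\<close>

definition the0 :: "('v::zf \<Rightarrow> bool) \<Rightarrow> 'v" where
  "the0 P = (if \<exists>!y. P y then THE y. P y else zero)"

lemma the0_eq: "P a \<Longrightarrow> (\<And>y. P y \<Longrightarrow> y = a) \<Longrightarrow> the0 P = a"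
  unfolding the0_def by (metis the_equality)

lemma the0_I: "\<exists>!y. P y \<Longrightarrow> P (the0 P)"
  unfolding the0_def by (simp add: theI')

lemma fot_the0 [fo]:
  assumes P: "fo (\<lambda>s. P (s 0) (\<lambda>n. s (Suc n)))" shows "fot (\<lambda>s. the0 (\<lambda>y. P y s))"
proof -
  have eq: "z = the0 P \<longleftrightarrow> (P z \<and> (\<exists>!y. P y)) \<or> (z = zero \<and> \<not> (\<exists>!y. P y))" for z and P :: "'a \<Rightarrow> bool"
    unfolding the0_def by (auto intro: the_equality[symmetric] theI')
  have 2: "fo (\<lambda>s. P (s 0) (\<lambda>n. s (Suc (Suc n))))"
    using fo_rename[OF P, of "\<lambda>n. case n of 0 \<Rightarrow> 0 | Suc m \<Rightarrow> Suc (Suc m)"] by simp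
  show ?thesis unfolding fot_def eq by (intro fo P 2)
qed

lemma fot_if [fo]:
  assumes "fo P" "fot t" "fot u" shows "fot (\<lambda>s. if P s then t s else u s)"
proof -
  have eq: "(z = (if b then x else y)) = ((b \<and> z = x) \<or> (\<not> b \<and> z = y))" for z x y :: 'a and b by auto
  show ?thesis unfolding fot_def eq by (intro fo fo_lift fot_lift assms)
qed

text \<open>A class function definable with parameters. It need not be an element of the model;
  \<open>maps_graph\<close> turns its restriction to a set into one.\<close>

definition dfun :: "('v::zf \<Rightarrow> 'v) \<Rightarrow> bool" where
  "dfun f \<longleftrightarrow> fo (\<lambda>s. s 0 = f (s (Suc 0)))"

lemma dfunI: "fot (\<lambda>s. f (s 0)) \<Longrightarrow> dfun f"
  unfolding dfun_def fot_def .

lemma fot_dfun: "dfun f \<Longrightarrow> fot t \<Longrightarrow> fot (\<lambda>s. f (t s))"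
  unfolding dfun_def by (rule fot1)

section \<open>Classes that are sets: separation and replacement for definable classes\<close>

definition small :: "'v::zf set \<Rightarrow> bool" where "small A \<longleftrightarrow> (\<exists>x. elts x = A)"

lemma small_elts [simp]: "small (elts x)" by (auto simp: small_def)

lemma mem_iff: "x \<^bold>\<in> y \<longleftrightarrow> x \<in> elts y" by (simp add: elts_def)

lemma fo_sm [fo]: "small A \<Longrightarrow> fot t \<Longrightarrow> fo (\<lambda>s. t s \<in> A)"
  unfolding small_def using fo_elts[OF _ fot_const] by blast

lemma separate:
  assumes P: "fo (\<lambda>s. P (s 0))" and A: "small A" and B: "B = {x \<in> A. P x}"
  shows "small B"
proof -
  obtain p ps where p: "\<And>s. P (s 0) \<longleftrightarrow> sat mem (merge s ps) p" using P unfolding fo_def by blast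
  \<comment> \<open>The axiom varies variable 0 only, so all even variables of \<open>p\<close> are
    identified with it; the odd ones keep the parameters.\<close>
  obtain q where q: "\<forall>s :: nat \<Rightarrow> 'a. sat mem s q \<longleftrightarrow> sat mem (\<lambda>n. s (if even n then 0 else n)) p"
    by (rule exE[OF sat_rename])
  obtain a where a: "elts a = A" using A by (auto simp: small_def)
  obtain b where b: "\<forall>x. x \<^bold>\<in> b \<longleftrightarrow> x \<^bold>\<in> a \<and> sat mem ((merge ps ps)(0 := x)) q"
    using separation by blast
  have "sat mem ((merge ps ps)(0 := x)) q \<longleftrightarrow> P x" for x
  proof -
    have "P x \<longleftrightarrow> sat mem (merge (\<lambda>_. x) ps) p" using p[of "\<lambda>_. x"] by simp
    also have "\<dots> \<longleftrightarrow> sat mem ((merge ps ps)(0 := x)) q" unfolding q[rule_format]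
      by (rule sat_cong) (auto simp: merge_def elim: oddE)
    finally show ?thesis ..
  qed
  then have "elts b = B" using b a B by (auto simp: elts_def)
  then show ?thesis by (auto simp: small_def)
qed

lemma small_image:
  assumes f: "dfun f" and A: "small A" shows "small (f ` A)"
proof -
  obtain p ps where p: "\<And>s. s 0 = f (s (Suc 0)) \<longleftrightarrow> sat mem (merge s ps) p"
    using f unfolding dfun_def fo_def by blast
  \<comment> \<open>Replacement reserves variable 0 for the argument and 1 for the value, so the
    parameters move up by two. Variable 0 of \<open>p\<close> is the value; all other even variables
    are read as the argument.\<close>
  obtain q where q: "\<forall>s :: nat \<Rightarrow> 'a. sat mem s q \<longleftrightarrow>
      sat mem (\<lambda>n. s (if even n then (if n = 0 then 1 else 0) else n + 2)) p"
    by (rule exE[OF sat_rename])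
  obtain a where a: "elts a = A" using A by (auto simp: small_def)
  let ?s = "\<lambda>n. ps ((n - 2) div 2)"
  have *: "sat mem (?s(0 := x, 1 := y)) q \<longleftrightarrow> y = f x" for x y
  proof -
    have "y = f x \<longleftrightarrow> sat mem (merge (\<lambda>n. if n = 0 then y else x) ps) p"
      using p[of "\<lambda>n. if n = 0 then y else x"] by simp
    also have "\<dots> \<longleftrightarrow> sat mem (?s(0 := x, 1 := y)) q" unfolding q[rule_format]
      by (rule sat_cong) (auto simp: merge_def)
    finally show ?thesis ..
  qed
  have "\<exists>b. \<forall>y. y \<^bold>\<in> b \<longleftrightarrow> (\<exists>x. x \<^bold>\<in> a \<and> sat mem (?s(0 := x, 1 := y)) q)"
    by (rule replacement) (simp only: *)
  then obtain b where "\<forall>y. y \<^bold>\<in> b \<longleftrightarrow> (\<exists>x. x \<^bold>\<in> a \<and> y = f x)" unfolding * by blast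
  then have "elts b = f ` A" using a by (auto simp: elts_def)
  then show ?thesis by (auto simp: small_def)
qed

lemma linear_irrefl: "linear (A, r) \<Longrightarrow> x \<in> A \<Longrightarrow> \<not> r x x"
  and linear_trans: "linear (A, r) \<Longrightarrow> r x y \<Longrightarrow> r y z \<Longrightarrow> x \<in> A \<Longrightarrow> y \<in> A \<Longrightarrow> z \<in> A \<Longrightarrow> r x z"
  and linear_total: "linear (A, r) \<Longrightarrow> x \<in> A \<Longrightarrow> y \<in> A \<Longrightarrow> x = y \<or> r x y \<or> r y x"
  unfolding linear_def split by blast+

lemma linearI:
  assumes "\<And>x. x \<in> A \<Longrightarrow> \<not> r x x"
    and "\<And>x y z. x \<in> A \<Longrightarrow> y \<in> A \<Longrightarrow> z \<in> A \<Longrightarrow> r x y \<Longrightarrow> r y z \<Longrightarrow> r x z"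
    and "\<And>x y. x \<in> A \<Longrightarrow> y \<in> A \<Longrightarrow> x \<noteq> y \<Longrightarrow> r x y \<or> r y x"
  shows "linear (A, r)"
  unfolding linear_def split using assms by blast

lemma linear_sub: "linear (A, r) \<Longrightarrow> B \<subseteq> A \<Longrightarrow> linear (B, r)"
  unfolding linear_def split by blast

lemma linear_rev: "linear (A, r) \<Longrightarrow> linear (A, \<lambda>x y. r y x)"
  unfolding linear_def split by blast

lemma small_sub: "small A \<Longrightarrow> fo (\<lambda>s. s 0 \<in> B) \<Longrightarrow> B \<subseteq> A \<Longrightarrow> small B"
  by (rule separate[where P = "\<lambda>x. x \<in> B" and A = A]) auto

lemma small_empty [simp]: "small {}" using elts_zero by (auto simp: small_def)

lemma small_union:
  assumes "small A" "small B" shows "small (A \<union> B)"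
proof -
  obtain a b where "elts a = A" "elts b = B" using assms by (auto simp: small_def)
  moreover obtain u where "\<forall>z. z \<^bold>\<in> u \<longleftrightarrow> (\<exists>y. z \<^bold>\<in> y \<and> y \<^bold>\<in> upair a b)" using union by blast
  ultimately have "elts u = A \<union> B" by (auto simp: mem_iff elts_upair)
  then show ?thesis by (auto simp: small_def)
qed

lemma small_insert: "small A \<Longrightarrow> small (insert a A)"
  using small_union[OF small_elts[of "upair a a"], of A] by (simp add: elts_upair)

lemma small_Pow:
  assumes "small A" shows "small {z. elts z \<subseteq> A}"
proof -
  obtain a where "elts a = A" using assms by (auto simp: small_def)
  moreover obtain p where "\<forall>z. z \<^bold>\<in> p \<longleftrightarrow> (\<forall>w. w \<^bold>\<in> z \<longrightarrow> w \<^bold>\<in> a)" using power_set by blast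
  ultimately have "elts p = {z. elts z \<subseteq> A}" by (auto simp: mem_iff)
  then show ?thesis unfolding small_def by blast
qed

text \<open>The element of the model with extension \<open>A\<close>. Written through
  \<open>the0\<close>, it remains a definable term when \<open>A\<close> depends definably on
  variables.\<close>

definition st :: "'v::zf set \<Rightarrow> 'v" where
  "st A = the0 (\<lambda>x. \<forall>z. z \<in> elts x \<longleftrightarrow> z \<in> A)"

lemma elts_st: "small A \<Longrightarrow> elts (st A) = A"
proof -
  assume "small A"
  then obtain a where a: "elts a = A" by (auto simp: small_def)
  have "st A = a" unfolding st_def
    by (rule the0_eq) (use a in \<open>auto simp flip: elts_inject\<close>)
  then show ?thesis using a by simp
qed

lemma st_elts [simp]: "st (elts a) = a"
  by (metis elts_inject elts_st small_elts)

lemma fot_st [fo]: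
  assumes "fo (\<lambda>s. s 0 \<in> A (\<lambda>n. s (Suc n)))" shows "fot (\<lambda>s. st (A s))"
proof -
  have "fo (\<lambda>s. s 0 \<in> A (\<lambda>n. s (Suc (Suc n))))"
    using fo_rename[OF assms, of "\<lambda>n. case n of 0 \<Rightarrow> 0 | Suc m \<Rightarrow> Suc (Suc m)"] by simp
  then show ?thesis unfolding st_def by (intro fo)
qed

definition ins :: "'v::zf \<Rightarrow> 'v \<Rightarrow> 'v" where "ins a y = st (insert a (elts y))"

lemma elts_ins [simp]: "elts (ins a y) = insert a (elts y)"
  by (simp add: ins_def elts_st small_insert)

lemma fot_ins [fo]: "fot t \<Longrightarrow> fot u \<Longrightarrow> fot (\<lambda>s. ins (t s) (u s))"
  by (rule fot2[of ins]) (simp_all, unfold ins_def, intro fo)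

lemma fot_upair [fo]: "fot t \<Longrightarrow> fot u \<Longrightarrow> fot (\<lambda>s. upair (t s) (u s))"
proof (rule fot2[of upair])
  have "upair x y = st {x, y}" for x y :: 'a by (metis elts_upair st_elts)
  then show "fo (\<lambda>s :: nat \<Rightarrow> 'a. s 0 = upair (s (Suc 0)) (s (Suc (Suc 0))))"
    by (simp only:) (intro fo)
qed

lemma fot_opair [fo]: "fot t \<Longrightarrow> fot u \<Longrightarrow> fot (\<lambda>s. opair (t s) (u s))"
  by (rule fot2[of opair]) (simp_all, unfold opair_def, intro fo)

declare opair_inject [simp] elts_zero [simp] elts_one [simp]

section \<open>Functions and isomorphisms inside the model\<close>

text \<open>The counterpart of \<open>app\<close> with a default value, hence a definable term; the
  two agree wherever the value is unique (\<open>app_ap\<close>).\<close>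

definition ap :: "'v::zf \<Rightarrow> 'v \<Rightarrow> 'v" where "ap f x = the0 (\<lambda>y. opair x y \<in> elts f)"

lemma fot_ap [fo]: "fot t \<Longrightarrow> fot u \<Longrightarrow> fot (\<lambda>s. ap (t s) (u s))"
  by (rule fot2[of ap]) (simp_all, unfold ap_def, intro fo)

lemma dfun_ap: "dfun (ap g)" by (rule dfunI) (intro fo)

lemma app_ap: "\<exists>!y. opair x y \<in> elts f \<Longrightarrow> app f x = ap f x"
  unfolding app_def ap_def the0_def by (simp add: mem_iff)

lemma maps_ap:
  assumes "maps f A B" "x \<in> A"
  shows "app f x = ap f x" "opair x (ap f x) \<in> elts f" "ap f x \<in> B"
proof -
  have u: "\<exists>!y. opair x y \<in> elts f" using assms by (auto simp: maps_def mem_iff)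
  then show "app f x = ap f x" by (rule app_ap)
  show *: "opair x (ap f x) \<in> elts f" using the0_I[OF u] by (simp add: ap_def)
  show "ap f x \<in> B" using * assms by (auto simp: maps_def)
qed

lemma maps_opair: "maps f A B \<Longrightarrow> opair x y \<in> elts f \<longleftrightarrow> x \<in> A \<and> y = ap f x"
  by (smt (verit, ccfv_threshold) maps_ap(2) maps_def mem_Collect_eq mem_iff opair_inject subset_iff)

lemma maps_ext:
  assumes "maps f A B" "maps g A C" "\<And>x. x \<in> A \<Longrightarrow> ap f x = ap g x" shows "f = g"
proof -
  have "z \<in> elts f \<longleftrightarrow> z \<in> elts g" for z
  proof (cases "\<exists>x y. z = opair x y")
    case True
    then show ?thesis using assms maps_opair by metis
  next
    case False
    then show ?thesis using assms unfolding maps_def by blast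
  qed
  then show ?thesis by (auto simp flip: elts_inject)
qed

text \<open>By replacement the graph of a definable class function on a set is a set. Isomorphisms
  and colourings can therefore be given as class functions and turned into elements of the model
  afterwards.\<close>

lemma maps_graph:
  assumes "dfun f" "small A" "f ` A \<subseteq> B"
  shows "\<exists>g. maps g A B \<and> (\<forall>x\<in>A. ap g x = f x)"
proof -
  have "small ((\<lambda>x. opair x (f x)) ` A)"
    by (rule small_image[OF dfunI assms(2)]) (intro fo fot_dfun[OF assms(1)])
  then obtain g where g: "elts g = (\<lambda>x. opair x (f x)) ` A" by (auto simp: small_def)
  have "maps g A B" using g assms(3) by (auto simp: maps_def mem_iff)
  moreover have "ap g x = f x" if "x \<in> A" for x
    using maps_opair[OF \<open>maps g A B\<close>, of x "f x"] g that by auto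
  ultimately show ?thesis by blast
qed

lemma isoI:
  assumes "dfun f" "small A" "bij_betw f A B" "\<And>x y. x \<in> A \<Longrightarrow> y \<in> A \<Longrightarrow> r x y \<longleftrightarrow> r' (f x) (f y)"
  shows "iso (A, r) (B, r')"
proof -
  obtain g where g: "maps g A B" "\<And>x. x \<in> A \<Longrightarrow> ap g x = f x"
    using maps_graph[OF assms(1,2), of B] assms(3) by (auto simp: bij_betw_def)
  then have a: "app g x = f x" if "x \<in> A" for x using maps_ap that by metis
  then have "bij_betw (app g) A B" using assms(3) by (simp cong: bij_betw_cong)
  then show ?thesis unfolding iso_def bijection_def using g a assms(4) by auto
qed

lemma bijE:
  assumes "bijection g A B"
  shows "bij_betw (ap g) A B" "\<And>x. x \<in> A \<Longrightarrow> app g x = ap g x"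
  using assms maps_ap(1) bij_betw_cong[of A "app g" "ap g"] unfolding bijection_def by blast+

lemma isoE:
  assumes "iso (A, r) (B, r')"
  obtains f where "dfun f" "bij_betw f A B" "\<And>x y. x \<in> A \<Longrightarrow> y \<in> A \<Longrightarrow> r x y \<longleftrightarrow> r' (f x) (f y)"
proof -
  obtain g where "bijection g A B" "\<forall>x\<in>A. \<forall>y\<in>A. r x y \<longleftrightarrow> r' (app g x) (app g y)"
    using assms by (auto simp: iso_def)
  moreover from this have "app g x = ap g x" if "x \<in> A" for x using bijE(2) that by blast
  ultimately show ?thesis using that[of "ap g", OF dfun_ap bijE(1)] by simp
qed

lemma dfun_comp:
  assumes "dfun f" "dfun g" shows "dfun (\<lambda>x. g (f x))"
  by (rule dfunI) (intro fot_dfun[OF assms(1)] fot_dfun[OF assms(2)] fo)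

definition dinv :: "'v::zf set \<Rightarrow> ('v \<Rightarrow> 'v) \<Rightarrow> 'v \<Rightarrow> 'v" where
  "dinv A f y = the0 (\<lambda>x. x \<in> A \<and> f x = y)"

lemma dfun_dinv:
  assumes "small A" "dfun f" shows "dfun (dinv A f)"
  unfolding dinv_def by (rule dfunI) (intro fo fot_dfun[OF assms(2)] assms)

lemma dinv_f: "inj_on f A \<Longrightarrow> x \<in> A \<Longrightarrow> dinv A f (f x) = x"
  unfolding dinv_def by (rule the0_eq) (auto dest: inj_onD)

lemma dinv_bij:
  assumes "bij_betw f A B"
  shows "bij_betw (dinv A f) B A" "\<And>y. y \<in> B \<Longrightarrow> f (dinv A f y) = y"
proof -
  have i: "inj_on f A" "f ` A = B" using assms by (auto simp: bij_betw_def)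
  show 1: "f (dinv A f y) = y" if "y \<in> B" for y using that i dinv_f[OF i(1)] by auto
  show "bij_betw (dinv A f) B A"
    by (rule bij_betw_byWitness[where f' = f]) (use i 1 dinv_f[OF i(1)] in auto)
qed

lemma iso_sm: "iso (A, r) (B, r') \<Longrightarrow> small A \<Longrightarrow> small B"
  by (erule isoE) (metis bij_betw_def small_image)

lemma iso_sym:
  assumes "iso (A, r) (B, r')" "small A" shows "iso (B, r') (A, r)"
proof -
  obtain f where f: "dfun f" "bij_betw f A B" "\<And>x y. x \<in> A \<Longrightarrow> y \<in> A \<Longrightarrow> r x y \<longleftrightarrow> r' (f x) (f y)"
    using isoE[OF assms(1)] by blast
  note d = dinv_bij[OF f(2)]
  show ?thesis
  proof (rule isoI[where f = "dinv A f"])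
    show "r' x y \<longleftrightarrow> r (dinv A f x) (dinv A f y)" if "x \<in> B" "y \<in> B" for x y
      using f(3)[of "dinv A f x" "dinv A f y"] d that bij_betw_apply[OF d(1)] by simp
  qed (use assms iso_sm f d dfun_dinv in \<open>blast+\<close>)
qed

lemma iso_trans:
  assumes "iso (A, r) (B, r')" "iso (B, r') (C, r'')" "small A" shows "iso (A, r) (C, r'')"
proof -
  obtain f where f: "dfun f" "bij_betw f A B" "\<And>x y. x \<in> A \<Longrightarrow> y \<in> A \<Longrightarrow> r x y \<longleftrightarrow> r' (f x) (f y)"
    using isoE[OF assms(1)] by blast
  obtain g where g: "dfun g" "bij_betw g B C" "\<And>x y. x \<in> B \<Longrightarrow> y \<in> B \<Longrightarrow> r' x y \<longleftrightarrow> r'' (g x) (g y)"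
    using isoE[OF assms(2)] by blast
  show ?thesis
    by (rule isoI[where f = "\<lambda>x. g (f x)"])
      (use assms f g dfun_comp bij_betw_trans[OF f(2) g(2)] bij_betw_apply[OF f(2)]
        in \<open>auto simp: comp_def\<close>)
qed

lemma iso_cong_rel: "(\<And>x y. x \<in> A \<Longrightarrow> y \<in> A \<Longrightarrow> r x y \<longleftrightarrow> q x y) \<Longrightarrow> iso (A, r) P \<longleftrightarrow> iso (A, q) P"
  unfolding iso_def by simp

subsection \<open>Natural numbers\<close>

abbreviation succ :: "'v::zf \<Rightarrow> 'v" where "succ n \<equiv> ins n n"

lemma is_inductive_iff: "is_inductive I \<longleftrightarrow> zero \<in> elts I \<and> (\<forall>y\<in>elts I. succ y \<in> elts I)"
  unfolding is_inductive_def mem_iff by (metis elts_ins elts_inject)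

lemma small_Omega: "small Omega"
proof -
  obtain I :: 'a where "is_inductive I"
  proof -
    obtain x :: 'a where x: "\<exists>e. e \<^bold>\<in> x \<and> (\<forall>z. \<not> z \<^bold>\<in> e)"
      "\<forall>y. y \<^bold>\<in> x \<longrightarrow> (\<exists>t. t \<^bold>\<in> x \<and> (\<forall>w. w \<^bold>\<in> t \<longleftrightarrow> w \<^bold>\<in> y \<or> w = y))" using infinity by blast
    have "zero \<^bold>\<in> x" using x(1) by (metis elts_zero empty_iff extensionality mem_iff)
    moreover have "succ y \<in> elts x" if y: "y \<in> elts x" for y
    proof -
      obtain t where t: "t \<^bold>\<in> x" "\<forall>w. w \<^bold>\<in> t \<longleftrightarrow> w \<^bold>\<in> y \<or> w = y" using x(2) y by (auto simp: mem_iff)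
      then have "elts t = elts (succ y)" by (auto simp: mem_iff)
      then have "t = succ y" unfolding elts_inject .
      then show ?thesis using t(1) by (simp add: mem_iff)
    qed
    ultimately show ?thesis using that unfolding is_inductive_iff mem_iff by blast
  qed
  then show ?thesis
  proof (intro small_sub[of "elts I" Omega])
    show "fo (\<lambda>s :: nat \<Rightarrow> 'a. s 0 \<in> Omega)"
      unfolding Omega_def is_inductive_iff by (intro fo)
  qed (auto simp: Omega_def mem_iff)
qed

declare small_Omega [fo, simp]

lemma zero_Omega [simp]: "zero \<in> Omega" by (auto simp: Omega_def is_inductive_iff mem_iff)

lemma succ_Omega [simp]: "n \<in> Omega \<Longrightarrow> succ n \<in> Omega"
  by (auto simp: Omega_def is_inductive_iff mem_iff)

text \<open>The numbers with property \<open>P\<close> have to form an inductive element of the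
  model, which separation yields only for definable \<open>P\<close>. As \<open>Omega\<close> may
  contain nonstandard elements, the restriction is genuine.\<close>

lemma Omega_induct [consumes 1, case_names definable zero succ]:
  assumes "n \<in> Omega" "fo (\<lambda>s. P (s 0))" "P zero" "\<And>n. n \<in> Omega \<Longrightarrow> P n \<Longrightarrow> P (succ n)"
  shows "P n"
proof -
  have "small {n \<in> Omega. P n}" by (rule small_sub[OF small_Omega]) (intro fo assms(2), auto)
  then obtain I where I: "elts I = {n \<in> Omega. P n}" by (auto simp: small_def)
  then have "is_inductive I" using assms(3,4) by (auto simp: is_inductive_iff)
  then show ?thesis using assms(1) I by (auto simp: Omega_def mem_iff)
qed

lemma Omega_mem: "n \<in> Omega \<Longrightarrow> elts n \<subseteq> Omega"
  by (induction n rule: Omega_induct) (auto intro!: fo)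

lemma Omega_trans: "n \<in> Omega \<Longrightarrow> \<forall>m\<in>elts n. elts m \<subseteq> elts n"
  by (induction n rule: Omega_induct) (auto intro!: fo)

lemma not_mem_self [simp]: "n \<notin> elts n"
  using foundation[of n "upair n n"] by (auto simp: mem_iff elts_upair)

lemma zero_least: "n \<in> Omega \<Longrightarrow> n = zero \<or> zero \<in> elts n"
  by (induction n rule: Omega_induct) (auto intro!: fo)

lemma succ_mono: "n \<in> Omega \<Longrightarrow> \<forall>m\<in>elts n. succ m \<in> elts n \<or> succ m = n"
  by (induction n rule: Omega_induct) (auto intro!: fo)

lemma Omega_tri:
  assumes "m \<in> Omega" "n \<in> Omega" shows "m \<in> elts n \<or> m = n \<or> n \<in> elts m"
proof -
  have "\<forall>n\<in>Omega. m \<in> elts n \<or> m = n \<or> n \<in> elts m"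
    using assms(1)
  proof (induction m rule: Omega_induct)
    case definable show ?case by (intro fo)
  next
    case zero show ?case using zero_least by blast
  next
    case (succ m) then show ?case using succ_mono by (metis elts_ins insertCI)
  qed
  then show ?thesis using assms by blast
qed

lemma Omega_less_trans: "n \<in> Omega \<Longrightarrow> m \<in> elts n \<Longrightarrow> k \<in> elts m \<Longrightarrow> k \<in> elts n"
  using Omega_trans by blast

lemma Omega_asym: "n \<in> Omega \<Longrightarrow> m \<in> elts n \<Longrightarrow> n \<notin> elts m"
  using Omega_trans not_mem_self by blast

text \<open>If \<open>A\<close> had no least element, induction on \<open>n\<close> would show that
  no predecessor of \<open>n\<close> belongs to \<open>A\<close>.\<close>

lemma Omega_least:
  assumes "fo (\<lambda>s. s 0 \<in> A)" "A \<subseteq> Omega" "A \<noteq> {}"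
  shows "\<exists>n\<in>A. \<forall>m\<in>A. m = n \<or> n \<in> elts m"
proof (rule ccontr)
  assume c: "\<not> ?thesis"
  have "\<forall>m\<in>elts n. m \<notin> A" if "n \<in> Omega" for n
    using that
  proof (induction n rule: Omega_induct)
    case definable show ?case by (intro fo fo1[OF assms(1)])
  next
    case (succ n)
    have "n \<notin> A"
    proof
      assume "n \<in> A"
      then obtain m where "m \<in> A" "m \<noteq> n" "n \<notin> elts m" using c by blast
      then show False using Omega_tri[of m n] assms(2) succ by auto
    qed
    then show ?case using succ by auto
  qed auto
  then show False using assms(2,3) succ_Omega by (metis all_not_in_conv elts_ins insertCI subsetD)
qed

subsection \<open>Finite sets\<close>

text \<open>Kuratowski finiteness. It is a first-order formula that mentions neither numbers nor
  bijections, and the induction principle \<open>fin_induct\<close> is built into it.\<close>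

definition kfinite :: "'v::zf \<Rightarrow> bool" where
  "kfinite x \<longleftrightarrow> (\<forall>S. zero \<in> elts S \<and> (\<forall>y\<in>elts S. \<forall>a\<in>elts x. ins a y \<in> elts S) \<longrightarrow> x \<in> elts S)"

text \<open>The version for classes; the extension is spelled out so that \<open>fin (A s)\<close>
  is definable whenever \<open>A\<close> is (\<open>fo_fin\<close>).\<close>

definition fin :: "'v::zf set \<Rightarrow> bool" where
  "fin A \<longleftrightarrow> (\<exists>x. (\<forall>z. z \<in> elts x \<longleftrightarrow> z \<in> A) \<and> kfinite x)"

lemma fo_fin [fo]:
  assumes "fo (\<lambda>s. s 0 \<in> A (\<lambda>n. s (Suc n)))" shows "fo (\<lambda>s. fin (A s))"
proof -
  have "fo (\<lambda>s. s 0 \<in> A (\<lambda>n. s (Suc (Suc n))))"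
    using fo_rename[OF assms, of "\<lambda>n. case n of 0 \<Rightarrow> 0 | Suc m \<Rightarrow> Suc (Suc m)"] by simp
  then show ?thesis unfolding fin_def kfinite_def by (intro fo)
qed

lemma fin_sm: "fin A \<Longrightarrow> small A"
  by (auto simp: fin_def small_def)

lemma fin_iff: "fin A \<longleftrightarrow> (\<exists>x. elts x = A \<and> kfinite x)"
  by (auto simp: fin_def)

lemma fin_induct [consumes 1, case_names definable empty insert]:
  assumes A: "fin A" and P: "fo (\<lambda>s. P (elts (s 0)))" and "P {}"
    and step: "\<And>B a. small B \<Longrightarrow> B \<subseteq> A \<Longrightarrow> a \<in> A \<Longrightarrow> P B \<Longrightarrow> P (insert a B)"
  shows "P A"
proof -
  obtain x where x: "elts x = A" "kfinite x" using A by (auto simp: fin_iff)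
  have "small {y. elts y \<subseteq> A \<and> P (elts y)}"
    by (rule small_sub[OF small_Pow[OF fin_sm[OF A]]]) (intro fo P fin_sm A, auto)
  then obtain S where S: "elts S = {y. elts y \<subseteq> A \<and> P (elts y)}" by (auto simp: small_def)
  have "x \<in> elts S" using x(2) unfolding kfinite_def
    by (elim allE[of _ S] mp) (auto simp: S assms x intro!: step)
  then show ?thesis using S x by auto
qed

lemma fin_empty [simp]: "fin {}"
  unfolding fin_iff kfinite_def by (rule exI[of _ zero]) auto

lemma fin_insert: "fin A \<Longrightarrow> fin (insert a A)"
proof -
  assume "fin A"
  then obtain x where x: "elts x = A" "kfinite x" by (auto simp: fin_iff)
  have "kfinite (ins a x)" unfolding kfinite_def
  proof (intro allI impI)
    fix S assume S: "zero \<in> elts S \<and> (\<forall>y\<in>elts S. \<forall>b\<in>elts (ins a x). ins b y \<in> elts S)"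
    then have "x \<in> elts S" using x unfolding kfinite_def by auto
    then show "ins a x \<in> elts S" using S by auto
  qed
  then show ?thesis unfolding fin_iff using x by (metis elts_ins)
qed

lemma fin_subset:
  assumes "fin A" "B \<subseteq> A" "fo (\<lambda>s. s 0 \<in> B)" shows "fin B"
proof -
  have "fin (A \<inter> B)" using assms(1)
  proof (induction rule: fin_induct)
    case definable show ?case by (intro fo assms)
  next
    case (insert C a)
    then show ?case by (cases "a \<in> B") (auto simp: fin_insert)
  qed simp
  then show ?thesis using assms(2) by (simp add: inf.absorb2)
qed

lemma fin_sub: "fin A \<Longrightarrow> B \<subseteq> A \<Longrightarrow> small B \<Longrightarrow> fin B"
  by (rule fin_subset) (auto intro: fo)

lemma fin_Un: 
  assumes "fin A" "fin B" shows "fin (A \<union> B)"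
  using assms(1)
proof (induction rule: fin_induct)
  case definable show ?case by (intro fo fin_sm assms)
qed (auto simp: fin_insert assms)

lemma fin_image:
  assumes "fin A" "dfun f" shows "fin (f ` A)"
  using assms(1)
proof (induction rule: fin_induct)
  case definable show ?case unfolding image_def by (intro fo fot_dfun[OF assms(2)])
qed (auto simp: fin_insert)

lemma fin_inj:
  assumes "inj_on f A" "small A" "dfun f" "fin (f ` A)" shows "fin A"
proof -
  have "fin (dinv A f ` f ` A)" by (intro fin_image assms dfun_dinv)
  moreover have "dinv A f ` f ` A = A" using dinv_f[OF assms(1)] by (force simp: image_iff)
  ultimately show ?thesis by simp
qed

lemma fin_max:
  assumes A: "fin A" "A \<noteq> {}" and r: "fo (\<lambda>s. r (s 0) (s (Suc 0)))" and l: "linear (A, r)"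
  shows "\<exists>m\<in>A. \<forall>x\<in>A. x = m \<or> r x m"
proof -
  have "A = {} \<or> (\<exists>m\<in>A. \<forall>x\<in>A. x = m \<or> r x m)" using A(1)
  proof (induction rule: fin_induct)
    case definable
    have "fo (\<lambda>s. \<not> (\<exists>x. x \<in> elts (s 0)) \<or> (\<exists>m\<in>elts (s 0). \<forall>x\<in>elts (s 0). x = m \<or> r x m))"
      by (intro fo fo2[OF r])
    then show ?case by (simp add: ex_in_conv)
  next
    case (insert B a)
    show ?case
    proof (cases "B = {}")
      case False
      then obtain m where m: "m \<in> B" "\<forall>x\<in>B. x = m \<or> r x m" using insert by blast
      then have "m \<in> A" using insert by auto
      then consider "a = m \<or> r a m" | "r m a" using linear_total[OF l, of a m] insert by blast
      then show ?thesis
      proof cases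
        case 1 then show ?thesis using m by auto
      next
        case 2
        have "r x a" if "x \<in> B" for x
          using m(2) that 2 linear_trans[OF l, of x m a] insert(2,3) \<open>m \<in> A\<close> by (metis subsetD)
        then show ?thesis by auto
      qed
    qed auto
  qed simp
  then show ?thesis using A by blast
qed

lemma fin_min:
  assumes A: "fin A" "A \<noteq> {}" and r: "fo (\<lambda>s. r (s 0) (s (Suc 0)))" and l: "linear (A, r)"
  shows "\<exists>m\<in>A. \<forall>x\<in>A. x = m \<or> r m x"
proof (rule fin_max[OF A, of "\<lambda>x y. r y x"])
  show "fo (\<lambda>s. r (s (Suc 0)) (s 0))" by (intro fo2[OF r] fo)
  show "linear (A, \<lambda>x y. r y x)" using l by (rule linear_rev)
qed

lemma linear_Omega: "linear (Omega, \<lambda>x y. x \<in> elts y)"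
  by (rule linearI) (use Omega_less_trans Omega_tri in \<open>auto, blast\<close>)

lemma fin_Omega_elem: "n \<in> Omega \<Longrightarrow> fin (elts n)"
  by (induction n rule: Omega_induct) (auto simp: fin_insert intro!: fo)

lemma not_fin_Omega: "\<not> fin Omega"
proof
  assume "fin (Omega :: 'a set)"
  then obtain m :: 'a where "m \<in> Omega" "\<forall>x\<in>Omega. x = m \<or> x \<in> elts m"
    using fin_max[OF _ _ _ linear_Omega] zero_Omega fo_elts[OF fot_var fot_var] by blast
  then have "succ m = m \<or> succ m \<in> elts m" by simp
  then show False using Omega_asym[OF \<open>m \<in> Omega\<close>, of "succ m"] not_mem_self[of m]
    by (metis elts_ins insertCI)
qed

section \<open>Definable relations; isomorphisms as elements of the model\<close>

definition drel :: "('v::zf \<Rightarrow> 'v \<Rightarrow> bool) \<Rightarrow> bool" where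
  "drel r \<longleftrightarrow> fo (\<lambda>s. r (s 0) (s (Suc 0)))"

lemma fo_drel: "drel r \<Longrightarrow> fot t \<Longrightarrow> fot u \<Longrightarrow> fo (\<lambda>s. r (t s) (u s))"
  unfolding drel_def by (rule fo2)

lemma drel_rev: "drel r \<Longrightarrow> drel (\<lambda>x y. r y x)"
  unfolding drel_def[of "\<lambda>x y. r y x"] by (intro fo_drel fo)

lemma drel_mem: "drel (\<^bold>\<in>)" unfolding drel_def by (intro fo)

lemma linear_mem: "linear (Omega, (\<^bold>\<in>))"
  using linear_Omega by (simp add: mem_iff[abs_def])

text \<open>The witness of \<open>iso\<close> made explicit, with \<open>ap\<close> in place of
  \<open>app\<close>, so that a unique isomorphism can be named by a definable description.\<close>

definition giso :: "'v::zf \<Rightarrow> 'v set \<Rightarrow> ('v \<Rightarrow> 'v \<Rightarrow> bool) \<Rightarrow> 'v set \<Rightarrow> ('v \<Rightarrow> 'v \<Rightarrow> bool) \<Rightarrow> bool" where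
  "giso g A r B r' \<longleftrightarrow> bijection g A B \<and> (\<forall>x\<in>A. \<forall>y\<in>A. r x y \<longleftrightarrow> r' (ap g x) (ap g y))"

lemma iso_giso: "iso (A, r) (B, r') \<longleftrightarrow> (\<exists>g. giso g A r B r')"
  unfolding iso_def giso_def using bijE(2) by (metis (no_types, lifting) fst_conv snd_conv)

lemma bijection_iff:
  "bijection g A B \<longleftrightarrow> (\<forall>z\<in>elts g. \<exists>x\<in>A. \<exists>y\<in>B. z = opair x y) \<and> (\<forall>x\<in>A. \<exists>!y. opair x y \<in> elts g) \<and>
     (\<forall>y\<in>B. \<exists>!x. x \<in> A \<and> ap g x = y)"
proof -
  have 1: "maps g A B \<longleftrightarrow> (\<forall>z\<in>elts g. \<exists>x\<in>A. \<exists>y\<in>B. z = opair x y) \<and> (\<forall>x\<in>A. \<exists>!y. opair x y \<in> elts g)"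
    unfolding maps_def mem_iff by blast
  have 2: "bij_betw (app g) A B \<longleftrightarrow> (\<forall>y\<in>B. \<exists>!x. x \<in> A \<and> ap g x = y)" if m: "maps g A B"
  proof -
    have "bij_betw (app g) A B \<longleftrightarrow> bij_betw (ap g) A B"
      by (rule bij_betw_cong) (rule maps_ap(1)[OF m])
    also have "\<dots> \<longleftrightarrow> (\<forall>y\<in>B. \<exists>!x. x \<in> A \<and> ap g x = y)"
    proof
      assume "bij_betw (ap g) A B"
      then show "\<forall>y\<in>B. \<exists>!x. x \<in> A \<and> ap g x = y" by (fastforce simp: bij_betw_def inj_on_def)
    next
      assume *: "\<forall>y\<in>B. \<exists>!x. x \<in> A \<and> ap g x = y"
      show "bij_betw (ap g) A B" unfolding bij_betw_def inj_on_def
        using * maps_ap(3)[OF m] by blast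
    qed
    finally show ?thesis .
  qed
  show ?thesis unfolding bijection_def using 1 2 by blast
qed

lemma fo_set:
  assumes "fo (\<lambda>s. s 0 \<in> A (\<lambda>n. s (Suc n)))"
  shows "fot t \<Longrightarrow> fo (\<lambda>s. t s \<in> A s)"
    and "fo (\<lambda>s. s 0 \<in> A (\<lambda>n. s (Suc (Suc n))))"
  using fo_subst[of "\<lambda>x s. x \<in> A s" t] assms
    fo_rename[OF assms, of "\<lambda>n. case n of 0 \<Rightarrow> 0 | Suc m \<Rightarrow> Suc (Suc m)"] by auto

lemma fo_giso:
  assumes A: "fo (\<lambda>s. s 0 \<in> A (\<lambda>n. s (Suc n)))" and B: "fo (\<lambda>s. s 0 \<in> B (\<lambda>n. s (Suc n)))"
    and r: "drel r" "drel r'" and g: "fot g"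
  shows "fo (\<lambda>s. giso (g s) (A s) r (B s) r')"
proof -
  note A1 = fo_set(2)[OF A] note A2 = fo_set(2)[OF A1] note A3 = fo_set(2)[OF A2]
  note B1 = fo_set(2)[OF B] note B2 = fo_set(2)[OF B1] note B3 = fo_set(2)[OF B2]
  have "fo (\<lambda>s. giso (s 0) (A (\<lambda>n. s (Suc n))) r (B (\<lambda>n. s (Suc n))) r')"
    unfolding giso_def bijection_iff
    by (intro fo fo_set(1)[OF A1] fo_set(1)[OF A2] fo_set(1)[OF A3] A A1 A2 A3
      fo_set(1)[OF B1] fo_set(1)[OF B2] fo_set(1)[OF B3] B B1 B2 B3 fo_drel[OF r(1)] fo_drel[OF r(2)])
  then show ?thesis by (rule fo_subst[of "\<lambda>x s. giso x (A s) r (B s) r'", OF _ g])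
qed

lemma fo_iso:
  assumes A: "fo (\<lambda>s. s 0 \<in> A (\<lambda>n. s (Suc n)))" and B: "fo (\<lambda>s. s 0 \<in> B (\<lambda>n. s (Suc n)))"
    and r: "drel r" "drel r'"
  shows "fo (\<lambda>s. iso (A s, r) (B s, r'))"
  unfolding iso_giso by (rule fo_ex) (intro fo_giso r fo fo_set[OF A] fo_set[OF B])

lemma giso_bij: "giso g A r B r' \<Longrightarrow> bij_betw (ap g) A B"
  and giso_ord: "giso g A r B r' \<Longrightarrow> x \<in> A \<Longrightarrow> y \<in> A \<Longrightarrow> r x y \<longleftrightarrow> r' (ap g x) (ap g y)"
  unfolding giso_def using bijE by blast+

lemma giso_eqI:
  assumes "giso g A r B r'" "giso h A r B r'" "\<And>x. x \<in> A \<Longrightarrow> ap g x = ap h x" shows "g = h"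
  by (rule maps_ext[of g A B h B]) (use assms in \<open>auto simp: giso_def bijection_def\<close>)

subsection \<open>Orders in which every element has finitely many predecessors\<close>

definition below :: "('v::zf \<Rightarrow> 'v \<Rightarrow> bool) \<Rightarrow> 'v set \<Rightarrow> 'v \<Rightarrow> 'v set" where
  "below r E x = {z \<in> E. r z x}"

text \<open>By \<open>omega_like_iso\<close>, the linear orders with this property are the finite
  ones and those of type \<omega>.\<close>

definition omega_like :: "('v::zf \<Rightarrow> 'v \<Rightarrow> bool) \<Rightarrow> 'v set \<Rightarrow> bool" where
  "omega_like r E \<longleftrightarrow> (\<forall>x\<in>E. fin (below r E x))"

lemma omega_like_least:
  assumes r: "drel r" and E: "linear (E, r)" "small E" "omega_like r E" and A: "A \<subseteq> E" "A \<noteq> {}" "fo (\<lambda>s. s 0 \<in> A)"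
  shows "\<exists>m\<in>A. \<forall>x\<in>A. x = m \<or> r m x"
proof -
  obtain x where x: "x \<in> A" using A by blast
  let ?B = "insert x (below r A x)"
  have "fin ?B"
  proof (rule fin_subset)
    show "fin (insert x (below r E x))" using E(3) x A(1) by (auto simp: omega_like_def intro: fin_insert)
    show "fo (\<lambda>s. s 0 \<in> ?B)" unfolding below_def by (intro fo fo_drel[OF r] A(3))
  qed (use A(1) in \<open>auto simp: below_def\<close>)
  then obtain m where m: "m \<in> ?B" "\<forall>y\<in>?B. y = m \<or> r m y"
    using fin_min[of ?B r] linear_sub[OF E(1), of ?B] r A(1) x unfolding drel_def below_def by blast
  have mA: "m \<in> A" using m(1) x by (auto simp: below_def)
  have "y = m \<or> r m y" if y: "y \<in> A" for y
  proof (cases "y \<in> ?B")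
    case False
    then have "r x y" using linear_total[OF E(1), of x y] x y A(1) by (auto simp: below_def)
    then show ?thesis using linear_trans[OF E(1), of m x y] m(2) mA x y A(1) by auto
  qed (use m in blast)
  then show ?thesis using mA by blast
qed

lemma omega_like_Omega: "omega_like (\<^bold>\<in>) Omega"
proof -
  have "below (\<^bold>\<in>) Omega x = elts x" if "x \<in> Omega" for x :: 'a
    using Omega_mem[OF that] by (auto simp: below_def mem_iff)
  then show ?thesis by (simp add: omega_like_def fin_Omega_elem)
qed

lemma omega_like_sub: 
  assumes "drel r" "omega_like r E" "small A" "A \<subseteq> E" shows "omega_like r A"
  unfolding omega_like_def
proof
  fix x assume x: "x \<in> A"
  show "fin (below r A x)"
  proof (rule fin_subset)
    show "fin (below r E x)" using assms x by (auto simp: omega_like_def)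
    show "fo (\<lambda>s. s 0 \<in> below r A x)" unfolding below_def by (intro fo fo_drel[OF assms(1)] assms)
  qed (use assms in \<open>auto simp: below_def\<close>)
qed

text \<open>At the least point \<open>m\<close> of disagreement one of the two values, say that of
  \<open>g\<close>, is smaller. As \<open>h\<close> is onto, it attains this value at a point below
  \<open>m\<close>, where \<open>g\<close> and \<open>h\<close> agree; this contradicts the
  injectivity of \<open>g\<close>.\<close>

lemma giso_unique:
  assumes r: "drel r" and E: "linear (E, r)" "small E" "omega_like r E" and E': "linear (E', r')"
    and g: "giso g E r E' r'" and h: "giso h E r E' r'"
  shows "g = h"
proof (rule giso_eqI[OF g h], rule ccontr)
  fix x assume "x \<in> E" "ap g x \<noteq> ap h x"
  let ?A = "{x \<in> E. ap g x \<noteq> ap h x}"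
  have "\<exists>m\<in>?A. \<forall>x\<in>?A. x = m \<or> r m x"
    by (rule omega_like_least[OF r E]) (use \<open>x \<in> E\<close> \<open>ap g x \<noteq> ap h x\<close> in \<open>auto intro!: fo E\<close>)
  then obtain m where m: "m \<in> E" "ap g m \<noteq> ap h m"
    "\<And>x. x \<in> E \<Longrightarrow> r x m \<Longrightarrow> ap g x = ap h x"
    using linear_irrefl[OF E(1)] linear_trans[OF E(1)] by (smt (verit, ccfv_threshold) mem_Collect_eq)
  have False if gh: "giso g E r E' r'" "giso h E r E' r'" "\<And>x. x \<in> E \<Longrightarrow> r x m \<Longrightarrow> ap g x = ap h x"
    and l: "r' (ap g m) (ap h m)" for g h
  proof -
    obtain z where z: "z \<in> E" "ap h z = ap g m"
      using giso_bij[OF gh(1)] giso_bij[OF gh(2)] m(1) by (metis bij_betw_iff_bijections)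
    then have "r z m" using giso_ord[OF gh(2), of z m] l m(1) by simp
    then have "ap g z = ap g m" using gh(3) z by simp
    then have "z = m" using giso_bij[OF gh(1)] z(1) m(1) by (auto simp: bij_betw_def dest: inj_onD)
    then show False using \<open>r z m\<close> linear_irrefl[OF E(1)] m(1) by blast
  qed
  moreover have "ap g m \<in> E'" "ap h m \<in> E'"
    using bij_betw_apply[OF giso_bij[OF g]] bij_betw_apply[OF giso_bij[OF h]] m by auto
  ultimately show False
    using linear_total[OF E', of "ap g m" "ap h m"] m g h by (metis (no_types, lifting))
qed

text \<open>An isomorphism \<open>f\<close> from the larger number to the smaller one moves some
  point down. If \<open>x\<close> is the least point moved down, then \<open>f x\<close> is moved
  down as well.\<close>

lemma iso_Omega_eq:
  assumes "m \<in> Omega" "n \<in> Omega" "iso (elts m, (\<^bold>\<in>)) (elts n, (\<^bold>\<in>))" shows "m = n"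
proof -
  have no: False if mn: "m \<in> Omega" "n \<in> Omega" "m \<in> elts n" and i: "iso (elts n, (\<^bold>\<in>)) (elts m, (\<^bold>\<in>))" for m n :: 'a
  proof -
    obtain f where f: "dfun f" "bij_betw f (elts n) (elts m)"
      "\<And>x y. x \<in> elts n \<Longrightarrow> y \<in> elts n \<Longrightarrow> x \<^bold>\<in> y \<longleftrightarrow> f x \<^bold>\<in> f y" using isoE[OF i] by blast
    let ?A = "{x \<in> elts n. f x \<in> elts x}"
    have fn: "f x \<in> elts m" if "x \<in> elts n" for x using bij_betw_apply[OF f(2) that] .
    have mn': "elts m \<subseteq> elts n" using Omega_trans mn by blast
    have "\<exists>x\<in>?A. \<forall>y\<in>?A. y = x \<or> x \<in> elts y"
      by (rule Omega_least)
        (use fn mn Omega_mem in \<open>auto intro!: fo fot_dfun[OF f(1)]\<close>)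
    then obtain x where x: "x \<in> elts n" "f x \<in> elts x" "\<And>y. y \<in> ?A \<Longrightarrow> y = x \<or> x \<in> elts y" by blast
    have "f x \<in> elts n" using fn x mn' by blast
    then have "f x \<in> ?A" using f(3)[of "f x" x] x by (simp add: mem_iff)
    then show False using x(1,2) x(3)[of "f x"] Omega_asym[of x "f x"] Omega_mem[OF mn(2)] by auto
  qed
  show ?thesis
    using no[of m n] no[of n m] Omega_tri[OF assms(1,2)] assms iso_sym[OF assms(3)] by auto
qed

section \<open>Ranks, and the types of orders with finite initial segments\<close>

definition rank :: "('v::zf \<Rightarrow> 'v \<Rightarrow> bool) \<Rightarrow> 'v set \<Rightarrow> 'v \<Rightarrow> 'v" where
  "rank r E x = the0 (\<lambda>k. k \<in> Omega \<and> iso (below r E x, r) (elts k, (\<^bold>\<in>)))"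

lemma dfun_rk:
  assumes "drel r" "small E" shows "dfun (rank r E)"
  unfolding rank_def below_def
  by (rule dfunI) (intro fo fo_iso assms drel_mem fo_drel[OF assms(1)])

context
  fixes r :: "'v::zf \<Rightarrow> 'v \<Rightarrow> bool" and E
  assumes r: "drel r" and E: "linear (E, r)" "small E" "omega_like r E"
begin

lemma small_lo: "small (below r E x)"
  by (rule small_sub[OF E(2)]) (auto simp: below_def intro!: fo E fo_drel[OF r])

text \<open>At a least counterexample \<open>m\<close> the finite set of predecessors is empty or
  has a last element \<open>y\<close>; in the second case the rank of \<open>m\<close> is the
  successor of the rank of \<open>y\<close>.\<close>

lemma rank_ex: 
  assumes "x \<in> E" shows "\<exists>k\<in>Omega. iso (below r E x, r) (elts k, (\<^bold>\<in>))"
proof (rule ccontr)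
  assume n: "\<not> ?thesis"
  let ?A = "{x \<in> E. \<not> (\<exists>k\<in>Omega. iso (below r E x, r) (elts k, (\<^bold>\<in>)))}"
  have "fo (\<lambda>s. s 0 \<in> ?A)" unfolding below_def
    by (intro fo fo_iso E drel_mem fo_drel[OF r] r)
  then obtain m where m: "m \<in> ?A" "\<And>x. x \<in> ?A \<Longrightarrow> x = m \<or> r m x"
    using omega_like_least[OF r E, of ?A] n assms by blast
  then have mE: "m \<in> E" by simp
  show False
  proof (cases "below r E m = {}")
    case True
    have "iso (below r E m, r) (elts zero, (\<^bold>\<in>))"
      by (rule isoI[where f = "\<lambda>x. x"]) (auto simp: True bij_betw_def intro: dfunI fo)
    then show False using m(1) zero_Omega by blast
  next
    case False
    then obtain y where y: "y \<in> below r E m" "\<And>x. x \<in> below r E m \<Longrightarrow> x = y \<or> r x y"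
      using fin_max[of "below r E m" r] E(3) mE linear_sub[OF E(1), of "below r E m"] r
      unfolding omega_like_def drel_def below_def by blast
    have yE: "y \<in> E" "r y m" using y(1) by (auto simp: below_def)
    have "y \<notin> ?A" using m(2)[of y] yE linear_irrefl[OF E(1) mE] linear_trans[OF E(1), of m y m] mE by blast
    then obtain k where k: "k \<in> Omega" "iso (below r E y, r) (elts k, (\<^bold>\<in>))" using yE by blast
    then obtain f where f: "dfun f" "bij_betw f (below r E y) (elts k)"
      "\<And>u v. u \<in> below r E y \<Longrightarrow> v \<in> below r E y \<Longrightarrow> r u v \<longleftrightarrow> f u \<^bold>\<in> f v" using isoE by blast
    have eq: "below r E m = insert y (below r E y)"
      using y yE linear_trans[OF E(1) _ yE(2)] mE by (auto simp: below_def)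
    have nl: "y \<notin> below r E y" using linear_irrefl[OF E(1)] by (auto simp: below_def)
    let ?f = "\<lambda>x. if x = y then k else f x"
    have fk: "f x \<in> elts k" if "x \<in> below r E y" for x using bij_betw_apply[OF f(2) that] .
    have "iso (below r E m, r) (elts (succ k), (\<^bold>\<in>))"
    proof (rule isoI)
      show "dfun ?f" by (rule dfunI) (intro fo fot_dfun[OF f(1)])
      have "bij_betw ?f (below r E y) (elts k)"
        using f(2) nl by (subst bij_betw_cong[of _ _ f]) auto
      then show "bij_betw ?f (below r E m) (elts (succ k))"
        unfolding eq elts_ins using bij_betw_combine[of ?f "{y}" "{k}" "below r E y" "elts k"] by auto
      fix u v assume "u \<in> below r E m" "v \<in> below r E m"
      then consider "u \<in> below r E y" "v \<in> below r E y" | "u = y" "v = y" | "u \<in> below r E y" "v = y" | "u = y" "v \<in> below r E y"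
        unfolding eq by blast
      then show "r u v \<longleftrightarrow> ?f u \<^bold>\<in> ?f v"
      proof cases
        case 1 then show ?thesis using f(3) nl by auto
      next
        case 2 then show ?thesis using linear_irrefl[OF E(1) yE(1)] by (simp add: mem_iff)
      next
        case 3 then show ?thesis using fk[of u] nl by (auto simp: mem_iff below_def)
      next
        case 4
        then have "\<not> r u v" using linear_trans[OF E(1), of y v y] linear_irrefl[OF E(1) yE(1)] yE
          by (auto simp: below_def)
        moreover have "k \<notin> elts (f v)" using fk[OF 4(2)] Omega_asym[OF k(1)] by blast
        ultimately show ?thesis using 4 nl by (auto simp: mem_iff)
      qed
    qed (rule small_lo)
    then show False using m(1) succ_Omega[OF k(1)] by blast
  qed
qed

lemma rank_eq:
  assumes "x \<in> E" "k \<in> Omega" "iso (below r E x, r) (elts k, (\<^bold>\<in>))" shows "rank r E x = k"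
  unfolding rank_def
proof (rule the0_eq)
  fix y assume "y \<in> Omega \<and> iso (below r E x, r) (elts y, (\<^bold>\<in>))"
  then show "y = k" using iso_Omega_eq[of y k] iso_trans[OF iso_sym[of _ _ "elts y"] assms(3)] small_lo assms(2) by auto
qed (use assms in blast)

lemma rank_iso: "x \<in> E \<Longrightarrow> rank r E x \<in> Omega \<and> iso (below r E x, r) (elts (rank r E x), (\<^bold>\<in>))"
  using rank_ex rank_eq by metis

lemma rank_lower:
  assumes "y \<in> E" shows "rank r E ` below r E y = elts (rank r E y)"
proof -
  let ?k = "rank r E y"
  have k: "?k \<in> Omega" using rank_iso assms by blast
  obtain f where f: "dfun f" "bij_betw f (below r E y) (elts ?k)"
    "\<And>u v. u \<in> below r E y \<Longrightarrow> v \<in> below r E y \<Longrightarrow> r u v \<longleftrightarrow> f u \<^bold>\<in> f v" using isoE rank_iso[OF assms] by blast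
  have "rank r E x = f x" if x: "x \<in> below r E y" for x
  proof (rule rank_eq)
    have fx: "f x \<in> elts ?k" using bij_betw_apply[OF f(2) x] .
    show "x \<in> E" using x by (simp add: below_def)
    show "f x \<in> Omega" using fx Omega_mem k by blast
    have sub: "below r E x \<subseteq> below r E y" using linear_trans[OF E(1)] x assms by (auto simp: below_def)
    have "f ` below r E x = elts (f x)"
    proof
      show "f ` below r E x \<subseteq> elts (f x)" using f(3) sub x by (auto simp: below_def mem_iff)
      show "elts (f x) \<subseteq> f ` below r E x"
      proof
        fix j assume j: "j \<in> elts (f x)"
        then have "j \<in> elts ?k" using fx Omega_trans[OF k] by blast
        then obtain u where u: "u \<in> below r E y" "f u = j" using f(2) by (metis bij_betw_iff_bijections)
        then have "r u x" using f(3)[of u x] x j by (simp add: mem_iff)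
        then show "j \<in> f ` below r E x" using u by (auto simp: below_def)
      qed
    qed
    then have "bij_betw f (below r E x) (elts (f x))"
      using inj_on_subset[OF bij_betw_imp_inj_on[OF f(2)] sub] by (simp add: bij_betw_def)
    then show "iso (below r E x, r) (elts (f x), (\<^bold>\<in>))"
      by (intro isoI[of f] f small_lo) (use sub in auto)
  qed
  then show ?thesis using f(2) by (simp add: bij_betw_def cong: image_cong)
qed

lemma rank_less: "x \<in> E \<Longrightarrow> y \<in> E \<Longrightarrow> r x y \<longleftrightarrow> rank r E x \<^bold>\<in> rank r E y"
  and rank_inj: "inj_on (rank r E) E"
proof -
  have 1: "rank r E x \<in> elts (rank r E y)" if "x \<in> E" "y \<in> E" "r x y" for x y
    using rank_lower[OF that(2)] that by (auto simp: below_def)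
  have 2: "rank r E x \<noteq> rank r E y" if "x \<in> E" "y \<in> E" "x \<noteq> y" for x y
    using linear_total[OF E(1) that(1,2)] 1[of x y] 1[of y x] that by auto
  show "inj_on (rank r E) E" using 2 unfolding inj_on_def by blast
  show "r x y \<longleftrightarrow> rank r E x \<^bold>\<in> rank r E y" if "x \<in> E" "y \<in> E"
  proof
    assume "rank r E x \<^bold>\<in> rank r E y"
    then have "\<not> rank r E y \<in> elts (rank r E x)" "x \<noteq> y"
      using Omega_asym[of "rank r E y"] rank_iso that by (auto simp: mem_iff)
    then show "r x y" using linear_total[OF E(1) that] 1[OF that(2,1)] by blast
  qed (use 1 that in \<open>auto simp: mem_iff\<close>)
qed

text \<open>\<open>rank\<close> is an isomorphism onto a downward closed part of
  \<open>Omega\<close>, which is all of \<open>Omega\<close> or consists of the members of the least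
  missing number.\<close>

lemma omega_like_iso:
  shows "\<not> fin E \<Longrightarrow> iso (E, r) (Omega, (\<^bold>\<in>))" and "fin E \<Longrightarrow> \<exists>k\<in>Omega. iso (E, r) (elts k, (\<^bold>\<in>))"
proof -
  have iso: "iso (E, r) (rank r E ` E, (\<^bold>\<in>))"
    by (rule isoI[OF dfun_rk[OF r E(2)] E(2)]) (use rank_less rank_inj in \<open>auto simp: bij_betw_def\<close>)
  have sO: "rank r E ` E \<subseteq> Omega" using rank_iso by blast
  have smi: "small (rank r E ` E)" by (intro small_image dfun_rk r E)
  have tr: "elts k \<subseteq> rank r E ` E" if k: "k \<in> rank r E ` E" for k
    using k rank_lower by (auto simp: below_def)
  have fin_case: "\<exists>k\<in>Omega. rank r E ` E = elts k" if ne: "rank r E ` E \<noteq> Omega"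
  proof -
    have "fo (\<lambda>s. s 0 \<in> Omega - rank r E ` E)" by (intro fo smi)
    then obtain k where k: "k \<in> Omega - rank r E ` E" "\<And>m. m \<in> Omega - rank r E ` E \<Longrightarrow> m = k \<or> k \<in> elts m"
      using Omega_least[of "Omega - rank r E ` E"] ne sO by blast
    have "rank r E ` E = elts k"
    proof
      show "elts k \<subseteq> rank r E ` E"
      proof
        fix m assume "m \<in> elts k"
        then show "m \<in> rank r E ` E" using k(2)[of m] Omega_mem k(1) Omega_asym[of k m] by auto
      qed
      show "rank r E ` E \<subseteq> elts k"
      proof
        fix m assume m: "m \<in> rank r E ` E"
        then show "m \<in> elts k" using Omega_tri[of m k] k(1) sO tr[OF m] by blast
      qed
    qed
    then show ?thesis using k by blast
  qed
  show "iso (E, r) (Omega, (\<^bold>\<in>))" if "\<not> fin E"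
  proof -
    have "rank r E ` E = Omega"
      using fin_case fin_inj[OF rank_inj E(2) dfun_rk[OF r E(2)]] fin_Omega_elem that by metis
    then show ?thesis using iso by simp
  qed
  show "\<exists>k\<in>Omega. iso (E, r) (elts k, (\<^bold>\<in>))" if "fin E"
  proof -
    have "rank r E ` E \<noteq> Omega"
      using fin_image[OF that dfun_rk[OF r E(2)]] not_fin_Omega by metis
    then show ?thesis using iso fin_case by metis
  qed
qed

end

section \<open>Thinning an order class by class\<close>

text \<open>An infinite subset of an order of type \<omega> is again of type \<omega>. Uniqueness is
  the point: it lets \<open>the0\<close> name the isomorphism.\<close>

lemma thin_unique:
  assumes r: "drel r" and E: "linear (E, r)" "small E" "omega_like r E" and X: "X \<subseteq> E" "small X" "X = E \<or> \<not> fin X"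
  shows "\<exists>!g. giso g E r X r"
proof -
  have lX: "linear (X, r)" using linear_sub[OF E(1) X(1)] .
  have wX: "omega_like r X" using omega_like_sub[OF r E(3) X(2) X(1)] .
  have "iso (E, r) (X, r)"
  proof (cases "X = E")
    case True
    show ?thesis unfolding True by (rule isoI[of "\<lambda>x. x"]) (auto intro: dfunI fo E simp: bij_betw_def)
  next
    case False
    then have nX: "\<not> fin X" using X by blast
    then have "\<not> fin E" using fin_sub X by blast
    then show ?thesis
      using iso_trans[OF omega_like_iso(1)[OF r E] iso_sym[OF omega_like_iso(1)[OF r lX X(2) wX]]] nX X(2) E(2) by blast
  qed
  then obtain g where "giso g E r X r" unfolding iso_giso by blast
  then show ?thesis using giso_unique[OF r E lX] by blast
qed

lemma giso_rev: "giso g A (\<lambda>x y. r y x) B (\<lambda>x y. r' y x) \<longleftrightarrow> giso g A r B r'"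
  unfolding giso_def by blast

lemma thin_unique':
  assumes r: "drel r" and E: "linear (E, r)" "small E" "omega_like r E \<or> omega_like (\<lambda>x y. r y x) E" and X: "X \<subseteq> E" "small X" "X = E \<or> \<not> fin X"
  shows "\<exists>!g. giso g E r X r"
  using thin_unique[OF r E(1,2) _ X] thin_unique[OF drel_rev[OF r] linear_rev[OF E(1)] E(2) _ X] E(3)
  unfolding giso_rev[of _ E r X r] by blast

text \<open>No choice is needed to glue the isomorphisms of the classes, since each of them is unique.\<close>

lemma thinning:
  assumes r: "drel r" and H: "linear (H, r)" "small H" and X: "X \<subseteq> H" "small X"
    and q: "drel q" "\<And>x. x \<in> H \<Longrightarrow> q x x" "\<And>x y. x \<in> H \<Longrightarrow> y \<in> H \<Longrightarrow> q x y \<Longrightarrow> q y x"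
      "\<And>x y z. x \<in> H \<Longrightarrow> y \<in> H \<Longrightarrow> z \<in> H \<Longrightarrow> q x y \<Longrightarrow> q y z \<Longrightarrow> q x z"
      "\<And>x y z. x \<in> H \<Longrightarrow> y \<in> H \<Longrightarrow> z \<in> H \<Longrightarrow> r x y \<Longrightarrow> r y z \<Longrightarrow> q x z \<Longrightarrow> q x y"
    and w: "\<And>x. x \<in> H \<Longrightarrow> omega_like r {y \<in> H. q x y} \<or> omega_like (\<lambda>x y. r y x) {y \<in> H. q x y}"
    and t: "\<And>x. x \<in> H \<Longrightarrow> {y \<in> H. q x y} \<subseteq> X \<or> \<not> fin {y \<in> X. q x y}"
  obtains f where "dfun f" "bij_betw f H X" "\<And>x y. x \<in> H \<Longrightarrow> y \<in> H \<Longrightarrow> r x y \<longleftrightarrow> r (f x) (f y)"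
    "\<And>x. x \<in> H \<Longrightarrow> q x (f x)"
proof -
  define f where "f x = ap (the0 (\<lambda>g. giso g {y \<in> H. q x y} r {y \<in> X. q x y} r)) x" for x
  have df: "dfun f" unfolding f_def
    by (rule dfunI) (intro fo fo_giso r H(2) X(2) fo_drel[OF q(1)])
  define G where "G x = the0 (\<lambda>g. giso g {y \<in> H. q x y} r {y \<in> X. q x y} r)" for x
  have G: "giso (G x) {y \<in> H. q x y} r {y \<in> X. q x y} r" if x: "x \<in> H" for x
  proof -
    have "\<exists>!g. giso g {y \<in> H. q x y} r {y \<in> X. q x y} r"
    proof (rule thin_unique'[OF r])
      show "small {y \<in> H. q x y}" by (rule small_sub[OF H(2)]) (auto intro!: fo H fo_drel[OF q(1)])
      show "small {y \<in> X. q x y}" by (rule small_sub[OF X(2)]) (auto intro!: fo X(2) fo_drel[OF q(1)])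
      show "linear ({y \<in> H. q x y}, r)" by (rule linear_sub[OF H(1)]) auto
      show "{y \<in> X. q x y} = {y \<in> H. q x y} \<or> \<not> fin {y \<in> X. q x y}" using t[OF x] X(1) by blast
    qed (use w[OF x] X(1) in blast)+
    then show ?thesis unfolding G_def by (rule the0_I)
  qed
  have Gq: "G x = G y" if "x \<in> H" "y \<in> H" "q x y" for x y
  proof -
    have "q x z \<longleftrightarrow> q y z" if "z \<in> H" for z using q that \<open>x \<in> H\<close> \<open>y \<in> H\<close> \<open>q x y\<close> by metis
    then have "{z \<in> H. q x z} = {z \<in> H. q y z}" "{z \<in> X. q x z} = {z \<in> X. q y z}" using X(1) by blast+
    then show ?thesis unfolding G_def by simp
  qed
  have fG: "f x = ap (G x) x" for x unfolding f_def G_def ..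
  have fX: "f x \<in> X \<and> q x (f x)" if "x \<in> H" for x
    using bij_betw_apply[OF giso_bij[OF G[OF that]], of x] that q(2) unfolding fG by blast
  have mono: "r (f x) (f y)" if xy: "x \<in> H" "y \<in> H" "r x y" for x y
  proof (cases "q x y")
    case True
    then show ?thesis
      using giso_ord[OF G[OF xy(1)], of x y] xy q(2) Gq[OF xy(1,2)] unfolding fG by auto
  next
    case False
    have fH: "f x \<in> H" "f y \<in> H" using fX xy X(1) by auto
    have nq: "\<not> q (f x) (f y)" using q fX xy fH False by metis
    then have ne: "f x \<noteq> f y" using q(2) fH by auto
    \<comment> \<open>Classes are convex and \<open>f\<close> preserves them. As \<open>x\<close>
      lies below the entire class of \<open>y\<close>, \<open>r (f y) (f x)\<close> would put
      \<open>f y\<close> between \<open>x\<close> and \<open>f x\<close>, hence into the class of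
      \<open>x\<close>.\<close>
    have "\<not> r (f y) (f x)"
    proof
      assume b: "r (f y) (f x)"
      have s1: "\<not> q u v" if "q x u" "q y v" "u \<in> H" "v \<in> H" for u v
        using q that False xy by metis
      have s2: "r x v" if v: "q y v" "v \<in> H" for v
      proof (rule ccontr)
        assume "\<not> r x v"
        then have "r v x" using linear_total[OF H(1), of x v] s1[of x v] v xy q(2) by blast
        then have "q v x" using q(5)[of v x y] v xy q(3) by blast
        then show False using s1[of x v] q v xy by blast
      qed
      have "r x (f y)" using s2 fX xy fH by blast
      then have "q x (f y)" using q(5)[OF xy(1) fH(2,1) _ b] fX xy by blast
      then show False using s1[of x "f y"] s1[of "f y" "f y"] fX xy fH q(2) by blast
    qed
    then show ?thesis using linear_total[OF H(1) fH] ne by blast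
  qed
  have ord: "r x y \<longleftrightarrow> r (f x) (f y)" if xy: "x \<in> H" "y \<in> H" for x y
  proof
    assume b: "r (f x) (f y)"
    have fH: "f x \<in> H" "f y \<in> H" using fX xy X(1) by auto
    have "\<not> r y x" using mono[of y x] xy b linear_trans[OF H(1) b, of "f x"] linear_irrefl[OF H(1)] fH by blast
    moreover have "x \<noteq> y" using b linear_irrefl[OF H(1)] fH by auto
    ultimately show "r x y" using linear_total[OF H(1) xy] by blast
  qed (use mono xy in blast)
  have "inj_on f H"
  proof (rule inj_onI)
    fix x y assume xy: "x \<in> H" "y \<in> H" "f x = f y"
    then have "f x \<in> H" using fX X(1) by auto
    then show "x = y" using linear_total[OF H(1) xy(1,2)] mono xy linear_irrefl[OF H(1)] by metis
  qed
  moreover have "f ` H = X"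
  proof
    show "f ` H \<subseteq> X" using fX by blast
    show "X \<subseteq> f ` H"
    proof
      fix y assume y: "y \<in> X"
      then have yH: "y \<in> H" using X by blast
      then obtain z where z: "z \<in> H" "q y z" "ap (G y) z = y"
        using giso_bij[OF G[OF yH]] y q(2) unfolding bij_betw_def by (smt (verit) image_iff mem_Collect_eq)
      then have "f z = y" unfolding fG using Gq[of y z] yH by simp
      then show "y \<in> f ` H" using z by blast
    qed
  qed
  ultimately show ?thesis using that[OF df _ ord] fX by (simp add: bij_betw_def)
qed

subsection \<open>Embedding countable orders into dense ones\<close>

text \<open>The forth half of Cantor's argument without choice: the points of \<open>T\<close> are
  placed in the order of \<open>j\<close>, each at the admissible place of least
  \<open>i\<close>-index. Recursion on \<open>Omega\<close> is replaced by approximations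
  \<open>p\<close> that are correct for all indices below \<open>n\<close>; they exist by a
  definable induction, and any two of them agree.\<close>

lemma dense_embedding:
  assumes T: "small T" "linear (T, rT)" "drel rT" and j: "dfun j" "inj_on j T" "j ` T \<subseteq> Omega"
    and Q: "small Q" "linear (Q, r)" "drel r" and i: "dfun i" "inj_on i Q" "i ` Q \<subseteq> Omega"
    and dense: "\<And>x y. x \<in> Q \<Longrightarrow> y \<in> Q \<Longrightarrow> r x y \<Longrightarrow> \<exists>z\<in>Q. r x z \<and> r z y"
    and ab: "a \<in> Q" "b \<in> Q" "r a b"
  obtains f where "dfun f" "\<And>t. t \<in> T \<Longrightarrow> f t \<in> Q \<and> r a (f t) \<and> r (f t) b"
    "\<And>s t. s \<in> T \<Longrightarrow> t \<in> T \<Longrightarrow> rT s t \<Longrightarrow> r (f s) (f t)"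
proof -
  define ok where "ok p t q \<longleftrightarrow> q \<in> Q \<and> r a q \<and> r q b \<and>
     (\<forall>s\<in>T. j s \<in> elts (j t) \<longrightarrow> (rT s t \<longrightarrow> r (ap p s) q) \<and> (rT t s \<longrightarrow> r q (ap p s)))" for p t q
  define good where "good p t q \<longleftrightarrow> ok p t q \<and> (\<forall>q'. ok p t q' \<longrightarrow> q' = q \<or> i q \<in> elts (i q'))" for p t q
  define appr where "appr p n \<longleftrightarrow> (\<forall>t\<in>T. j t \<in> elts n \<longrightarrow> good p t (ap p t))" for p n
  have fo_ok: "fo (\<lambda>s. ok (s 0) (s (Suc 0)) (s (Suc (Suc 0))))" unfolding ok_def
    by (intro fo T Q fo_drel[OF T(3)] fo_drel[OF Q(3)] fot_dfun[OF j(1)])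
  have fo_good: "fo (\<lambda>s. good (s 0) (s (Suc 0)) (s (Suc (Suc 0))))" unfolding good_def
    by (intro fo fo3[OF fo_ok] fot_dfun[OF i(1)])
  have fo_appr: "fo (\<lambda>s. appr (s 0) (s (Suc 0)))" unfolding appr_def
    by (intro fo T fo3[OF fo_good] fot_dfun[OF j(1)])
  have jO: "j t \<in> Omega" if "t \<in> T" for t using j that by blast
  have good_unique: "q = q'" if "good p t q" "good p t q'" for p t q q'
  proof (rule ccontr)
    assume "q \<noteq> q'"
    then have "i q \<in> elts (i q')" "i q' \<in> elts (i q)" "q \<in> Q"
      using that unfolding good_def ok_def by blast+
    then show False using Omega_asym i(3) by blast
  qed
  have good_cong: "good p t q \<longleftrightarrow> good p' t q"
    if "\<And>s. s \<in> T \<Longrightarrow> j s \<in> elts (j t) \<Longrightarrow> ap p s = ap p' s" for p p' t q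
  proof -
    have "ok p t q \<longleftrightarrow> ok p' t q" for q using that unfolding ok_def by simp
    then show ?thesis unfolding good_def by simp
  qed
  have agree: "ap p t = ap p' t"
    if p: "appr p n" "appr p' n'" and n: "n \<in> Omega" "n' \<in> Omega" and t: "t \<in> T" "j t \<in> elts n" "j t \<in> elts n'" for p p' n n' t
  proof (rule ccontr)
    assume ne: "ap p t \<noteq> ap p' t"
    let ?A = "{m \<in> Omega. \<exists>t\<in>T. j t = m \<and> m \<in> elts n \<and> m \<in> elts n' \<and> ap p t \<noteq> ap p' t}"
    have "fo (\<lambda>s. s 0 \<in> ?A)" by (intro fo T fot_dfun[OF j(1)])
    then obtain m where m: "m \<in> ?A" "\<And>k. k \<in> ?A \<Longrightarrow> k = m \<or> m \<in> elts k"
      using Omega_least[of ?A] ne t jO by blast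
    then obtain u where u: "u \<in> T" "j u = m" "m \<in> elts n" "m \<in> elts n'" "ap p u \<noteq> ap p' u" by blast
    have "ap p s = ap p' s" if s: "s \<in> T" "j s \<in> elts (j u)" for s
    proof (rule ccontr)
      assume "ap p s \<noteq> ap p' s"
      then have "j s \<in> ?A" using s u jO Omega_less_trans[OF n(1) u(3)] Omega_less_trans[OF n(2) u(4)] by auto
      then show False using m(2)[of "j s"] s u(2) Omega_asym[OF jO[OF u(1)]] by auto
    qed
    then have "good p u (ap p' u)" using good_cong[of u p p'] p(2) u unfolding appr_def by blast
    then show False using good_unique p(1) u unfolding appr_def by blast
  qed
  have mono: "r (ap p s) (ap p t)" if p: "appr p n" and st: "s \<in> T" "t \<in> T" "j s \<in> elts n" "j t \<in> elts n" "rT s t" for p n s t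
  proof -
    have "j s \<noteq> j t" using st j(2) linear_irrefl[OF T(2)] by (auto dest: inj_onD)
    then consider "j s \<in> elts (j t)" | "j t \<in> elts (j s)" using Omega_tri jO st by blast
    then show ?thesis using p st unfolding appr_def good_def ok_def by cases blast+
  qed
  have ex: "\<exists>p. appr p n" if "n \<in> Omega" for n
    using that
  proof (induction n rule: Omega_induct)
    case definable show ?case by (intro fo fo2[OF fo_appr])
  next
    case zero show ?case unfolding appr_def by simp
  next
    case (succ n)
    then obtain p where p: "appr p n" by blast
    show ?case
    proof (cases "\<exists>t\<in>T. j t = n")
      case False
      then show ?thesis using p unfolding appr_def by (metis elts_ins insertE)
    next
      case True
      then obtain t where t: "t \<in> T" "j t = n" by blast
      let ?S = "{s \<in> T. j s \<in> elts n}"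
      have smS: "small ?S" by (rule small_sub[OF T(1)]) (auto intro!: fo T fot_dfun[OF j(1)])
      have finS: "fin ?S"
      proof (rule fin_inj[of j])
        show "inj_on j ?S" using j(2) by (auto simp: inj_on_def)
        show "fin (j ` ?S)" by (rule fin_sub[OF fin_Omega_elem[OF succ(1)]]) (auto intro: small_image j smS)
      qed (intro smS j)+
      have pQ: "ap p s \<in> Q \<and> r a (ap p s) \<and> r (ap p s) b" if "s \<in> ?S" for s
        using p that unfolding appr_def good_def ok_def by blast
      \<comment> \<open>Including \<open>a\<close> and \<open>b\<close> makes both sets non-empty
        and keeps the new point strictly between the two. Finiteness yields the greatest lower and
        the least upper constraint, and density a point between these.\<close>
      let ?L = "insert a (ap p ` {s \<in> ?S. rT s t})" and ?U = "insert b (ap p ` {s \<in> ?S. rT t s})"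
      have finL: "fin ?L" "fin ?U"
        by (intro fin_insert fin_image dfun_ap fin_subset[OF finS], auto intro!: fo T fo_drel[OF T(3)] fot_dfun[OF j(1)])+
      have LQ: "?L \<subseteq> Q" "?U \<subseteq> Q" using pQ ab by auto
      obtain l where l: "l \<in> ?L" "\<And>x. x \<in> ?L \<Longrightarrow> x = l \<or> r x l"
        using fin_max[OF finL(1) _ Q(3)[unfolded drel_def] linear_sub[OF Q(2) LQ(1)]] by blast
      obtain u where u: "u \<in> ?U" "\<And>x. x \<in> ?U \<Longrightarrow> x = u \<or> r u x"
        using fin_min[OF finL(2) _ Q(3)[unfolded drel_def] linear_sub[OF Q(2) LQ(2)]] by blast
      have LU: "r x y" if "x \<in> ?L" "y \<in> ?U" for x y
      proof -
        have *: "rT s s'" if "s \<in> T" "s' \<in> T" "rT s t" "rT t s'" for s s'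
          using linear_trans[OF T(2)] that t by blast
        show ?thesis using that ab pQ mono[OF p _ _ _ _ *] by blast
      qed
      have lu: "l \<in> Q" "u \<in> Q" using subsetD[OF LQ(1) l(1)] subsetD[OF LQ(2) u(1)] .
      obtain q where q: "q \<in> Q" "r l q" "r q u" using dense[OF lu LU[OF l(1) u(1)]] by metis
      have Lq: "r x q" if "x \<in> ?L" for x
        using l(2)[OF that] q linear_trans[OF Q(2), of x l q] subsetD[OF LQ(1) that] lu by metis
      have qU: "r q x" if "x \<in> ?U" for x
        using u(2)[OF that] q linear_trans[OF Q(2), of q u x] subsetD[OF LQ(2) that] lu by metis
      have "ok p t q" unfolding ok_def t(2) using q Lq qU by blast
      let ?I = "{m \<in> Omega. \<exists>q. ok p t q \<and> i q = m}"
      have "fo (\<lambda>s. s 0 \<in> ?I)" by (intro fo fo3[OF fo_ok] fot_dfun[OF i(1)])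
      then obtain m where m: "m \<in> ?I" "\<And>k. k \<in> ?I \<Longrightarrow> k = m \<or> m \<in> elts k"
        using Omega_least[of ?I] \<open>ok p t q\<close> q(1) i(3) by blast
      then obtain q' where q': "ok p t q'" "i q' = m" by blast
      have gq: "good p t q'" unfolding good_def
      proof (intro conjI allI impI q')
        fix z assume z: "ok p t z"
        then have "z \<in> Q" "q' \<in> Q" using q' unfolding ok_def by blast+
        then show "z = q' \<or> i q' \<in> elts (i z)" using m(2)[of "i z"] z q'(2) i by (auto dest: inj_onD)
      qed
      have "dfun (\<lambda>x. if x = t then q' else ap p x)" by (rule dfunI) (intro fo)
      from maps_graph[OF this T(1) subset_UNIV]
      obtain p' where p': "\<And>x. x \<in> T \<Longrightarrow> ap p' x = (if x = t then q' else ap p x)" by blast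
      have "appr p' (ins n n)" unfolding appr_def
      proof (intro ballI impI)
        fix s assume s: "s \<in> T" "j s \<in> elts (ins n n)"
        have "j s = n \<longleftrightarrow> s = t" using j(2) s t by (auto dest: inj_onD)
        have eq: "ap p u = ap p' u" if "u \<in> T" "j u \<in> elts (j s)" for u
          using p' that t s Omega_asym[OF succ(1)] by auto
        show "good p' s (ap p' s)"
        proof (cases "s = t")
          case True
          then show ?thesis using gq good_cong[of t p p'] eq p' t by simp
        next
          case False
          then have "good p s (ap p s)" using p s \<open>j s = n \<longleftrightarrow> s = t\<close> unfolding appr_def by auto
          then show ?thesis using good_cong[of s p p'] eq p' s False by simp
        qed
      qed
      then show ?thesis by blast
    qed
  qed
  define f where "f t = the0 (\<lambda>q. \<exists>p. appr p (ins (j t) (j t)) \<and> ap p t = q)" for t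
  have df: "dfun f" unfolding f_def by (rule dfunI) (intro fo fo2[OF fo_appr] fot_dfun[OF j(1)])
  have f: "f t = ap p t" if "t \<in> T" "appr p n" "n \<in> Omega" "j t \<in> elts n" for t p n
  proof -
    obtain p' where p': "appr p' (ins (j t) (j t))" using ex[OF succ_Omega[OF jO[OF \<open>t \<in> T\<close>]]] by blast
    have *: "ap p'' t = ap p t" if "appr p'' (ins (j t) (j t))" for p''
      using agree[OF that \<open>appr p n\<close> succ_Omega[OF jO[OF \<open>t \<in> T\<close>]]] \<open>t \<in> T\<close> \<open>n \<in> Omega\<close> \<open>j t \<in> elts n\<close> by simp
    show ?thesis unfolding f_def by (rule the0_eq) (use p' * in auto)
  qed
  have two: "\<exists>n\<in>Omega. j s \<in> elts n \<and> j t \<in> elts n" if "s \<in> T" "t \<in> T" for s t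
    using Omega_tri[OF jO jO, OF that] jO that by (metis elts_ins insertCI succ_Omega)
  show ?thesis
  proof
    show "dfun f" by (rule df)
    show "f t \<in> Q \<and> r a (f t) \<and> r (f t) b" if t: "t \<in> T" for t
    proof -
      obtain n p where "n \<in> Omega" "j t \<in> elts n" "appr p n" using two[OF t t] ex by blast
      then show ?thesis using f[OF t] t unfolding appr_def good_def ok_def by metis
    qed
    show "r (f s) (f t)" if st: "s \<in> T" "t \<in> T" "rT s t" for s t
    proof -
      obtain n p where "n \<in> Omega" "j s \<in> elts n" "j t \<in> elts n" "appr p n" using two[OF st(1,2)] ex by blast
      then show ?thesis using f st mono by metis
    qed
  qed
qed

text \<open>
  \<open>dl x y\<close> is the level in the well-ordered set \<open>al\<close> at which the branches \<open>x\<close>, \<open>y\<close> of a binary tree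
  split, \<open>bit x d\<close> is the direction in which \<open>x\<close> leaves level \<open>d\<close>, and \<open>ei\<close> enumerates the levels.
\<close>

locale tree =
  fixes L :: "'v::zf set" and lt :: "'v \<Rightarrow> 'v \<Rightarrow> bool" and al :: "'v set"
    and dl :: "'v \<Rightarrow> 'v \<Rightarrow> 'v" and ei :: "'v \<Rightarrow> 'v" and bit :: "'v \<Rightarrow> 'v \<Rightarrow> 'v"
  assumes smL: "small L" and dlt: "drel lt" and linL: "linear (L, lt)"
    and fo_dl: "fo (\<lambda>s. s 0 = dl (s (Suc 0)) (s (Suc (Suc 0))))"
    and dl_al: "x \<in> L \<Longrightarrow> y \<in> L \<Longrightarrow> x \<noteq> y \<Longrightarrow> dl x y \<in> al"
    and dl_sym: "dl x y = dl y x"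
    and small_al: "small al" and lin_al: "linear (al, (\<^bold>\<in>))"
    and al_least: "A \<subseteq> al \<Longrightarrow> A \<noteq> {} \<Longrightarrow> fo (\<lambda>s. s 0 \<in> A) \<Longrightarrow> \<exists>m\<in>A. \<forall>x\<in>A. x = m \<or> m \<in> elts x"
    and dei: "dfun ei" and bij_ei: "bij_betw ei al Omega"
    and fo_bit: "fo (\<lambda>s. s 0 = bit (s (Suc 0)) (s (Suc (Suc 0))))"
    and bit01: "x \<in> L \<Longrightarrow> d \<in> al \<Longrightarrow> bit x d = zero \<or> bit x d = one"
    and bit_dl: "x \<in> L \<Longrightarrow> y \<in> L \<Longrightarrow> x \<noteq> y \<Longrightarrow> bit x (dl x y) \<noteq> bit y (dl x y)"
    and tri: "x \<in> L \<Longrightarrow> y \<in> L \<Longrightarrow> z \<in> L \<Longrightarrow> lt x y \<Longrightarrow> lt y z \<Longrightarrow>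
      (dl x y \<in> elts (dl y z) \<and> dl x z = dl x y) \<or> (dl y z \<in> elts (dl x y) \<and> dl x z = dl y z)"
begin

text \<open>The splitting levels of a triple do not depend on the direction of the order, so each
  statement about \<omega> has its mirror image about \<open>\<omega>\<^sup>*\<close>.\<close>

lemma tree_rev: "tree L (\<lambda>x y. lt y x) al dl ei bit"
proof
  fix x y z assume "x \<in> L" "y \<in> L" "z \<in> L" "lt y x" "lt z y"
  then show "(dl x y \<in> elts (dl y z) \<and> dl x z = dl x y) \<or> (dl y z \<in> elts (dl x y) \<and> dl x z = dl y z)"
    using tri[of z y x] dl_sym[of x y] dl_sym[of y z] dl_sym[of x z] by auto
qed (fact smL drel_rev[OF dlt] linear_rev[OF linL] fo_dl dl_al dl_sym small_al lin_al al_least dei bij_ei fo_bit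
    bit01 bit_dl)+

lemmas fot_dl [fo] = fot2[OF fo_dl] and fot_bit [fo] = fot2[OF fo_bit] and fo_lt [fo] = fo_drel[OF dlt]
  and fot_ei [fo] = fot_dfun[OF dei]

lemma lt_irrefl: "x \<in> L \<Longrightarrow> \<not> lt x x" using linear_irrefl[OF linL] .
lemma lt_trans: "lt x y \<Longrightarrow> lt y z \<Longrightarrow> x \<in> L \<Longrightarrow> y \<in> L \<Longrightarrow> z \<in> L \<Longrightarrow> lt x z" using linear_trans[OF linL] .
lemma lt_total: "x \<in> L \<Longrightarrow> y \<in> L \<Longrightarrow> x = y \<or> lt x y \<or> lt y x" using linear_total[OF linL] .
lemma lt_asym: "lt x y \<Longrightarrow> x \<in> L \<Longrightarrow> y \<in> L \<Longrightarrow> \<not> lt y x" using lt_irrefl lt_trans by blast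

lemma al_trans: "d \<in> elts d' \<Longrightarrow> d' \<in> elts d'' \<Longrightarrow> d \<in> al \<Longrightarrow> d' \<in> al \<Longrightarrow> d'' \<in> al \<Longrightarrow> d \<in> elts d''"
  using linear_trans[OF lin_al, of d d' d''] by (simp add: mem_iff)
lemma al_asym: "d \<in> elts d' \<Longrightarrow> d \<in> al \<Longrightarrow> d' \<in> al \<Longrightarrow> d' \<notin> elts d"
  using al_trans[of d d' d] by auto

lemma ei_Omega: "d \<in> al \<Longrightarrow> ei d \<in> Omega" using bij_betw_apply[OF bij_ei] .

text \<open>The ultrametric law for splitting levels: the smallest of the three occurs exactly
  twice. Unlike \<open>tri\<close> it does not refer to the arrangement of the points in the
  order.\<close>

lemma isosceles:
  assumes "a \<in> L" "b \<in> L" "c \<in> L" "a \<noteq> b" "b \<noteq> c" "a \<noteq> c"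
  shows "(dl a b = dl a c \<and> dl a b \<in> elts (dl b c)) \<or> (dl a b = dl b c \<and> dl a b \<in> elts (dl a c)) \<or>
    (dl a c = dl b c \<and> dl a c \<in> elts (dl a b))"
proof -
  have *: "(dl x y = dl x z \<and> dl x y \<in> elts (dl y z)) \<or> (dl x z = dl y z \<and> dl x z \<in> elts (dl x y))"
    if "x \<in> L" "y \<in> L" "z \<in> L" "lt x y" "lt y z" for x y z
    using tri[OF that] by auto
  consider "lt a b" "lt b c" | "lt a c" "lt c b" | "lt b a" "lt a c" | "lt b c" "lt c a" | "lt c a" "lt a b" | "lt c b" "lt b a"
    using lt_total assms by metis
  then show ?thesis
    using assms *[of a b c] *[of a c b] *[of b a c] *[of b c a] *[of c a b] *[of c b a]
      dl_sym[of a b] dl_sym[of b c] dl_sym[of a c] by cases auto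
qed

text \<open>Branching is binary: at the least of the three levels \<open>a\<close> and
  \<open>b\<close> go to opposite sides, and \<open>c\<close> accompanies exactly one of them. So
  cutting a class at its least splitting level leaves two pieces.\<close>

lemma least_split:
  assumes abc: "a \<in> L" "b \<in> L" "c \<in> L" "a \<noteq> b" "b \<noteq> c" "a \<noteq> c"
    and d: "dl a b = d" "dl a c = d \<or> d \<in> elts (dl a c)" "dl b c = d \<or> d \<in> elts (dl b c)"
  shows "(dl a c = d) \<longleftrightarrow> (dl b c \<noteq> d)"
proof -
  have al: "dl a b \<in> al" "dl a c \<in> al" "dl b c \<in> al" using dl_al abc by auto
  show ?thesis using isosceles[OF abc] d al al_asym by (metis not_mem_self)
qed

subsection \<open>Ends of a subset\<close>

text \<open>Symmetric in \<open>x\<close> and \<open>y\<close>, so that \<open>near\<close> becomes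
  an equivalence relation without any assumption on which point is the smaller.\<close>

definition between :: "'v \<Rightarrow> 'v \<Rightarrow> 'v \<Rightarrow> 'v set" where
  "between X x y = {z \<in> elts X. (lt x z \<and> lt z y) \<or> (lt y z \<and> lt z x)}"

definition near :: "'v \<Rightarrow> 'v \<Rightarrow> 'v \<Rightarrow> bool" where
  "near X x y \<longleftrightarrow> x \<in> elts X \<and> y \<in> elts X \<and> fin (between X x y)"

text \<open>A class of \<open>near\<close> of type \<open>\<omega>\<^sup>* + \<omega>\<close> has no canonical midpoint in its order type.  The least
  level at which it splits provides one; \<open>same_end\<close> refines \<open>near\<close> by this cut.\<close>

definition same_end :: "'v \<Rightarrow> 'v \<Rightarrow> 'v \<Rightarrow> bool" where
  "same_end X x y \<longleftrightarrow> near X x y \<and> (x = y \<or> (\<exists>z. near X x z \<and> z \<noteq> x \<and> dl x z \<in> elts (dl x y)))"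

lemma fo_near [fo]: "fot t \<Longrightarrow> fot u \<Longrightarrow> fot v \<Longrightarrow> fo (\<lambda>s. near (t s) (u s) (v s))"
  by (rule fo3[of near]) (unfold near_def between_def, intro fo)

lemma fo_same_end [fo]: "fot t \<Longrightarrow> fot u \<Longrightarrow> fot v \<Longrightarrow> fo (\<lambda>s. same_end (t s) (u s) (v s))"
  by (rule fo3[of same_end]) (unfold same_end_def, intro fo)

text \<open>The third clause provides every point of the class with a partner on the other side of
  the cut; the last one identifies \<open>same_end\<close> with lying on the same side.\<close>

definition least_split_level :: "'v \<Rightarrow> 'v \<Rightarrow> 'v \<Rightarrow> bool" where
  "least_split_level X x d \<longleftrightarrow> d \<in> al \<and>
    (\<forall>u v. near X x u \<longrightarrow> near X x v \<longrightarrow> u \<noteq> v \<longrightarrow> dl u v = d \<or> d \<in> elts (dl u v)) \<and>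
    (\<forall>u. near X x u \<longrightarrow> (\<exists>z. near X x z \<and> z \<noteq> u \<and> dl u z = d)) \<and>
    (\<forall>u v. near X x u \<longrightarrow> near X x v \<longrightarrow> (same_end X u v \<longleftrightarrow> u = v \<or> dl u v \<noteq> d))"

lemma least_split_levelD:
  assumes "least_split_level X x d"
  shows "d \<in> al"
    "\<And>u v. near X x u \<Longrightarrow> near X x v \<Longrightarrow> u \<noteq> v \<Longrightarrow> dl u v = d \<or> d \<in> elts (dl u v)"
    "\<And>u. near X x u \<Longrightarrow> \<exists>z. near X x z \<and> z \<noteq> u \<and> dl u z = d"
    "\<And>u v. near X x u \<Longrightarrow> near X x v \<Longrightarrow> same_end X u v \<longleftrightarrow> u = v \<or> dl u v \<noteq> d"
  using assms unfolding least_split_level_def by simp_all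

lemma fo_between: "fo (\<lambda>s. s 0 \<in> between X x y)" unfolding between_def by (intro fo)

lemma small_bt: "small (between X x y)" by (rule small_sub[OF small_elts[of X] fo_between]) (auto simp: between_def)

lemma near_sym: "near X x y \<Longrightarrow> near X y x"
proof -
  have "between X x y = between X y x" by (auto simp: between_def)
  then show "near X x y \<Longrightarrow> near X y x" by (simp add: near_def)
qed

lemma near_in: "near X x y \<Longrightarrow> x \<in> elts X" "near X x y \<Longrightarrow> y \<in> elts X"
  by (auto simp: near_def)

end

locale subtree = tree L lt al dl ei bit for L :: "'v::zf set" and lt al dl ei bit +
  fixes X :: 'v
  assumes XL: "elts X \<subseteq> L"
begin

lemma near_refl: "x \<in> elts X \<Longrightarrow> near X x x"
proof -
  assume x: "x \<in> elts X"
  have "between X x x = {}" using lt_asym x XL by (auto simp: between_def)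
  then show ?thesis using x by (simp add: near_def)
qed

lemma near_trans:
  assumes "near X x y" "near X y z" shows "near X x z"
proof -
  have X: "x \<in> elts X" "y \<in> elts X" "z \<in> elts X" using assms by (auto simp: near_def)
  have "between X x z \<subseteq> insert y (between X x y \<union> between X y z)"
  proof
    fix w assume w: "w \<in> between X x z"
    then have wX: "w \<in> elts X" by (simp add: between_def)
    then have "w = y \<or> lt w y \<or> lt y w" using lt_total X XL by blast
    then show "w \<in> insert y (between X x y \<union> between X y z)" using w by (auto simp: between_def)
  qed
  then have "fin (between X x z)"
    using assms fin_sub[OF fin_insert[OF fin_Un]] small_bt unfolding near_def by blast
  then show ?thesis using X by (simp add: near_def)
qed

lemma near_convex: 
  assumes "near X x z" "y \<in> elts X" "lt x y" "lt y z" shows "near X x y"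
proof -
  have X: "x \<in> elts X" "y \<in> elts X" "z \<in> elts X" using assms by (auto simp: near_def)
  have "w \<in> between X x z" if w: "w \<in> between X x y" for w
  proof -
    have wX: "w \<in> elts X" using w by (simp add: between_def)
    have "\<not> (lt y w \<and> lt w x)" using lt_trans[of y w x] lt_asym assms X wX XL by blast
    then have "lt x w" "lt w y" using w by (auto simp: between_def)
    then show ?thesis using lt_trans[of w y z] assms X wX XL by (auto simp: between_def)
  qed
  then have "fin (between X x y)" using fin_sub[of "between X x z" "between X x y"] small_bt assms(1) by (auto simp: near_def)
  then show ?thesis using X by (simp add: near_def)
qed

lemma least_split_level_ex:
  assumes xy: "near X x y" "x \<noteq> y"
  shows "\<exists>d. least_split_level X x d"
proof -
  let ?A = "{d. \<exists>u v. near X x u \<and> near X x v \<and> u \<noteq> v \<and> d = dl u v}"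
  have nL: "u \<in> L" if "near X x u" for u using near_in(2)[OF that] XL by blast
  have xX: "x \<in> elts X" using near_in xy by blast
  have "?A \<subseteq> al" using dl_al nL by blast
  moreover have "fo (\<lambda>s. s 0 \<in> ?A)" by (intro fo)
  moreover have "dl x y \<in> ?A" using xy near_refl[OF xX] by blast
  ultimately obtain d where d: "d \<in> ?A" "\<And>d'. d' \<in> ?A \<Longrightarrow> d' = d \<or> d \<in> elts d'"
    using al_least[of ?A] by blast
  then obtain a b where ab: "near X x a" "near X x b" "a \<noteq> b" "d = dl a b" by blast
  have dal: "d \<in> al" using ab dl_al nL by blast
  have least: "dl u v = d \<or> d \<in> elts (dl u v)" if "near X x u" "near X x v" "u \<noteq> v" for u v
    using d(2)[of "dl u v"] that by blast
  have ex: "\<exists>z. near X x z \<and> z \<noteq> u \<and> dl u z = d" if u: "near X x u" for u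
  proof (cases "u = a \<or> u = b")
    case True
    then show ?thesis using ab dl_sym by metis
  next
    case False
    then have "(dl a u = d) \<longleftrightarrow> (dl b u \<noteq> d)"
      using least_split[OF nL nL nL, OF ab(1,2) u ab(3), of d] least[OF ab(1) u] least[OF ab(2) u] ab(4)
      by metis
    then show ?thesis using ab dl_sym False by metis
  qed
  have same_end: "same_end X u v \<longleftrightarrow> u = v \<or> dl u v \<noteq> d" if uv: "near X x u" "near X x v" for u v
  proof -
    have nuv: "near X u v" using near_trans near_sym uv by blast
    have "(\<exists>z. near X u z \<and> z \<noteq> u \<and> dl u z \<in> elts (dl u v)) \<longleftrightarrow> dl u v \<noteq> d" if ne: "u \<noteq> v"
    proof
      assume "\<exists>z. near X u z \<and> z \<noteq> u \<and> dl u z \<in> elts (dl u v)"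
      then obtain z where z: "near X u z" "z \<noteq> u" "dl u z \<in> elts (dl u v)" by blast
      have xz: "near X x z" using near_trans[OF uv(1) z(1)] .
      have "dl u z = d \<or> d \<in> elts (dl u z)" using least[OF uv(1) xz] z by blast
      then show "dl u v \<noteq> d" using z al_asym[OF z(3)] dl_al nL uv xz ne by auto
    next
      assume "dl u v \<noteq> d"
      then have "d \<in> elts (dl u v)" using least[OF uv ne] by blast
      moreover obtain z where "near X x z" "z \<noteq> u" "dl u z = d" using ex[OF uv(1)] by blast
      ultimately show "\<exists>z. near X u z \<and> z \<noteq> u \<and> dl u z \<in> elts (dl u v)"
        using near_trans near_sym uv by blast
    qed
    then show ?thesis unfolding same_end_def using nuv by blast
  qed
  show ?thesis unfolding least_split_level_def using dal least ex same_end by blast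
qed

lemma same_end_near: "same_end X x y \<Longrightarrow> near X x y" by (simp add: same_end_def)

lemma same_end_in: "same_end X x y \<Longrightarrow> x \<in> elts X" "same_end X x y \<Longrightarrow> y \<in> elts X"
  using same_end_near near_in by blast+

lemma same_end_refl: "x \<in> elts X \<Longrightarrow> same_end X x x" by (simp add: same_end_def near_refl)

lemma same_end_sym:
  assumes "same_end X x y" shows "same_end X y x"
proof (cases "x = y")
  case False
  obtain d where least_split_level: "least_split_level X x d" using least_split_level_ex[OF same_end_near[OF assms] False] by blast
  note d = least_split_levelD(4)[OF least_split_level]
  have n: "near X x x" "near X x y" using same_end_near assms near_refl same_end_in by blast+
  then show ?thesis using d[OF n(1,2)] d[OF n(2,1)] assms dl_sym[of x y] by auto
qed (use assms in simp)

lemma same_end_trans: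
  assumes "same_end X x y" "same_end X y z" shows "same_end X x z"
proof (cases "x = y \<or> y = z \<or> x = z")
  case False
  obtain d where least_split_level: "least_split_level X x d" using least_split_level_ex[OF same_end_near[OF assms(1)]] False by blast
  note d = least_split_levelD(2)[OF least_split_level] least_split_levelD(4)[OF least_split_level]
  have n: "near X x x" "near X x y" "near X x z"
    using same_end_near assms near_refl same_end_in near_trans by blast+
  have L: "x \<in> L" "y \<in> L" "z \<in> L" using n near_in XL by blast+
  have "dl x y \<noteq> d" "dl y z \<noteq> d" using d(2) n assms False by auto
  then have "dl x z \<noteq> d"
    using least_split[of x z y d] L False d(1)[OF n(1,2)] d(1)[OF n(3,2)] dl_sym[of y z] by auto
  then show ?thesis using d(2)[OF n(1,3)] by blast
qed (use assms same_end_refl same_end_in in blast)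

lemma same_end_convex:
  assumes "same_end X x z" "y \<in> elts X" "lt x y" "lt y z" shows "same_end X x y"
proof -
  have L: "x \<in> L" "y \<in> L" "z \<in> L" using same_end_in assms XL by blast+
  have ne: "x \<noteq> z" "x \<noteq> y" using lt_asym assms L by blast+
  obtain d where least_split_level: "least_split_level X x d" using least_split_level_ex[OF same_end_near[OF assms(1)]] ne by blast
  note d = least_split_levelD(2)[OF least_split_level] least_split_levelD(1)[OF least_split_level] least_split_levelD(4)[OF least_split_level]
  have n: "near X x x" "near X x z" "near X x y"
    using same_end_near assms near_refl same_end_in near_convex by blast+
  have "dl x z \<noteq> d" using d(3)[OF n(1,2)] assms ne by blast
  moreover have "dl y z = d \<or> d \<in> elts (dl y z)" using d(1)[OF n(3,2)] lt_irrefl assms L by blast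
  moreover have "dl y z \<in> al" using dl_al L lt_irrefl assms by blast
  ultimately have "dl x y \<noteq> d" using tri[OF L assms(3,4)] al_asym[of d "dl y z"] d(2) by auto
  then show ?thesis using d(3)[OF n(1,3)] by blast
qed

text \<open>Different ends are disjoint and convex, so one lies entirely below the other. Their
  order can thus be read off any representatives.\<close>

lemma same_end_separated:
  assumes "same_end X x x'" "same_end X y y'" "\<not> same_end X x y" "lt x y" shows "lt x' y'"
proof -
  note L = subsetD[OF XL]
  have X: "x \<in> elts X" "x' \<in> elts X" "y \<in> elts X" "y' \<in> elts X" using assms same_end_in by blast+
  have nap: "\<not> same_end X u v" if "same_end X x u" "same_end X y v" for u v
    using that assms(3) same_end_trans same_end_sym by blast
  have 1: "lt x y'"
  proof (rule ccontr)
    assume "\<not> lt x y'"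
    then have "lt y' x" using lt_total[of x y'] nap[of x y'] same_end_refl assms(2) X L by blast
    then have "same_end X y' x" using same_end_convex[of y' y x] same_end_sym[OF assms(2)] X assms(4) by blast
    then show False using nap[OF same_end_refl assms(2)] same_end_sym X by blast
  qed
  show ?thesis
  proof (rule ccontr)
    assume "\<not> lt x' y'"
    then have "lt y' x'" using lt_total[of x' y'] nap[OF assms(1,2)] same_end_refl X L by blast
    then have "same_end X x y'" using same_end_convex[OF assms(1) X(4) 1] by blast
    then show False using nap[OF same_end_refl assms(2)] X by blast
  qed
qed

lemma fo_below: "fo (\<lambda>s. s 0 \<in> below lt {y. same_end X x y} z)" "fo (\<lambda>s. s 0 \<in> below (\<lambda>x y. lt y x) {y. same_end X x y} z)"
  unfolding below_def by (intro fo)+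

text \<open>A near point \<open>z\<close> beyond the cut bounds the end on one side, and only
  finitely many points lie between \<open>z\<close> and any given point of the end. If
  \<open>z\<close> lies below, the end is \<omega>-like; if it lies above, the end is so in the
  reversed order.\<close>

lemma same_end_wl:
  assumes x: "x \<in> elts X"
  shows "omega_like lt {y. same_end X x y} \<or> omega_like (\<lambda>x y. lt y x) {y. same_end X x y}"
proof (cases "\<exists>y. same_end X x y \<and> x \<noteq> y")
  case False
  then have "{y. same_end X x y} = {x}" using same_end_refl[OF x] by blast
  moreover have "below lt {x} x = {}" using lt_irrefl x XL by (auto simp: below_def)
  ultimately have "omega_like lt {y. same_end X x y}" by (simp add: omega_like_def)
  then show ?thesis ..
next
  case True
  then obtain y where y: "same_end X x y" "x \<noteq> y" by blast
  obtain d where least_split_level: "least_split_level X x d" using least_split_level_ex[OF same_end_near[OF y(1)] y(2)] by blast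
  note d = least_split_levelD(3)[OF least_split_level] least_split_levelD(4)[OF least_split_level]
  obtain z where z: "near X x z" "z \<noteq> x" "dl x z = d" using d(1) near_refl x by blast
  have nz: "\<not> same_end X x z" using d(2)[OF near_refl[OF x] z(1)] z by auto
  have zX: "z \<in> elts X" using near_in z by blast
  have fin: "fin (between X z u)" if "same_end X x u" for u
    using near_trans[OF near_sym[OF z(1)] same_end_near[OF that]] by (simp add: near_def)
  note L = subsetD[OF XL]
  have "lt z x \<or> lt x z" using lt_total z(2) L zX x by blast
  then show ?thesis
  proof
    assume zx: "lt z x"
    have zu: "lt z u" if "same_end X x u" for u
      using same_end_separated[OF same_end_refl[OF zX] that _ zx] nz same_end_sym by blast
    have "fin (below lt {y. same_end X x y} u)" if u: "same_end X x u" for u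
      by (rule fin_subset[OF fin[OF u] _ fo_below(1)]) (use zu same_end_in in \<open>auto simp: below_def between_def\<close>)
    then show ?thesis by (simp add: omega_like_def)
  next
    assume zx: "lt x z"
    have zu: "lt u z" if "same_end X x u" for u
      using same_end_separated[OF that same_end_refl[OF zX] _ zx] nz by blast
    have "fin (below (\<lambda>x y. lt y x) {y. same_end X x y} u)" if u: "same_end X x u" for u
      by (rule fin_subset[OF fin[OF u] _ fo_below(2)]) (use zu same_end_in in \<open>auto simp: below_def between_def\<close>)
    then show ?thesis by (simp add: omega_like_def)
  qed
qed

text \<open>The map \<open>f\<close> from \<open>thinning\<close> moves each point within its own
  end. Thinning might bring points near each other or shift the cut of a class. The first is
  excluded because \<open>f\<close> reflects finite intervals, the second because every point beyond
  the cut has an image beyond the cut.\<close>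

lemma thin_ends:
  assumes Y: "elts Y \<subseteq> elts X"
    and t: "\<And>x. x \<in> elts X \<Longrightarrow> {y. same_end X x y} \<subseteq> elts Y \<or> \<not> fin {y \<in> elts Y. same_end X x y}"
  shows "iso (elts Y, lt) (elts X, lt)"
    and "\<And>x y. same_end Y x y \<longleftrightarrow> x \<in> elts Y \<and> y \<in> elts Y \<and> same_end X x y"
proof -
  interpret Y: subtree L lt al dl ei bit Y by unfold_locales (use Y XL in blast)
  have lX: "linear (elts X, lt)" using linear_sub[OF linL XL] .
  have eqc: "{y \<in> elts X. same_end X x y} = {y. same_end X x y}" for x using same_end_in by blast
  obtain f where f: "dfun f" "bij_betw f (elts X) (elts Y)"
    "\<And>x y. x \<in> elts X \<Longrightarrow> y \<in> elts X \<Longrightarrow> lt x y \<longleftrightarrow> lt (f x) (f y)"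
    "\<And>x. x \<in> elts X \<Longrightarrow> same_end X x (f x)"
  proof (rule thinning[OF dlt lX small_elts Y small_elts, of "same_end X"])
    show "drel (same_end X)" unfolding drel_def by (intro fo)
    show "same_end X x z \<Longrightarrow> lt x y \<Longrightarrow> lt y z \<Longrightarrow> y \<in> elts X \<Longrightarrow> same_end X x y" for x y z using same_end_convex .
    show "omega_like lt {y \<in> elts X. same_end X x y} \<or> omega_like (\<lambda>x y. lt y x) {y \<in> elts X. same_end X x y}" if "x \<in> elts X" for x
      unfolding eqc using same_end_wl[OF that] .
    show "{y \<in> elts X. same_end X x y} \<subseteq> elts Y \<or> \<not> fin {y \<in> elts Y. same_end X x y}" if "x \<in> elts X" for x
      unfolding eqc using t[OF that] .
    show "same_end X x x" if "x \<in> elts X" for x using same_end_refl[OF that] .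
    show "same_end X y x" if "same_end X x y" for x y using same_end_sym[OF that] .
    show "same_end X x z" if "same_end X x y" "same_end X y z" for x y z using same_end_trans[OF that] .
  qed (rule that; assumption)
  have "iso (elts X, lt) (elts Y, lt)" by (rule isoI[OF f(1) small_elts f(2)]) (rule f(3))
  then show "iso (elts Y, lt) (elts X, lt)" by (rule iso_sym) simp
  have fX: "f x \<in> elts Y" if "x \<in> elts X" for x using bij_betw_apply[OF f(2) that] .
  have near: "near Y x y \<longleftrightarrow> near X x y" if xy: "x \<in> elts Y" "y \<in> elts Y" for x y
  proof
    assume "near X x y"
    moreover have "between Y x y \<subseteq> between X x y" using Y by (auto simp: between_def)
    ultimately show "near Y x y" using fin_sub[OF _ _ small_bt] xy by (auto simp: near_def)
  next
    assume n: "near Y x y"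
    obtain u v where uv: "u \<in> elts X" "f u = x" "v \<in> elts X" "f v = y"
      using xy unfolding bij_betw_imp_surj_on[OF f(2), symmetric] by blast
    have "f w \<in> between Y x y" if "w \<in> between X u v" for w
      using that f(3)[of u w] f(3)[of w u] f(3)[of v w] f(3)[of w v] fX[of w] uv(1,3)
      unfolding between_def uv(2,4)[symmetric] by blast
    then have "f ` between X u v \<subseteq> between Y x y" by blast
    then have "fin (f ` between X u v)" using n fin_sub[OF _ _ small_image[OF f(1) small_bt]] by (auto simp: near_def)
    moreover have "inj_on f (between X u v)"
      by (rule inj_on_subset[OF bij_betw_imp_inj_on[OF f(2)]]) (auto simp: between_def)
    ultimately have "fin (between X u v)" using fin_inj[OF _ small_bt f(1)] by blast
    then have "near X u v" using uv by (simp add: near_def)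
    moreover have "near X u x" "near X v y" using same_end_near f(4) uv by blast+
    ultimately show "near X x y" using near_trans near_sym by blast
  qed
  fix x y
  show "same_end Y x y \<longleftrightarrow> x \<in> elts Y \<and> y \<in> elts Y \<and> same_end X x y"
  proof (cases "x \<in> elts Y \<and> y \<in> elts Y")
    case False then show ?thesis using Y.same_end_in by blast
  next
    case xy: True
    have "near Y x z \<Longrightarrow> near X x z" for z using near[of x z] xy near_in(2)[of Y x z] by blast
    then have "same_end Y x y \<Longrightarrow> same_end X x y" unfolding same_end_def by blast
    moreover have "same_end Y x y" if a: "same_end X x y"
    proof (cases "x = y")
      case False
      obtain d where least_split_level: "least_split_level X x d" using least_split_level_ex[OF same_end_near[OF a] False] by blast
  note d = least_split_levelD(3)[OF least_split_level] least_split_levelD(2)[OF least_split_level] least_split_levelD(4)[OF least_split_level]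
      have nx: "near X x x" "near X x y" using near_refl same_end_near[OF a] xy Y by blast+
      obtain z where z: "near X x z" "z \<noteq> x" "dl x z = d" using d(1)[OF nx(1)] by blast
      have zX: "z \<in> elts X" using z near_in by blast
      \<comment> \<open>\<open>z\<close> itself may be missing from \<open>Y\<close>; its image lies
        in the same end and still splits from \<open>x\<close> at the level
        \<open>d\<close>.\<close>
      have nz: "near X x (f z)" using near_trans[OF z(1) same_end_near[OF f(4)[OF zX]]] .
      have "\<not> same_end X x z" using d(3)[OF nx(1) z(1)] z by auto
      then have "\<not> same_end X x (f z)" using f(4)[OF zX] same_end_trans same_end_sym by blast
      then have "f z \<noteq> x" "dl x (f z) = d" using d(3)[OF nx(1) nz] by auto
      moreover have "d \<in> elts (dl x y)" using d(2,3)[OF nx] a False by blast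
      moreover have "near Y x (f z)" "near Y x y" using near xy fX zX nz nx by blast+
      ultimately show ?thesis unfolding same_end_def by auto
    qed (use xy Y.same_end_refl in auto)
    ultimately show ?thesis using xy by blast
  qed
qed

end

section \<open>Avoiding levels of small index, and the colouring by ends\<close>

context tree begin

definition agree_upto :: "'v \<Rightarrow> 'v \<Rightarrow> 'v \<Rightarrow> bool" where
  "agree_upto n x y \<longleftrightarrow> (\<forall>d\<in>al. ei d \<in> elts n \<longrightarrow> bit x d = bit y d)"

lemma fo_agree_upto [fo]: "fot t \<Longrightarrow> fot u \<Longrightarrow> fot v \<Longrightarrow> fo (\<lambda>s. agree_upto (t s) (u s) (v s))"
  by (rule fo3[of agree_upto]) (unfold agree_upto_def, intro fo small_al)

lemma agree_upto_dl: "agree_upto n x y \<Longrightarrow> agree_upto n x z \<Longrightarrow> y \<in> L \<Longrightarrow> z \<in> L \<Longrightarrow> y \<noteq> z \<Longrightarrow> ei (dl y z) \<notin> elts n"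
  using bit_dl[of y z] dl_al[of y z] unfolding agree_upto_def by metis

text \<open>Passing from \<open>n\<close> to its successor adds a single level, whose two directions
  divide an infinite set into two parts that are not both finite. By \<open>agree_upto_dl\<close>,
  no two of the points obtained split at a level of index below \<open>n\<close>.\<close>

lemma pigeonhole:
  assumes A: "small A" "A \<subseteq> L" "\<not> fin A" and n: "n \<in> Omega"
  shows "\<exists>x\<in>A. \<not> fin {y \<in> A. agree_upto n x y}"
  using n
proof (induction n rule: Omega_induct)
  case definable show ?case by (intro fo A)
next
  case zero
  have "A \<noteq> {}" using A by auto
  moreover have "{y \<in> A. agree_upto zero x y} = A" for x by (auto simp: agree_upto_def)
  ultimately show ?case using A by auto
next
  case (succ n)
  then obtain x where x: "x \<in> A" "\<not> fin {y \<in> A. agree_upto n x y}" by blast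
  obtain d where d: "d \<in> al" "ei d = n" using succ(1) unfolding bij_betw_imp_surj_on[OF bij_ei, symmetric] by blast
  let ?B = "\<lambda>b. {y \<in> A. agree_upto n x y \<and> bit y d = b}"
  have eq: "{y \<in> A. agree_upto n x y} = ?B zero \<union> ?B one" using bit01 d A(2) by blast
  have "\<not> fin (?B zero) \<or> \<not> fin (?B one)" using x(2) fin_Un[of "?B zero" "?B one"] unfolding eq by blast
  then obtain b where b: "\<not> fin (?B b)" by blast
  have "?B b \<noteq> {}"
  proof
    assume "?B b = {}"
    then show False using b by (simp only: fin_empty not_True_eq_False)
  qed
  \<comment> \<open>The old reference point \<open>x\<close> may lie in the other half, so a new one
    is taken from the half that stayed infinite.\<close>
  then obtain z where z: "z \<in> A" "agree_upto n x z" "bit z d = b" by blast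
  have "?B b \<subseteq> {y \<in> A. agree_upto (ins n n) z y}"
    using z d bij_ei unfolding agree_upto_def by (auto simp: bij_betw_def dest: inj_onD) 
  moreover have "small (?B b)" by (rule small_sub[OF A(1)]) (intro fo A, auto)
  ultimately have "\<not> fin {y \<in> A. agree_upto (ins n n) z y}" using b fin_sub by blast
  then show ?case using z by blast
qed

definition infinite_end :: "'v \<Rightarrow> 'v \<Rightarrow> bool" where
  "infinite_end X x \<longleftrightarrow> x \<in> elts X \<and> \<not> fin {y. same_end X x y}"

lemma fo_infinite_end [fo]: "fot t \<Longrightarrow> fot u \<Longrightarrow> fo (\<lambda>s. infinite_end (t s) (u s))"
  by (rule fo2[of infinite_end]) (unfold infinite_end_def, intro fo)

text \<open>The least index of a level at which two points of the end of \<open>x\<close> split is smaller than that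
  for the end of \<open>y\<close>.\<close>

definition level_less :: "'v \<Rightarrow> 'v \<Rightarrow> 'v \<Rightarrow> bool" where
  "level_less X x y \<longleftrightarrow> (\<exists>p p'. same_end X x p \<and> same_end X x p' \<and> p \<noteq> p' \<and>
     (\<forall>q q'. same_end X y q \<and> same_end X y q' \<and> q \<noteq> q' \<longrightarrow> ei (dl p p') \<in> elts (ei (dl q q'))))"

lemma fo_level_less [fo]: "fot t \<Longrightarrow> fot u \<Longrightarrow> fot v \<Longrightarrow> fo (\<lambda>s. level_less (t s) (u s) (v s))"
  by (rule fo3[of level_less]) (unfold level_less_def, intro fo)

text \<open>The least indices of two ends may coincide, since the ends can sit at different places
  of the tree; \<open>level_less\<close> then holds in neither direction. The sets produced by
  \<open>split_ends\<close> have an undisputed first and second end.\<close>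

definition end_colour :: "'v \<Rightarrow> bool" where
  "end_colour X \<longleftrightarrow> (\<exists>x y. infinite_end X x \<and> infinite_end X y \<and> lt x y \<and> \<not> same_end X x y \<and> level_less X x y \<and>
     (\<forall>z. infinite_end X z \<and> \<not> same_end X x z \<and> \<not> same_end X y z \<longrightarrow> level_less X y z))"

lemma fo_end_colour [fo]: "fot t \<Longrightarrow> fo (\<lambda>s. end_colour (t s))"
  by (rule fo1[of end_colour]) (unfold end_colour_def, intro fo)

end

context subtree begin

lemma infinite_end_pair:
  assumes "infinite_end X x" obtains p p' where "same_end X x p" "same_end X x p'" "p \<noteq> p'"
proof -
  have x: "x \<in> elts X" using assms by (simp add: infinite_end_def)
  have "\<exists>p. same_end X x p \<and> p \<noteq> x"
  proof (rule ccontr)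
    assume "\<not> ?thesis"
    then have "{y. same_end X x y} = {x}" using same_end_refl x by blast
    then show False using assms fin_insert[OF fin_empty, of x] by (simp add: infinite_end_def)
  qed
  then show ?thesis using that same_end_refl x by metis
qed

lemma level_less_asym: "level_less X x y \<Longrightarrow> \<not> level_less X y x"
proof
  assume "level_less X x y" "level_less X y x"
  then obtain p p' q q' where *: "same_end X x p" "same_end X x p'" "p \<noteq> p'" "same_end X y q" "same_end X y q'" "q \<noteq> q'"
    "ei (dl p p') \<in> elts (ei (dl q q'))" "ei (dl q q') \<in> elts (ei (dl p p'))"
    unfolding level_less_def by metis
  then have "p \<in> L" "p' \<in> L" using same_end_in XL by blast+
  then show False using Omega_asym[OF ei_Omega[OF dl_al]] * by blast
qed

lemma level_less_trans: "level_less X x y \<Longrightarrow> level_less X y z \<Longrightarrow> level_less X x z"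
proof -
  assume "level_less X x y" "level_less X y z"
  then obtain p p' q q' where *: "same_end X x p" "same_end X x p'" "p \<noteq> p'" "same_end X y q" "same_end X y q'" "q \<noteq> q'"
    "ei (dl p p') \<in> elts (ei (dl q q'))"
    "\<forall>a a'. same_end X z a \<and> same_end X z a' \<and> a \<noteq> a' \<longrightarrow> ei (dl q q') \<in> elts (ei (dl a a'))"
    unfolding level_less_def by metis
  have "ei (dl p p') \<in> elts (ei (dl a a'))" if a: "same_end X z a" "same_end X z a'" "a \<noteq> a'" for a a'
  proof -
    have "a \<in> L" "a' \<in> L" using a same_end_in XL by blast+
    then show ?thesis using Omega_less_trans[OF ei_Omega[OF dl_al[OF _ _ a(3)]]] * a by blast
  qed
  then show ?thesis unfolding level_less_def using * by blast
qed

lemma level_less_cong: 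
  assumes "same_end X x x'" "same_end X y y'" shows "level_less X x y \<longleftrightarrow> level_less X x' y'"
proof -
  have "same_end X x p \<longleftrightarrow> same_end X x' p" "same_end X y p \<longleftrightarrow> same_end X y' p" for p using assms same_end_sym same_end_trans by blast+
  then show ?thesis unfolding level_less_def by simp
qed

text \<open>The two leading ends are determined: comparing the witnesses in
  \<open>end_colour\<close> with \<open>u\<close> and \<open>v\<close>, asymmetry and transitivity
  of \<open>level_less\<close> force them into the same ends.\<close>

lemma end_colour_iff:
  assumes u: "infinite_end X u" and v: "infinite_end X v" and n: "\<not> same_end X u v" and uv: "level_less X u v"
    and z: "\<And>z. infinite_end X z \<Longrightarrow> \<not> same_end X u z \<Longrightarrow> \<not> same_end X v z \<Longrightarrow> level_less X v z"
  shows "end_colour X \<longleftrightarrow> lt u v"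
proof
  assume "lt u v" then show "end_colour X" unfolding end_colour_def using assms by blast
next
  assume "end_colour X"
  then obtain x y where xy: "infinite_end X x" "infinite_end X y" "lt x y" "\<not> same_end X x y" "level_less X x y"
    "\<And>z. infinite_end X z \<Longrightarrow> \<not> same_end X x z \<Longrightarrow> \<not> same_end X y z \<Longrightarrow> level_less X y z" unfolding end_colour_def by blast
  have min: "level_less X x w" if "infinite_end X w" "\<not> same_end X x w" for w
    using xy that level_less_trans level_less_cong[OF same_end_refl, of x y w] same_end_in(1) unfolding infinite_end_def by blast
  have min': "level_less X u w" if "infinite_end X w" "\<not> same_end X u w" for w
    using uv z that level_less_trans level_less_cong[OF same_end_refl, of u v w] u unfolding infinite_end_def by blast
  have xu: "same_end X x u" using min[OF u] min'[OF xy(1)] level_less_asym same_end_sym by blast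
  have "same_end X y v"
  proof (rule ccontr)
    assume nv: "\<not> same_end X y v"
    have "\<not> same_end X x v" "\<not> same_end X u y" using xu n xy(4) same_end_sym same_end_trans by blast+
    then have "level_less X y v" "level_less X v y" using xy(6)[OF v] z[OF xy(2)] nv same_end_sym by blast+
    then show False using level_less_asym by blast
  qed
  then show "lt u v" using same_end_separated[OF xu _ xy(4) xy(3)] by blast
qed

text \<open>The end of \<open>u\<close> is kept whole, and a pair \<open>p\<close>,
  \<open>p'\<close> in it fixes a bound \<open>n\<close>. The end of \<open>v\<close> is thinned so
  that no level of index below \<open>n\<close> splits it; a pair \<open>q\<close>,
  \<open>q'\<close> that remains fixes a bound \<open>m\<close>, below which all other infinite ends
  are thinned. So \<open>u\<close> comes first and \<open>v\<close> second, and exchanging them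
  gives the other colour.\<close>

lemma split_ends:
  assumes j: "dfun j" "inj_on j (elts X)" "j ` elts X \<subseteq> Omega"
    and uv: "infinite_end X u" "infinite_end X v" "\<not> same_end X u v"
  shows "\<exists>Y. elts Y \<subseteq> elts X \<and> iso (elts Y, lt) (elts X, lt) \<and> (end_colour Y \<longleftrightarrow> lt u v)"
proof -
  obtain p p' where p: "same_end X u p" "same_end X u p'" "p \<noteq> p'" using infinite_end_pair[OF uv(1)] .
  have pL: "p \<in> L" "p' \<in> L" using p same_end_in XL by blast+
  \<comment> \<open>The successor also excludes the level of \<open>p\<close> and \<open>p'\<close>
    itself, as \<open>level_less\<close> is strict.\<close>
  define n where "n = succ (ei (dl p p'))"
  have nO: "n \<in> Omega" unfolding n_def using ei_Omega dl_al pL p by auto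
  have smA: "small {y. same_end X x y}" for x by (rule small_sub[OF small_elts[of X]]) (use same_end_in in \<open>auto intro!: fo\<close>)
  have sub: "{y. same_end X x y} \<subseteq> L" for x using same_end_in XL by blast
  have "\<not> fin {y. same_end X v y}" using uv(2) by (simp add: infinite_end_def)
  then obtain a where a: "same_end X v a" "\<not> fin {y. same_end X v y \<and> agree_upto n a y}"
    using pigeonhole[OF smA sub _ nO, of v] by auto
  have ex2: "\<exists>y\<in>A. y \<noteq> x" if "\<not> fin A" for A :: "'v set" and x
  proof (rule ccontr)
    assume "\<not> ?thesis"
    then have "A \<subseteq> {x}" by blast
    then have "A = {} \<or> A = {x}" by (rule subset_singletonD)
    then show False using that fin_insert[OF fin_empty, of x] fin_empty by auto
  qed
  obtain q q' where q: "same_end X v q" "agree_upto n a q" "same_end X v q'" "agree_upto n a q'" "q \<noteq> q'"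
    using ex2[OF a(2)] by blast
  have qL: "q \<in> L" "q' \<in> L" using q same_end_in XL by blast+
  define m where "m = succ (ei (dl q q'))"
  have mO: "m \<in> Omega" unfolding m_def using ei_Omega dl_al qL q by auto
  \<comment> \<open>There may be infinitely many further ends, and each needs a point with which
    infinitely many of its points agree up to \<open>m\<close>. \<open>c x\<close> is the
    \<open>j\<close>-least such point; it depends only on the end of \<open>x\<close>
    (\<open>ccong\<close>), and no choice is involved.\<close>
  define big where "big x y \<longleftrightarrow> same_end X x y \<and> \<not> fin {z. same_end X x z \<and> agree_upto m y z}" for x y
  define c where "c x = the0 (\<lambda>y. big x y \<and> (\<forall>z. big x z \<longrightarrow> z = y \<or> j y \<in> elts (j z)))" for x
  note fj [fo] = fot_dfun[OF j(1)]
  have fbig: "fo (\<lambda>s. big (s 0) (s (Suc 0)))" unfolding big_def by (intro fo)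
  note fbig' [fo] = fo2[OF fbig]
  have fc: "fot t \<Longrightarrow> fot (\<lambda>s. c (t s))" for t
    by (rule fot1[of c]) (unfold c_def, intro fo)
  have c: "big x (c x)" if x: "infinite_end X x" for x
  proof -
    have "\<exists>y. big x y"
      using pigeonhole[OF smA sub _ mO, of x] x unfolding infinite_end_def big_def by auto
    let ?J = "{k \<in> Omega. \<exists>y. big x y \<and> j y = k}"
    have "fo (\<lambda>s. s 0 \<in> ?J)" by (intro fo)
    moreover have jO: "j y \<in> Omega" if "big x y" for y using that j(3) same_end_in unfolding big_def by blast
    ultimately obtain k where k: "k \<in> ?J" "\<And>k'. k' \<in> ?J \<Longrightarrow> k' = k \<or> k \<in> elts k'"
      using Omega_least[of ?J] \<open>\<exists>y. big x y\<close> by blast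
    then obtain y where y: "big x y" "j y = k" by blast
    have inX: "y \<in> elts X" if "big x y" for y using that same_end_in unfolding big_def by blast
    have le: "z = y \<or> j y \<in> elts (j z)" if "big x z" for z
    proof -
      have "j z = k \<or> k \<in> elts (j z)" using k(2)[of "j z"] that jO by blast
      then show ?thesis using inj_onD[OF j(2), of z y] inX[OF that] inX[OF y(1)] y(2) by auto
    qed
    have "c x = y" unfolding c_def
    proof (rule the0_eq)
      fix z assume z: "big x z \<and> (\<forall>w. big x w \<longrightarrow> w = z \<or> j z \<in> elts (j w))"
      then show "z = y" using le y Omega_asym jO by blast
    qed (use y le in blast)
    then show ?thesis using y by simp
  qed
  have ccong: "c x = c y" if "same_end X x y" for x y
  proof -
    have "same_end X x = same_end X y" using that same_end_sym same_end_trans by blast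
    then show ?thesis unfolding c_def big_def by simp
  qed
  \<comment> \<open>Finite ends pass unchanged, as \<open>thin_ends\<close> demands: an end may lose
    points only if infinitely many remain.\<close>
  define W where "W y \<longleftrightarrow> (infinite_end X y \<longrightarrow> same_end X u y \<or> (same_end X v y \<and> agree_upto n a y) \<or>
      (\<not> same_end X u y \<and> \<not> same_end X v y \<and> agree_upto m (c y) y))" for y
  have smY: "small {y \<in> elts X. W y}"
    by (rule small_sub[OF small_elts[of X]]) (unfold W_def, intro fo fc, auto)
  define Y where "Y = st {y \<in> elts X. W y}"
  have Y: "elts Y = {y \<in> elts X. W y}" unfolding Y_def by (rule elts_st[OF smY])
  interpret Y: subtree L lt al dl ei bit Y by unfold_locales (use Y XL in blast)
  have infc: "infinite_end X y" if "infinite_end X x" "same_end X x y" for x y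
  proof -
    have "same_end X x = same_end X y" using that same_end_sym same_end_trans by blast
    then show ?thesis using that same_end_in unfolding infinite_end_def by simp
  qed
  have big_end: "\<not> fin {y \<in> elts Y. same_end X x y}" if x: "infinite_end X x" for x
  proof -
    consider "same_end X u x" | "same_end X v x" | "\<not> same_end X u x" "\<not> same_end X v x" by blast
    then show ?thesis
    proof cases
      case 1
      have "{y \<in> elts Y. same_end X x y} = {y. same_end X x y}"
        using 1 same_end_trans same_end_in unfolding Y W_def by blast
      then show ?thesis using x by (simp add: infinite_end_def)
    next
      case 2
      have "{y. same_end X v y \<and> agree_upto n a y} \<subseteq> {y \<in> elts Y. same_end X x y}"
        using 2 same_end_trans same_end_sym same_end_in unfolding Y W_def by blast
      moreover have "small {y. same_end X v y \<and> agree_upto n a y}" by (rule small_sub[OF smA[of v]]) (auto intro!: fo)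
      ultimately show ?thesis using a(2) fin_sub by blast
    next
      case 3
      have "{y. same_end X x y \<and> agree_upto m (c x) y} \<subseteq> {y \<in> elts Y. same_end X x y}"
      proof
        fix y assume "y \<in> {y. same_end X x y \<and> agree_upto m (c x) y}"
        then have y: "same_end X x y" "agree_upto m (c x) y" by blast+
        have "\<not> same_end X u y" "\<not> same_end X v y" using 3 y(1) same_end_sym same_end_trans by blast+
        moreover have "agree_upto m (c y) y" using y ccong[OF y(1)] by simp
        ultimately show "y \<in> {y \<in> elts Y. same_end X x y}" using y(1) same_end_in(2) unfolding Y W_def by blast
      qed
      moreover have "small {y. same_end X x y \<and> agree_upto m (c x) y}" by (rule small_sub[OF smA[of x]]) (auto intro!: fo)
      ultimately show ?thesis using c[OF x] fin_sub unfolding big_def by blast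
    qed
  qed
  have thin: "{y. same_end X x y} \<subseteq> elts Y \<or> \<not> fin {y \<in> elts Y. same_end X x y}" if x: "x \<in> elts X" for x
  proof (cases "infinite_end X x")
    case False
    then have "\<not> infinite_end X y" if "same_end X x y" for y using infc that same_end_sym by blast
    then show ?thesis using same_end_in unfolding Y W_def by blast
  qed (use big_end in blast)
  have YX: "elts Y \<subseteq> elts X" using Y by blast
  note t = thin_ends[OF YX thin]
  have ap: "same_end Y x y \<longleftrightarrow> x \<in> elts Y \<and> y \<in> elts Y \<and> same_end X x y" for x y using t(2) .
  have inf: "infinite_end Y x" if "x \<in> elts Y" "infinite_end X x" for x
  proof -
    have "{y. same_end Y x y} = {y \<in> elts Y. same_end X x y}" using ap that by blast
    then show ?thesis using big_end that by (simp add: infinite_end_def)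
  qed
  have inf': "infinite_end X x" if "infinite_end Y x" for x
  proof -
    have "{y. same_end Y x y} \<subseteq> {y. same_end X x y}" "small {y. same_end Y x y}"
      using ap by (blast, intro small_sub[OF small_elts[of Y]], auto intro!: fo)
    then show ?thesis using that YX fin_sub unfolding infinite_end_def by blast
  qed
  have uY: "y \<in> elts Y" if "same_end X u y" for y using that same_end_in(2) unfolding Y W_def by blast
  have vY: "y \<in> elts Y" if "same_end X v y" "agree_upto n a y" for y using that same_end_in(2) unfolding Y W_def by blast
  have pY: "p \<in> elts Y" "p' \<in> elts Y" "q \<in> elts Y" "q' \<in> elts Y"
    using p q uY vY by blast+
  have iY: "infinite_end Y p" "infinite_end Y q" using inf pY infc uv p q by blast+
  have nX: "\<not> same_end X p q" using uv(3) same_end_trans[OF same_end_trans[OF p(1)] same_end_sym[OF q(1)]] by blast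
  have npq: "\<not> same_end Y p q" using nX ap[of p q] by blast
  have apI: "same_end Y x y" if "x \<in> elts Y" "y \<in> elts Y" "same_end X x y" for x y using ap[of x y] that by blast
  have apD: "x \<in> elts Y" "y \<in> elts Y" "same_end X x y" if "same_end Y x y" for x y using ap[of x y] that by blast+
  have pp: "same_end X p p'" "same_end X q q'" using same_end_trans[OF same_end_sym] p(1,2) q(1,3) by blast+
  have l1: "level_less Y p q" unfolding level_less_def
  proof (intro exI conjI allI impI)
    show "same_end Y p p" "same_end Y p p'" using apI pY pp Y.same_end_refl by blast+
    fix z z' assume "same_end Y q z \<and> same_end Y q z' \<and> z \<noteq> z'"
    then have z: "z \<in> elts Y" "z' \<in> elts Y" "same_end X v z" "same_end X v z'" "z \<noteq> z'"
      using apD same_end_trans[OF q(1)] by blast+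
    have "\<not> same_end X u z" "\<not> same_end X u z'" using same_end_trans[OF _ same_end_sym] z(3,4) uv(3) by blast+
    moreover have "infinite_end X z" "infinite_end X z'" using infc[OF uv(2)] z by blast+
    ultimately have "agree_upto n a z" "agree_upto n a z'" using z unfolding Y W_def by blast+
    then have "ei (dl z z') \<notin> elts n" using agree_upto_dl z Y XL by blast
    moreover have "dl z z' \<in> al" "dl p p' \<in> al" using dl_al z(1,2,5) YX XL pL p(3) by blast+
    ultimately show "ei (dl p p') \<in> elts (ei (dl z z'))"
      using Omega_tri[OF ei_Omega ei_Omega, of "dl p p'" "dl z z'"] unfolding n_def by auto
  qed (rule p(3))
  have l2: "level_less Y q w" if w: "infinite_end Y w" "\<not> same_end Y p w" "\<not> same_end Y q w" for w
    unfolding level_less_def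
  proof (intro exI conjI allI impI)
    show "same_end Y q q" "same_end Y q q'" using apI pY pp Y.same_end_refl by blast+
    have wY: "w \<in> elts Y" using w by (simp add: infinite_end_def)
    have nw: "\<not> same_end X u w" "\<not> same_end X v w"
      using w(2,3) apI[OF pY(1) wY] apI[OF pY(3) wY] same_end_trans[OF same_end_sym[OF p(1)]] same_end_trans[OF same_end_sym[OF q(1)]]
      by blast+
    fix z z' assume "same_end Y w z \<and> same_end Y w z' \<and> z \<noteq> z'"
    then have z: "z \<in> elts Y" "z' \<in> elts Y" "same_end X w z" "same_end X w z'" "z \<noteq> z'"
      using apD by blast+
    have "\<not> same_end X u z" "\<not> same_end X u z'" "\<not> same_end X v z" "\<not> same_end X v z'"
      using nw same_end_trans[OF _ same_end_sym] z(3,4) by blast+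
    moreover have "infinite_end X z" "infinite_end X z'" using infc[OF inf'[OF w(1)]] z by blast+
    moreover have "c z = c w" "c z' = c w" using ccong[OF z(3)] ccong[OF z(4)] by simp_all
    ultimately have "agree_upto m (c w) z" "agree_upto m (c w) z'" using z(1,2) unfolding Y W_def by auto
    then have "ei (dl z z') \<notin> elts m" using agree_upto_dl z Y XL by blast
    moreover have "dl z z' \<in> al" "dl q q' \<in> al" using dl_al z(1,2,5) YX XL qL q(5) by blast+
    ultimately show "ei (dl q q') \<in> elts (ei (dl z z'))"
      using Omega_tri[OF ei_Omega ei_Omega, of "dl q q'" "dl z z'"] unfolding m_def by auto
  qed (rule q(5))
  have "end_colour Y \<longleftrightarrow> lt p q" using Y.end_colour_iff[OF iY npq l1 l2] by blast
  moreover have "lt p q \<longleftrightarrow> lt u v"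
  proof -
    show ?thesis using same_end_separated[OF same_end_sym[OF p(1)] same_end_sym[OF q(1)] nX] same_end_separated[OF p(1) q(1) uv(3)] by blast
  qed
  ultimately show ?thesis using t(1) YX by blast
qed

end

section \<open>Sets with at most one end\<close>

text \<open>An intrinsic form of the type \<omega> + k, free of the number k and of concatenation;
  \<open>exceptional_iff\<close> makes the connection.\<close>

definition omega_plus_finite :: "('v::zf \<Rightarrow> 'v \<Rightarrow> bool) \<Rightarrow> 'v set \<Rightarrow> bool" where
  "omega_plus_finite r A \<longleftrightarrow> \<not> fin {x \<in> A. fin (below r A x)} \<and> fin {x \<in> A. \<not> fin (below r A x)}"

context tree begin

definition infinite_class :: "'v \<Rightarrow> 'v \<Rightarrow> bool" where
  "infinite_class X x \<longleftrightarrow> x \<in> elts X \<and> \<not> fin {y. near X x y}"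

definition in_interval :: "'v \<Rightarrow> 'v \<Rightarrow> 'v \<Rightarrow> bool" where
  "in_interval a b z \<longleftrightarrow> z = a \<or> z = b \<or> (lt a z \<and> lt z b)"

lemma fo_in_interval [fo]: "fot t \<Longrightarrow> fot u \<Longrightarrow> fot v \<Longrightarrow> fo (\<lambda>s. in_interval (t s) (u s) (v s))"
  by (rule fo3[of in_interval]) (unfold in_interval_def, intro fo)

end

context subtree begin

lemma linX: "linear (elts X, lt)" using linear_sub[OF linL XL] .

lemma small_near: "small {y. near X x y}"
  by (rule small_sub[OF small_elts[of X]]) (use near_in in \<open>auto intro!: fo\<close>)

text \<open>Here \<open>c\<close> is the first point of the only infinite class. If \<open>d\<close>
  precedes \<open>c\<close>, the two are not near each other, and some \<open>z\<close> between them
  is not near \<open>d\<close>; the interval from \<open>d\<close> to \<open>z\<close> avoids the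
  infinite class. If nothing precedes \<open>c\<close>, the class is an initial segment of type
  \<omega>. The points after it, if any, contain two that are not near each other or lie in one
  finite class.\<close>

lemma first_case:
  assumes c: "infinite_class X c" "\<And>y. near X c y \<Longrightarrow> y = c \<or> lt c y"
    and uniq: "\<And>x y. infinite_class X x \<Longrightarrow> infinite_class X y \<Longrightarrow> near X x y"
  shows "omega_plus_finite lt (elts X) \<or> (\<exists>a b. a \<in> elts X \<and> b \<in> elts X \<and> lt a b \<and> \<not> near X a b \<and>
           (\<forall>z\<in>elts X. in_interval a b z \<longrightarrow> \<not> infinite_class X z))"
proof -
  note L = subsetD[OF XL]
  have cX: "c \<in> elts X" using c(1) by (simp add: infinite_class_def)
  have nb: "near X c x" if "infinite_class X x" for x using uniq c(1) that by blast
  show ?thesis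
  proof (cases "\<exists>d\<in>elts X. lt d c")
    case True
    then obtain d where d: "d \<in> elts X" "lt d c" by blast
    have ndc: "\<not> near X c w" if "w \<in> elts X" "lt w c" for w
      using c(2)[of w] lt_asym[OF that(2)] lt_irrefl L that cX by blast
    have "\<not> infinite_class X d" using nb ndc d by blast
    then have fd: "fin {y. near X d y}" using d by (simp add: infinite_class_def)
    have "\<not> fin (between X d c)" using ndc[OF d] near_sym[of X d c] d cX unfolding near_def by blast
    then have "\<not> between X d c \<subseteq> {y. near X d y}" using fin_sub[OF fd _ small_bt] by blast
    then obtain z where z: "z \<in> between X d c" "\<not> near X d z" by blast
    have zX: "z \<in> elts X" using z by (simp add: between_def)
    have "\<not> (lt c z \<and> lt z d)" using lt_trans[of c z d] lt_asym[OF d(2)] L zX d cX by blast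
    then have dz: "lt d z" "lt z c" using z by (auto simp: between_def)
    have "\<not> infinite_class X w" if w: "w \<in> elts X" "in_interval d z w" for w
    proof -
      have "lt w c" using w d dz lt_trans[of w z c] L zX cX unfolding in_interval_def by blast
      then show ?thesis using nb ndc w by blast
    qed
    then show ?thesis using d zX dz z(2) by blast
  next
    case False
    then have cl: "x = c \<or> lt c x" if "x \<in> elts X" for x using lt_total[of c x] L that cX by blast
    let ?D = "{d \<in> elts X. \<not> near X c d}"
    have above: "lt y d" if "near X c y" "d \<in> ?D" for y d
    proof (rule ccontr)
      assume n: "\<not> lt y d"
      have y: "y \<in> elts X" using near_in that by blast
      have "y \<noteq> d" using that by blast
      then have "lt d y" using lt_total[of y d] n L y that by blast
      moreover have "lt c d" using cl[of d] that near_refl[OF cX] by blast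
      ultimately show False using near_convex[OF that(1), of d] that by blast
    qed
    show ?thesis
    proof (cases "\<exists>d\<in>?D. \<exists>d'\<in>?D. lt d d' \<and> \<not> near X d d'")
      case True
      then obtain d d' where d: "d \<in> ?D" "d' \<in> ?D" "lt d d'" "\<not> near X d d'" by blast
      have "\<not> infinite_class X w" if w: "w \<in> elts X" "in_interval d d' w" for w
      proof
        assume "infinite_class X w"
        then have cw: "near X c w" by (rule nb)
        then have "lt w d" using above d by blast
        moreover have "w = d \<or> lt d w \<or> w = d'" using w(2) unfolding in_interval_def by blast
        ultimately show False using lt_asym[of w d] L w(1) d cw lt_irrefl by blast
      qed
      then show ?thesis using d by blast
    next
      case nD: False
      have finD: "fin ?D"
      proof (cases "?D = {}")
        case True then show ?thesis by (simp only: True fin_empty)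
      next
        case False
        then obtain d where d: "d \<in> ?D" by blast
        have "\<not> infinite_class X d" using nb d by blast
        then have "fin {y. near X d y}" using d by (simp add: infinite_class_def)
        moreover have "?D \<subseteq> {y. near X d y}"
        proof
          fix e assume e: "e \<in> ?D"
          have "e = d \<or> lt e d \<or> lt d e" using lt_total[of e d] L e d by blast
          then have "near X d e" using nD d e near_refl near_sym by blast
          then show "e \<in> {y. near X d y}" by simp
        qed
        moreover have "small ?D" by (rule small_sub[OF small_elts[of X]]) (auto intro!: fo)
        ultimately show ?thesis using fin_sub by blast
      qed
      have flo: "fo (\<lambda>s. s 0 \<in> below lt (elts X) x)" for x unfolding below_def by (intro fo)
      have S: "fin (below lt (elts X) x) \<longleftrightarrow> near X c x" if x: "x \<in> elts X" for x
      proof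
        assume n: "near X c x"
        have "below lt (elts X) x \<subseteq> insert c (between X c x)" using cl by (auto simp: below_def between_def)
        then show "fin (below lt (elts X) x)"
          using fin_subset[OF fin_insert _ flo] n unfolding near_def by blast
      next
        assume f: "fin (below lt (elts X) x)"
        show "near X c x"
        proof (rule ccontr)
          assume "\<not> near X c x"
          then have "{y. near X c y} \<subseteq> below lt (elts X) x" using above x near_in by (auto simp: below_def)
          then show False using fin_sub[OF f _ small_near] c(1) by (auto simp: infinite_class_def)
        qed
      qed
      have "{x \<in> elts X. fin (below lt (elts X) x)} = {y. near X c y}" using S near_in by blast
      moreover have "{x \<in> elts X. \<not> fin (below lt (elts X) x)} = ?D" using S by blast
      ultimately show ?thesis using finD c(1) unfolding omega_plus_finite_def infinite_class_def by simp
    qed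
  qed
qed

text \<open>The cut of the class has two sides, represented by \<open>x\<close> and by a point
  \<open>z\<close> that splits from \<open>x\<close> at the least level.\<close>

lemma infinite_class_classes:
  assumes "infinite_class X x"
  shows "\<exists>z. near X x z \<and> \<not> same_end X x z \<and> (\<forall>y. near X x y \<longrightarrow> same_end X x y \<or> same_end X z y)"
proof -
  have x: "x \<in> elts X" using assms by (simp add: infinite_class_def)
  have "\<exists>y. near X x y \<and> x \<noteq> y"
  proof (rule ccontr)
    assume "\<not> ?thesis"
    then have "{y. near X x y} = {x}" using near_refl x by blast
    then show False using assms fin_insert[OF fin_empty, of x] by (simp add: infinite_class_def)
  qed
  then obtain y where y: "near X x y" "x \<noteq> y" by blast
  obtain d where least_split_level: "least_split_level X x d" using least_split_level_ex[OF y] by blast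
  note nx = near_refl[OF x]
  obtain z where z: "near X x z" "z \<noteq> x" "dl x z = d" using least_split_levelD(3)[OF least_split_level nx] by blast
  have "\<not> same_end X x z" using least_split_levelD(4)[OF least_split_level nx z(1)] z by auto
  moreover have "same_end X x w \<or> same_end X z w" if w: "near X x w" for w
  proof (cases "w = x \<or> w = z")
    case True then show ?thesis using same_end_refl near_in w by blast
  next
    case False
    have L: "x \<in> L" "z \<in> L" "w \<in> L" using near_in z w XL by blast+
    have "(dl x w = d) \<longleftrightarrow> (dl z w \<noteq> d)"
      using least_split[OF L, of d] z least_split_levelD(2)[OF least_split_level nx w] least_split_levelD(2)[OF least_split_level z(1) w] False by auto
    then show ?thesis using least_split_levelD(4)[OF least_split_level nx w] least_split_levelD(4)[OF least_split_level z(1) w] by blast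
  qed
  ultimately show ?thesis using z(1) by blast
qed

text \<open>An infinite class has an infinite piece, so there is at most one such class. It has a
  first or a last point: otherwise its left piece has no first point and its right piece no last
  point, and both are infinite ends. Then \<open>first_case\<close> or its mirror image
  applies.\<close>

lemma few_ends_intervals:
  assumes ninf: "\<not> fin (elts X)" and one_end: "\<And>u v. infinite_end X u \<Longrightarrow> infinite_end X v \<Longrightarrow> same_end X u v"
  shows "omega_plus_finite lt (elts X) \<or> omega_plus_finite (\<lambda>x y. lt y x) (elts X) \<or>
     (\<exists>a b. a \<in> elts X \<and> b \<in> elts X \<and> lt a b \<and> \<not> near X a b \<and> (\<forall>z\<in>elts X. in_interval a b z \<longrightarrow> \<not> infinite_class X z))"
proof -
  note L = subsetD[OF XL]
  have ex: "\<exists>y. near X x y \<and> infinite_end X y" if x: "infinite_class X x" for x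
  proof -
    obtain z where z': "near X x z \<and> \<not> same_end X x z \<and> (\<forall>y. near X x y \<longrightarrow> same_end X x y \<or> same_end X z y)"
      by (rule exE[OF infinite_class_classes[OF x]])
    have z: "near X x z" "\<not> same_end X x z" "\<And>y. near X x y \<Longrightarrow> same_end X x y \<or> same_end X z y" using z' by simp_all
    have "{y. near X x y} \<subseteq> {y. same_end X x y} \<union> {y. same_end X z y}" using z(3) by blast
    then have "\<not> fin {y. same_end X x y} \<or> \<not> fin {y. same_end X z y}"
      using fin_sub[OF fin_Un _ small_near] x unfolding infinite_class_def by blast
    then show ?thesis using z(1) near_in[OF z(1)] near_refl unfolding infinite_end_def by blast
  qed
  have uniq: "near X x y" if xy: "infinite_class X x" "infinite_class X y" for x y
  proof -
    obtain x' y' where x': "near X x x'" "infinite_end X x'" and y': "near X y y'" "infinite_end X y'"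
      using ex[OF xy(1)] ex[OF xy(2)] by blast
    show ?thesis
      by (rule near_trans[OF near_trans[OF x'(1) same_end_near[OF one_end[OF x'(2) y'(2)]]] near_sym[OF y'(1)]])
  qed
  show ?thesis
  proof (cases "\<exists>x. infinite_class X x")
    case False
    \<comment> \<open>Without infinite classes the class of any point \<open>a\<close> is finite and
      cannot exhaust \<open>X\<close>, so some point is not near \<open>a\<close>.\<close>
    obtain a where a: "a \<in> elts X" using ninf fin_empty by fastforce
    then have "fin {y. near X a y}" using False by (auto simp: infinite_class_def)
    then have "\<not> elts X \<subseteq> {y. near X a y}" using fin_sub ninf small_elts by blast
    then obtain b where b: "b \<in> elts X" "\<not> near X a b" by blast
    then have "a \<noteq> b" using near_refl a by blast
    then have "lt a b \<or> lt b a" using lt_total L a b by blast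
    then show ?thesis using False a b near_sym by blast
  next
    case True
    then obtain x where x: "infinite_class X x" by blast
    have "\<exists>c. near X x c \<and> ((\<forall>y. near X x y \<longrightarrow> y = c \<or> lt c y) \<or> (\<forall>y. near X x y \<longrightarrow> y = c \<or> lt y c))"
    proof (rule ccontr)
      assume n: "\<not> ?thesis"
      obtain z where z': "near X x z \<and> \<not> same_end X x z \<and> (\<forall>y. near X x y \<longrightarrow> same_end X x y \<or> same_end X z y)"
        by (rule exE[OF infinite_class_classes[OF x]])
      have z: "near X x z" "\<not> same_end X x z" "\<And>y. near X x y \<Longrightarrow> same_end X x y \<or> same_end X z y" using z' by simp_all
      obtain a b where ab: "near X x a" "near X x b" "lt a b" "\<not> same_end X a b" "\<And>y. near X x y \<Longrightarrow> same_end X a y \<or> same_end X b y"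
      proof -
        have xz: "x \<in> elts X" "z \<in> elts X" using near_in z by blast+
        then have "x \<noteq> z" using z same_end_refl by blast
        then have "lt x z \<or> lt z x" using lt_total L xz by blast
        then show ?thesis using that[of x z] that[of z x] z near_refl[OF xz(1)] same_end_sym by blast
      qed
      have abX: "a \<in> elts X" "b \<in> elts X" using near_in ab by blast+
      have linc: "linear ({y. same_end X w y}, lt)" for w using linear_sub[OF linX, of "{y. same_end X w y}"] same_end_in by blast
      note fl = dlt[unfolded drel_def]
      have "infinite_end X a" unfolding infinite_end_def
      proof (intro conjI abX(1) notI)
        assume "fin {y. same_end X a y}"
        then obtain m where m: "same_end X a m" "\<And>y. same_end X a y \<Longrightarrow> y = m \<or> lt m y"
          using fin_min[OF _ _ fl linc[of a]] same_end_refl[OF abX(1)] by blast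
        have nm: "near X x m" using near_trans[OF ab(1) same_end_near[OF m(1)]] .
        then obtain w where w: "near X x w" "w \<noteq> m" "\<not> lt m w" using n by blast
        have wX: "w \<in> L" "m \<in> L" using near_in w nm L by blast+
        have "\<not> same_end X a w" using m(2) w by blast
        then have "same_end X b w" using ab(5)[OF w(1)] by blast
        then show False using same_end_separated[OF m(1) _ ab(4,3)] w(3) by blast
      qed
      moreover have "infinite_end X b" unfolding infinite_end_def
      proof (intro conjI abX(2) notI)
        assume "fin {y. same_end X b y}"
        then obtain m where m: "same_end X b m" "\<And>y. same_end X b y \<Longrightarrow> y = m \<or> lt y m"
          using fin_max[OF _ _ fl linc[of b]] same_end_refl[OF abX(2)] by blast
        have nm: "near X x m" using near_trans[OF ab(2) same_end_near[OF m(1)]] .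
        then obtain w where w: "near X x w" "w \<noteq> m" "\<not> lt w m" using n by blast
        have "\<not> same_end X b w" using m(2) w by blast
        then have "same_end X a w" using ab(5)[OF w(1)] by blast
        then show False using same_end_separated[OF _ m(1) ab(4,3)] w(3) by blast
      qed
      ultimately show False using one_end ab(4) by blast
    qed
    then obtain c where c: "near X x c"
      "(\<forall>y. near X x y \<longrightarrow> y = c \<or> lt c y) \<or> (\<forall>y. near X x y \<longrightarrow> y = c \<or> lt y c)" by blast
    have eq: "near X x y \<longleftrightarrow> near X c y" for y using near_trans near_sym c(1) by blast
    have nc: "infinite_class X c" using x near_in[OF c(1)] unfolding infinite_class_def eq by blast
    \<comment> \<open>Reversal changes neither \<open>near\<close> nor
      \<open>infinite_class\<close>; only the endpoints of an interval are exchanged.\<close>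
    interpret R: tree L "\<lambda>x y. lt y x" al dl ei bit by (rule tree_rev)
    interpret R: subtree L "\<lambda>x y. lt y x" al dl ei bit X by unfold_locales (rule XL)
    have rbt: "R.between X x y = between X x y" for x y unfolding R.between_def between_def by blast
    have rnear: "R.near X x y \<longleftrightarrow> near X x y" for x y unfolding R.near_def near_def rbt ..
    have rnbig: "R.infinite_class X x \<longleftrightarrow> infinite_class X x" for x unfolding R.infinite_class_def infinite_class_def rnear ..
    have ritv: "R.in_interval a b z \<longleftrightarrow> in_interval b a z" for a b z unfolding R.in_interval_def in_interval_def by blast
    from c(2) show ?thesis
    proof
      assume "\<forall>y. near X x y \<longrightarrow> y = c \<or> lt c y"
      then have "\<And>y. near X c y \<Longrightarrow> y = c \<or> lt c y" using eq by blast
      from first_case[OF nc this uniq] show ?thesis by blast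
    next
      assume "\<forall>y. near X x y \<longrightarrow> y = c \<or> lt y c"
      then have "\<And>y. near X c y \<Longrightarrow> y = c \<or> lt y c" using eq by blast
      from R.first_case[unfolded rnear rnbig ritv, OF nc this uniq] show ?thesis
        using near_sym by blast
    qed
  qed
qed

text \<open>From each class that meets the interval the point with the least \<open>j\<close>-index
  is kept. Between two such points there are infinitely many points of \<open>X\<close>, and only
  finitely many are near either of the two because their classes are finite; so a third class
  intervenes.\<close>

lemma few_ends_dense:
  assumes ninf: "\<not> fin (elts X)" and one_end: "\<And>u v. infinite_end X u \<Longrightarrow> infinite_end X v \<Longrightarrow> same_end X u v"
    and j: "dfun j" "inj_on j (elts X)" "j ` elts X \<subseteq> Omega"
  shows "omega_plus_finite lt (elts X) \<or> omega_plus_finite (\<lambda>x y. lt y x) (elts X) \<or>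
     (\<exists>Q a b. small Q \<and> Q \<subseteq> elts X \<and> a \<in> Q \<and> b \<in> Q \<and> lt a b \<and>
       (\<forall>x\<in>Q. \<forall>y\<in>Q. lt x y \<longrightarrow> (\<exists>z\<in>Q. lt x z \<and> lt z y)))"
proof (cases "omega_plus_finite lt (elts X) \<or> omega_plus_finite (\<lambda>x y. lt y x) (elts X)")
  case False
  then obtain a b where ab: "a \<in> elts X" "b \<in> elts X" "lt a b" "\<not> near X a b"
    "\<And>z. z \<in> elts X \<Longrightarrow> in_interval a b z \<Longrightarrow> \<not> infinite_class X z"
    using few_ends_intervals[OF ninf one_end] by blast
  note L = subsetD[OF XL]
  note fj [fo] = fot_dfun[OF j(1)]
  define I where "I = {z \<in> elts X. in_interval a b z}"
  have smI: "small I" unfolding I_def by (rule small_sub[OF small_elts[of X]]) (auto intro!: fo)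
  have IX: "z \<in> elts X" "z \<in> L" if "z \<in> I" for z using that L unfolding I_def by blast+
  define Q where "Q = {z \<in> I. \<forall>z'\<in>I. near X z z' \<longrightarrow> z' = z \<or> j z \<in> elts (j z')}"
  have smQ: "small Q" unfolding Q_def by (rule small_sub[OF smI]) (auto intro!: fo smI)
  have QI: "Q \<subseteq> I" unfolding Q_def by blast
  have jO: "j z \<in> Omega" if "z \<in> I" for z using j(3) IX that by blast
  have rep: "\<exists>q\<in>Q. near X z q" if z: "z \<in> I" for z
  proof -
    let ?J = "{k \<in> Omega. \<exists>w\<in>I. near X z w \<and> j w = k}"
    have "fo (\<lambda>s. s 0 \<in> ?J)" by (intro fo smI)
    moreover have "?J \<noteq> {}" using z near_refl[OF IX(1)[OF z]] jO by blast
    ultimately obtain k where k: "k \<in> ?J" "\<And>k'. k' \<in> ?J \<Longrightarrow> k' = k \<or> k \<in> elts k'"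
      using Omega_least[of ?J] by blast
    then obtain q where q: "q \<in> I" "near X z q" "j q = k" by blast
    have "z' = q \<or> j q \<in> elts (j z')" if z': "z' \<in> I" "near X q z'" for z'
    proof -
      have "j z' = k \<or> k \<in> elts (j z')" using k(2)[of "j z'"] z' jO near_trans[OF q(2)] by blast
      then show ?thesis using inj_onD[OF j(2), of z' q] IX z'(1) q by auto
    qed
    then show ?thesis using q unfolding Q_def by blast
  qed
  have Qnear: "x = y" if "x \<in> Q" "y \<in> Q" "near X x y" for x y
  proof (rule ccontr)
    assume "x \<noteq> y"
    then have "j x \<in> elts (j y)" "j y \<in> elts (j x)" using that near_sym unfolding Q_def by blast+
    then show False using Omega_asym jO that(1) QI by blast
  qed
  have Iconv: "z \<in> I" if xy: "x \<in> I" "y \<in> I" "lt x z" "lt z y" "z \<in> elts X" for x y z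
  proof -
    have aX: "a \<in> L" "b \<in> L" "x \<in> L" "y \<in> L" "z \<in> L" using ab L IX xy by blast+
    have "x = a \<or> lt a x" "y = b \<or> lt y b" using xy ab(3) unfolding I_def in_interval_def by blast+
    then have "lt a z" "lt z b" using lt_trans[of a x z] lt_trans[of z y b] aX xy by blast+
    then show ?thesis using xy unfolding I_def in_interval_def by blast
  qed
  have dense: "\<exists>z\<in>Q. lt x z \<and> lt z y" if xy: "x \<in> Q" "y \<in> Q" "lt x y" for x y
  proof -
    have I: "x \<in> I" "y \<in> I" using xy QI by blast+
    note xL = IX(2)[OF I(1)] IX(2)[OF I(2)]
    have "x \<noteq> y" using xy(3) lt_irrefl xL by blast
    then have "\<not> near X x y" using Qnear xy by blast
    then have nf: "\<not> fin (between X x y)" using IX I by (simp add: near_def)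
    have "fin {w. near X x w}" "fin {w. near X y w}"
      using ab(5) I unfolding I_def infinite_class_def by blast+
    then have "fin ({w. near X x w} \<union> {w. near X y w})" by (rule fin_Un)
    then have "\<not> between X x y \<subseteq> {w. near X x w} \<union> {w. near X y w}" using fin_sub[OF _ _ small_bt] nf by blast
    then obtain w where w: "w \<in> between X x y" "\<not> near X x w" "\<not> near X y w" by blast
    have wX: "w \<in> elts X" using w by (simp add: between_def)
    have "\<not> (lt y w \<and> lt w x)" using lt_trans[of y w x] lt_asym[OF xy(3)] xL L wX by blast
    then have xw: "lt x w" "lt w y" using w by (auto simp: between_def)
    \<comment> \<open>The representative \<open>z\<close> of the class of \<open>w\<close> may
      differ from \<open>w\<close>; convexity of classes keeps it strictly between \<open>x\<close>
      and \<open>y\<close>.\<close>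
    obtain z where z: "z \<in> Q" "near X w z" using rep[OF Iconv[OF I xw wX]] by blast
    have zX: "z \<in> elts X" "z \<in> L" "w \<in> L" using z QI IX L wX by blast+
    have "lt x z"
    proof (rule ccontr)
      assume "\<not> lt x z"
      then have "z = x \<or> lt z x" using lt_total[of x z] xL zX by blast
      then have "near X z x" using near_convex[OF near_sym[OF z(2)], of x] IX I xw near_refl by blast
      then show False using w(2) near_trans[OF z(2)] near_sym by blast
    qed
    moreover have "lt z y"
    proof (rule ccontr)
      assume "\<not> lt z y"
      then have "z = y \<or> lt y z" using lt_total[of y z] xL zX by blast
      then have "near X w y" using near_convex[OF z(2), of y] IX I xw z(2) by blast
      then show False using w(3) near_sym by blast
    qed
    ultimately show ?thesis using z by blast
  qed
  have aI: "a \<in> I" "b \<in> I" using ab unfolding I_def in_interval_def by blast+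
  obtain p q where pq: "p \<in> Q" "near X a p" "q \<in> Q" "near X b q" using rep aI by blast
  have "p \<noteq> q" using pq ab(4) near_trans near_sym by blast
  moreover have "p \<in> L" "q \<in> L" using pq QI IX by blast+
  ultimately have "lt p q \<or> lt q p" using lt_total by blast
  moreover have "Q \<subseteq> elts X" using QI IX by blast
  ultimately show ?thesis using smQ pq dense by blast
qed blast

end

section \<open>Splitting levels in intervals of a dense set\<close>

context tree begin

definition le :: "'v \<Rightarrow> 'v \<Rightarrow> bool" where "le d d' \<longleftrightarrow> d = d' \<or> d \<in> elts d'"

lemma le_trans: "le d d' \<Longrightarrow> le d' d'' \<Longrightarrow> d \<in> al \<Longrightarrow> d' \<in> al \<Longrightarrow> d'' \<in> al \<Longrightarrow> le d d''"
  unfolding le_def using al_trans by blast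

lemma less_le_trans: "d \<in> elts d' \<Longrightarrow> le d' d'' \<Longrightarrow> d \<in> al \<Longrightarrow> d' \<in> al \<Longrightarrow> d'' \<in> al \<Longrightarrow> d \<in> elts d''"
  unfolding le_def using al_trans by blast

lemma dl_al': "x \<in> L \<Longrightarrow> y \<in> L \<Longrightarrow> lt x y \<Longrightarrow> dl x y \<in> al"
  using dl_al lt_irrefl by blast

lemma tri_le:
  assumes "x \<in> L" "y \<in> L" "z \<in> L" "lt x y" "lt y z"
  shows "le (dl x z) (dl x y)" "le (dl x z) (dl y z)"
  using tri[OF assms] unfolding le_def by auto

lemma in_interval_le:
  assumes L: "a \<in> L" "b \<in> L" "u \<in> L" "v \<in> L" and uv: "in_interval a b u" "in_interval a b v" "lt u v" and ab: "lt a b"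
  shows "le (dl a b) (dl u v)"
proof -
  have au: "a = u \<or> lt a u" using uv ab L lt_asym lt_irrefl unfolding in_interval_def by blast
  have vb: "v = b \<or> lt v b" using uv ab L lt_asym lt_irrefl unfolding in_interval_def by blast
  have av: "lt a v" using au uv L lt_trans by blast
  have 1: "le (dl a b) (dl a v)" using vb tri_le(1)[of a v b] av L unfolding le_def by blast
  have 2: "le (dl a v) (dl u v)" using au tri_le(2)[of a u v] uv L unfolding le_def by blast
  show ?thesis using le_trans[OF 1 2] dl_al' L uv av ab by blast
qed

lemma in_interval_trans:
  assumes "a \<in> L" "b \<in> L" "c \<in> L" "d \<in> L" "z \<in> L" "in_interval a b c" "in_interval a b d" "lt c d" "lt a b" "in_interval c d z"
  shows "in_interval a b z"
proof -
  have "a = c \<or> lt a c" "d = b \<or> lt d b"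
    using assms lt_asym lt_irrefl unfolding in_interval_def by blast+
  moreover have "z = c \<or> z = d \<or> (lt c z \<and> lt z d)" using assms(10) unfolding in_interval_def .
  ultimately show ?thesis using assms(6,7) lt_trans[of a c z] lt_trans[of z d b] assms(1-5) unfolding in_interval_def by blast
qed

context
  fixes Q
  assumes Q: "small Q" "Q \<subseteq> L" and dense: "\<And>x y. x \<in> Q \<Longrightarrow> y \<in> Q \<Longrightarrow> lt x y \<Longrightarrow> \<exists>z\<in>Q. lt x z \<and> lt z y"
begin

text \<open>If the level of index \<open>n\<close> occurs as \<open>dl x y\<close> in the current
  interval, a point \<open>z\<close> between \<open>x\<close> and \<open>y\<close> yields a half
  whose endpoints split strictly later (\<open>tri\<close>). All levels inside that half are at
  least as late (\<open>in_interval_le\<close>), so the level of index \<open>n\<close> does not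
  recur.\<close>

lemma dense_shrink:
  assumes ab: "a \<in> Q" "b \<in> Q" "lt a b" and n: "n \<in> Omega"
  shows "\<exists>c\<in>Q. \<exists>d\<in>Q. in_interval a b c \<and> in_interval a b d \<and> lt c d \<and>
     (\<forall>x\<in>Q. \<forall>y\<in>Q. in_interval c d x \<longrightarrow> in_interval c d y \<longrightarrow> lt x y \<longrightarrow> ei (dl x y) \<notin> elts n)"
  using n
proof (induction n rule: Omega_induct)
  case definable show ?case by (intro fo Q)
next
  case zero show ?case using ab by (auto simp: in_interval_def)
next
  case (succ n)
  note L = subsetD[OF Q(2)]
  obtain c d where cd: "c \<in> Q" "d \<in> Q" "in_interval a b c" "in_interval a b d" "lt c d"
    "\<And>x y. x \<in> Q \<Longrightarrow> y \<in> Q \<Longrightarrow> in_interval c d x \<Longrightarrow> in_interval c d y \<Longrightarrow> lt x y \<Longrightarrow> ei (dl x y) \<notin> elts n"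
    using succ(2) by blast
  show ?case
  proof (cases "\<exists>x\<in>Q. \<exists>y\<in>Q. in_interval c d x \<and> in_interval c d y \<and> lt x y \<and> ei (dl x y) = n")
    case False
    then have "ei (dl x y) \<notin> elts (ins n n)" if "x \<in> Q" "y \<in> Q" "in_interval c d x" "in_interval c d y" "lt x y" for x y
      using cd(6)[OF that] that by auto
    then show ?thesis using cd(1-5) by blast
  next
    case True
    then obtain x y where xy: "x \<in> Q" "y \<in> Q" "in_interval c d x" "in_interval c d y" "lt x y" "ei (dl x y) = n" by blast
    obtain z where z: "z \<in> Q" "lt x z" "lt z y" using dense xy by blast
    have "\<exists>e\<in>Q. \<exists>f\<in>Q. in_interval x y e \<and> in_interval x y f \<and> lt e f \<and> dl x y \<in> elts (dl e f)"
      using tri[OF L[OF xy(1)] L[OF z(1)] L[OF xy(2)] z(2,3)]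
    proof
      assume "dl x z \<in> elts (dl z y) \<and> dl x y = dl x z"
      then show ?thesis using xy z unfolding in_interval_def by (intro bexI[of _ z] bexI[of _ y]) auto
    next
      assume "dl z y \<in> elts (dl x z) \<and> dl x y = dl z y"
      then show ?thesis using xy z unfolding in_interval_def by (intro bexI[of _ x] bexI[of _ z]) auto
    qed
    then obtain e f where ef: "e \<in> Q" "f \<in> Q" "in_interval x y e" "in_interval x y f" "lt e f" "dl x y \<in> elts (dl e f)" by blast
    note LL = L[OF cd(1)] L[OF cd(2)] L[OF xy(1)] L[OF xy(2)] L[OF ef(1)] L[OF ef(2)] L[OF ab(1)] L[OF ab(2)]
    have ce: "in_interval c d e" "in_interval c d f"
      using in_interval_trans[OF LL(1,2,3,4) _ xy(3,4,5) cd(5)] LL ef by blast+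
    have ae: "in_interval a b e" "in_interval a b f"
      using in_interval_trans[OF LL(7,8,1,2) _ cd(3,4,5) ab(3)] LL ce by blast+
    have "ei (dl u v) \<notin> elts (ins n n)" if uv: "u \<in> Q" "v \<in> Q" "in_interval e f u" "in_interval e f v" "lt u v" for u v
    proof -
      note uL = L[OF uv(1)] L[OF uv(2)]
      have "in_interval c d u" "in_interval c d v" using in_interval_trans[OF LL(1,2,5,6) _ ce ef(5) cd(5)] uL uv by blast+
      then have 1: "ei (dl u v) \<notin> elts n" using cd(6) uv by blast
      have "le (dl e f) (dl u v)" using in_interval_le[OF LL(5,6) uL uv(3,4,5) ef(5)] .
      moreover have al: "dl x y \<in> al" "dl e f \<in> al" "dl u v \<in> al" using dl_al' LL uL xy ef uv by blast+
      ultimately have "dl x y \<in> elts (dl u v)" using less_le_trans[OF ef(6)] by blast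
      then have "dl u v \<noteq> dl x y" by auto
      then have "ei (dl u v) \<noteq> n" using inj_onD[OF bij_betw_imp_inj_on[OF bij_ei], of "dl u v" "dl x y"] al xy(6) by auto
      then show ?thesis using 1 by simp
    qed
    then show ?thesis using ef(1,2,5) ae by blast
  qed
qed

text \<open>\<open>z\<close> and \<open>z'\<close> split at the least level that occurs in the open
  interval; its openness leaves room for \<open>a\<close> and \<open>b\<close> on both sides. By
  \<open>tri\<close> consecutive pairs of an increasing triple never split at the same level, so the
  outer pairs split strictly later.\<close>

lemma dense_split:
  assumes ab: "a0 \<in> Q" "b0 \<in> Q" "lt a0 b0"
  obtains a z z' b where "a \<in> Q" "z \<in> Q" "z' \<in> Q" "b \<in> Q" "lt a z" "lt z z'" "lt z' b"
    "dl z z' \<in> elts (dl a z)" "dl z z' \<in> elts (dl z' b)"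
proof -
  note L = subsetD[OF Q(2)]
  let ?I = "\<lambda>x. lt a0 x \<and> lt x b0"
  let ?A = "{d. \<exists>x\<in>Q. \<exists>y\<in>Q. ?I x \<and> ?I y \<and> lt x y \<and> d = dl x y}"
  obtain p where p: "p \<in> Q" "lt a0 p" "lt p b0" using dense ab by blast
  obtain q where q: "q \<in> Q" "lt p q" "lt q b0" using dense p ab by blast
  have "lt a0 q" using lt_trans[OF p(2) q(2)] L ab p q by blast
  then have "dl p q \<in> ?A" using p q by blast
  moreover have "?A \<subseteq> al" using dl_al' L by blast
  moreover have "fo (\<lambda>s. s 0 \<in> ?A)" by (intro fo Q)
  ultimately obtain d where d: "d \<in> ?A" "\<And>d'. d' \<in> ?A \<Longrightarrow> d' = d \<or> d \<in> elts d'"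
    using al_least[of ?A] by blast
  then obtain z z' where z: "z \<in> Q" "z' \<in> Q" "?I z" "?I z'" "lt z z'" "d = dl z z'" by blast
  obtain a where a: "a \<in> Q" "lt a0 a" "lt a z" using dense[of a0 z] z ab by blast
  obtain b where b: "b \<in> Q" "lt z' b" "lt b b0" using dense[of z' b0] z ab by blast
  note LL = L[OF a(1)] L[OF z(1)] L[OF z(2)] L[OF b(1)] L[OF ab(1)] L[OF ab(2)]
  have Ia: "?I a" "?I b" using a b z lt_trans[of a z b0] lt_trans[of a0 z' b] LL by blast+
  have "dl a z \<in> ?A" "dl z' b \<in> ?A" using Ia a b z by blast+
  then have 1: "dl a z = d \<or> d \<in> elts (dl a z)" "dl z' b = d \<or> d \<in> elts (dl z' b)" using d(2) by blast+
  have ne: "dl a z \<noteq> dl z z'" using tri[OF LL(1,2,3) a(3) z(5)] not_mem_self by metis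
  have ne': "dl z' b \<noteq> dl z z'" using tri[OF LL(2,3,4) z(5) b(2)] not_mem_self by metis
  show ?thesis using that[OF a(1) z(1,2) b(1) a(3) z(5) b(2)] 1 ne ne' z(6) by blast
qed

end

section \<open>The colouring by the two sides of the first split\<close>

definition lside :: "'v \<Rightarrow> 'v \<Rightarrow> 'v \<Rightarrow> bool" where
  "lside X d x \<longleftrightarrow> x \<in> elts X \<and> (\<exists>y\<in>elts X. lt x y \<and> dl x y = d)"

definition rside :: "'v \<Rightarrow> 'v \<Rightarrow> 'v \<Rightarrow> bool" where
  "rside X d y \<longleftrightarrow> y \<in> elts X \<and> (\<exists>x\<in>elts X. lt x y \<and> dl x y = d)"

text \<open>The least level at which \<open>X\<close> splits cuts \<open>X\<close> into a left and a right part; the colour compares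
  the least indices of the levels at which these two parts split.\<close>

definition split_colour :: "'v \<Rightarrow> bool" where
  "split_colour X \<longleftrightarrow> (\<exists>d. (\<exists>u\<in>elts X. \<exists>v\<in>elts X. lt u v \<and> dl u v = d) \<and>
     (\<forall>u\<in>elts X. \<forall>v\<in>elts X. lt u v \<longrightarrow> dl u v = d \<or> d \<in> elts (dl u v)) \<and>
     (\<exists>x x'. lside X d x \<and> lside X d x' \<and> lt x x' \<and>
       (\<forall>y y'. rside X d y \<and> rside X d y' \<and> lt y y' \<longrightarrow> ei (dl x x') \<in> elts (ei (dl y y')))))"

lemma fo_lside [fo]: "fot t \<Longrightarrow> fot u \<Longrightarrow> fot v \<Longrightarrow> fo (\<lambda>s. lside (t s) (u s) (v s))"
  by (rule fo3[of lside]) (unfold lside_def, intro fo)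
lemma fo_rside [fo]: "fot t \<Longrightarrow> fot u \<Longrightarrow> fot v \<Longrightarrow> fo (\<lambda>s. rside (t s) (u s) (v s))"
  by (rule fo3[of rside]) (unfold rside_def, intro fo)
lemma fo_split_colour [fo]: "fot t \<Longrightarrow> fo (\<lambda>s. split_colour (t s))"
  by (rule fo1[of split_colour]) (unfold split_colour_def, intro fo)

text \<open>A least splitting level is unique, so \<open>d\<close> is the only level that can serve
  in \<open>split_colour\<close>, and the sides that it cuts off are \<open>A\<close> and
  \<open>B\<close>.\<close>

lemma split_colour_iff:
  assumes X: "elts X = A \<union> B" "A \<subseteq> L" "B \<subseteq> L" "A \<noteq> {}" "B \<noteq> {}"
    and AB: "\<And>x y. x \<in> A \<Longrightarrow> y \<in> B \<Longrightarrow> lt x y \<and> dl x y = d"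
    and A: "\<And>x y. x \<in> A \<Longrightarrow> y \<in> A \<Longrightarrow> lt x y \<Longrightarrow> d \<in> elts (dl x y)"
    and B: "\<And>x y. x \<in> B \<Longrightarrow> y \<in> B \<Longrightarrow> lt x y \<Longrightarrow> d \<in> elts (dl x y)"
  shows "split_colour X \<longleftrightarrow> (\<exists>x\<in>A. \<exists>x'\<in>A. lt x x' \<and>
     (\<forall>y\<in>B. \<forall>y'\<in>B. lt y y' \<longrightarrow> ei (dl x x') \<in> elts (ei (dl y y'))))"
proof -
  have nBA: "\<not> lt y x" if "x \<in> A" "y \<in> B" for x y using AB[OF that] lt_asym that X(2,3) by blast
  have lA: "lside X d x \<longleftrightarrow> x \<in> A" for x
  proof
    assume "lside X d x"
    then obtain y where y: "x \<in> A \<union> B" "y \<in> A \<union> B" "lt x y" "dl x y = d" unfolding lside_def X(1) by blast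
    have "\<not> (x \<in> B \<and> y \<in> B)" "\<not> (x \<in> A \<and> y \<in> A)" using A[of x y] B[of x y] y by auto
    then show "x \<in> A" using y nBA by blast
  next
    assume "x \<in> A"
    then show "lside X d x" using AB X(5) unfolding lside_def X(1) by blast
  qed
  have rB: "rside X d y \<longleftrightarrow> y \<in> B" for y
  proof
    assume "rside X d y"
    then obtain x where y: "x \<in> A \<union> B" "y \<in> A \<union> B" "lt x y" "dl x y = d" unfolding rside_def X(1) by blast
    have "\<not> (x \<in> B \<and> y \<in> B)" "\<not> (x \<in> A \<and> y \<in> A)" using A[of x y] B[of x y] y by auto
    then show "y \<in> B" using y nBA by blast
  next
    assume "y \<in> B"
    then show "rside X d y" using AB X(4) unfolding rside_def X(1) by blast
  qed
  have ex: "\<exists>u\<in>elts X. \<exists>v\<in>elts X. lt u v \<and> dl u v = d" using AB X(4,5) unfolding X(1) by blast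
  have least: "dl u v = d \<or> d \<in> elts (dl u v)" if uv: "u \<in> elts X" "v \<in> elts X" "lt u v" for u v
  proof -
    have "u \<in> A \<union> B" "v \<in> A \<union> B" using uv(1,2) unfolding X(1) .
    then consider "u \<in> A" "v \<in> A" | "u \<in> A" "v \<in> B" | "u \<in> B" "v \<in> A" | "u \<in> B" "v \<in> B" by blast
    then show ?thesis using A B AB nBA uv(3) by cases blast+
  qed
  have uniq: "d' = d" if u1: "\<exists>u\<in>elts X. \<exists>v\<in>elts X. lt u v \<and> dl u v = d'"
    and u2: "\<And>u v. u \<in> elts X \<Longrightarrow> v \<in> elts X \<Longrightarrow> lt u v \<Longrightarrow> dl u v = d' \<or> d' \<in> elts (dl u v)" for d'
  proof -
    obtain u v where uv: "u \<in> elts X" "v \<in> elts X" "lt u v" "dl u v = d'" using u1 by blast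
    obtain x y where xy: "x \<in> elts X" "y \<in> elts X" "lt x y" "dl x y = d" using ex by blast
    have 1: "d' = d \<or> d \<in> elts d'" using least[OF uv(1-3)] uv(4) by simp
    have 2: "d = d' \<or> d' \<in> elts d" using u2[OF xy(1-3)] xy(4) by simp
    have "d \<in> al" "d' \<in> al" using dl_al'[of u v] dl_al'[of x y] uv xy X(2,3) unfolding X(1) by blast+
    then show ?thesis using 1 2 al_asym by blast
  qed
  show ?thesis (is "_ \<longleftrightarrow> ?R")
  proof
    assume "split_colour X"
    then obtain d' where d': "\<exists>u\<in>elts X. \<exists>v\<in>elts X. lt u v \<and> dl u v = d'"
      "\<And>u v. u \<in> elts X \<Longrightarrow> v \<in> elts X \<Longrightarrow> lt u v \<Longrightarrow> dl u v = d' \<or> d' \<in> elts (dl u v)"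
      "\<exists>x x'. lside X d' x \<and> lside X d' x' \<and> lt x x' \<and>
       (\<forall>y y'. rside X d' y \<and> rside X d' y' \<and> lt y y' \<longrightarrow> ei (dl x x') \<in> elts (ei (dl y y')))"
      unfolding split_colour_def by blast
    have "d' = d" using uniq[OF d'(1)] d'(2) by blast
    then show ?R using d'(3) unfolding \<open>d' = d\<close> lA rB by blast
  next
    assume ?R
    then have r: "\<exists>x x'. lside X d x \<and> lside X d x' \<and> lt x x' \<and>
       (\<forall>y y'. rside X d y \<and> rside X d y' \<and> lt y y' \<longrightarrow> ei (dl x x') \<in> elts (ei (dl y y')))"
      unfolding lA rB by blast
    have "\<forall>u\<in>elts X. \<forall>v\<in>elts X. lt u v \<longrightarrow> dl u v = d \<or> d \<in> elts (dl u v)"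
      by (intro ballI impI) (rule least)
    from conjI[OF ex conjI[OF this r]] show "split_colour X" unfolding split_colour_def by (rule exI[of _ d])
  qed
qed

end

context tree begin

text \<open>\<open>T\<close> is cut after \<open>t2\<close>, so that each part has two points and
  hence a splitting level. Full copies of \<open>T\<close> are placed between \<open>a\<close> and
  \<open>z\<close> and between \<open>z'\<close> and \<open>b\<close>; the left part of the first is
  glued to the right part of the second. For one colour the left copy is fixed and the right
  interval is shrunk until its levels have larger indices; for the other colour the roles are
  exchanged.\<close>

lemma dense_colours:
  assumes Q: "small Q" "Q \<subseteq> L" and dense: "\<And>x y. x \<in> Q \<Longrightarrow> y \<in> Q \<Longrightarrow> lt x y \<Longrightarrow> \<exists>z\<in>Q. lt x z \<and> lt z y"
    and ab0: "a0 \<in> Q" "b0 \<in> Q" "lt a0 b0" and i: "dfun i" "inj_on i Q" "i ` Q \<subseteq> Omega"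
    and T: "small T" "linear (T, rT)" "drel rT" and j: "dfun j" "inj_on j T" "j ` T \<subseteq> Omega"
    and t: "t1 \<in> T" "t2 \<in> T" "t3 \<in> T" "t4 \<in> T" "rT t1 t2" "rT t2 t3" "rT t3 t4"
  shows "\<exists>Y. elts Y \<subseteq> Q \<and> iso (elts Y, lt) (T, rT) \<and> (split_colour Y \<longleftrightarrow> c)"
proof -
  note L = subsetD[OF Q(2)]
  note sp = dense_split[OF Q dense ab0]
  obtain a z z' b where az: "a \<in> Q" "z \<in> Q" "z' \<in> Q" "b \<in> Q" "lt a z" "lt z z'" "lt z' b"
    "dl z z' \<in> elts (dl a z)" "dl z z' \<in> elts (dl z' b)" by (rule sp)
  note LL = L[OF az(1)] L[OF az(2)] L[OF az(3)] L[OF az(4)]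
  have linQ: "linear (Q, lt)" using linear_sub[OF linL Q(2)] .
  have emb: "\<exists>f. dfun f \<and> (\<forall>t\<in>T. f t \<in> Q \<and> lt p (f t) \<and> lt (f t) q) \<and> (\<forall>s\<in>T. \<forall>t\<in>T. rT s t \<longrightarrow> lt (f s) (f t))"
    if pq: "p \<in> Q" "q \<in> Q" "lt p q" for p q
  proof -
    obtain f where f: "dfun f" "\<And>t. t \<in> T \<Longrightarrow> f t \<in> Q \<and> lt p (f t) \<and> lt (f t) q"
      "\<And>s t. s \<in> T \<Longrightarrow> t \<in> T \<Longrightarrow> rT s t \<Longrightarrow> lt (f s) (f t)"
      using dense_embedding[OF T(1,2,3) j Q(1) linQ dlt i dense pq] by blast
    then show ?thesis by blast
  qed
  define left where "left t \<longleftrightarrow> t = t2 \<or> rT t t2" for t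
  have glue: "\<exists>Y. elts Y \<subseteq> Q \<and> iso (elts Y, lt) (T, rT) \<and> (split_colour Y \<longleftrightarrow>
      (\<exists>x\<in>f ` {t \<in> T. left t}. \<exists>x'\<in>f ` {t \<in> T. left t}. lt x x' \<and>
     (\<forall>y\<in>g ` {t \<in> T. \<not> left t}. \<forall>y'\<in>g ` {t \<in> T. \<not> left t}. lt y y' \<longrightarrow> ei (dl x x') \<in> elts (ei (dl y y')))))"
    if f: "dfun f" "\<And>t. t \<in> T \<Longrightarrow> f t \<in> Q \<and> in_interval a z (f t)" "\<And>s t. s \<in> T \<Longrightarrow> t \<in> T \<Longrightarrow> rT s t \<Longrightarrow> lt (f s) (f t)"
      and g: "dfun g" "\<And>t. t \<in> T \<Longrightarrow> g t \<in> Q \<and> in_interval z' b (g t)" "\<And>s t. s \<in> T \<Longrightarrow> t \<in> T \<Longrightarrow> rT s t \<Longrightarrow> lt (g s) (g t)" for f g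
  proof -
    define h where "h t = (if left t then f t else g t)" for t
    have dh: "dfun h" unfolding h_def left_def
      by (rule dfunI) (intro fo fo_drel[OF T(3)] fot_dfun[OF f(1)] fot_dfun[OF g(1)])
    have smY: "small (h ` T)" by (rule small_image[OF dh T(1)])
    define Y where "Y = st (h ` T)"
    have Y: "elts Y = h ` T" unfolding Y_def by (rule elts_st[OF smY])
    \<comment> \<open>Inside either interval all levels are later than \<open>dl z z'\<close>, so
      points of different intervals split exactly there.\<close>
    have cross: "lt x y \<and> dl x y = dl z z'" if xy: "x \<in> Q" "in_interval a z x" "y \<in> Q" "in_interval z' b y" for x y
    proof -
      note xL = L[OF xy(1)] L[OF xy(3)]
      have x1: "x = z \<or> lt x z" using xy(2) az unfolding in_interval_def by blast
      have y1: "y = z' \<or> lt z' y" using xy(4) az unfolding in_interval_def by blast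
      have lxz: "lt x z'" using x1 lt_trans[OF _ az(6) xL(1) LL(2,3)] az(6) by blast
      have d1: "dl x z' = dl z z'"
      proof (cases "x = z")
        case False
        then have xz: "lt x z" using x1 by blast
        have "le (dl a z) (dl x z)" using in_interval_le[OF LL(1,2) xL(1) LL(2) xy(2) _ xz az(5)] by (simp add: in_interval_def)
        then have "dl z z' \<in> elts (dl x z)"
          using less_le_trans[OF az(8)] dl_al' LL xL az xz by blast
        moreover have "dl x z \<in> al" "dl z z' \<in> al" using dl_al' LL xL az xz by blast+
        ultimately show ?thesis using tri[OF xL(1) LL(2,3) xz az(6)] al_asym by blast
      qed simp
      show ?thesis
      proof (cases "y = z'")
        case True then show ?thesis using d1 lxz by simp
      next
        case False
        then have zy: "lt z' y" using y1 by blast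
        have "le (dl z' b) (dl z' y)" using in_interval_le[OF LL(3,4) LL(3) xL(2) _ xy(4) zy az(7)] by (simp add: in_interval_def)
        then have "dl x z' \<in> elts (dl z' y)" unfolding d1
          using less_le_trans[OF az(9)] dl_al' LL xL az zy by blast
        moreover have "dl x z' \<in> al" "dl z' y \<in> al" using dl_al' LL xL lxz zy by blast+
        ultimately show ?thesis
          using tri[OF xL(1) LL(3) xL(2) lxz zy] al_asym d1 lt_trans[OF lxz zy xL(1) LL(3) xL(2)] by metis
      qed
    qed
    have A: "dl z z' \<in> elts (dl x y)" if xy: "x \<in> Q" "in_interval a z x" "y \<in> Q" "in_interval a z y" "lt x y" for x y
    proof -
      note xL = L[OF xy(1)] L[OF xy(3)]
      show ?thesis using less_le_trans[OF az(8) in_interval_le[OF LL(1,2) xL xy(2,4,5) az(5)]] dl_al' LL xL az xy by blast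
    qed
    have B: "dl z z' \<in> elts (dl x y)" if xy: "x \<in> Q" "in_interval z' b x" "y \<in> Q" "in_interval z' b y" "lt x y" for x y
    proof -
      note xL = L[OF xy(1)] L[OF xy(3)]
      show ?thesis using less_le_trans[OF az(9) in_interval_le[OF LL(3,4) xL xy(2,4,5) az(7)]] dl_al' LL xL az xy by blast
    qed
    have left_down: "left s" if "s \<in> T" "t \<in> T" "rT s t" "left t" for s t
      using that linear_trans[OF T(2), of s t t2] t(2) unfolding left_def by blast
    have hmono: "lt (h s) (h t)" if st: "s \<in> T" "t \<in> T" "rT s t" for s t
      using f g cross left_down st unfolding h_def by auto
    have hQ: "h t \<in> Q" if "t \<in> T" for t using f(2) g(2) that unfolding h_def by auto
    have hiff: "rT s t \<longleftrightarrow> lt (h s) (h t)" if st: "s \<in> T" "t \<in> T" for s t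
    proof
      assume l: "lt (h s) (h t)"
      have "s \<noteq> t" using l lt_irrefl L hQ st by blast
      moreover have "\<not> rT t s" using hmono[of t s] st l lt_asym L hQ by blast
      ultimately show "rT s t" using linear_total[OF T(2)] st by blast
    qed (rule hmono[OF st])
    have hinj: "inj_on h T"
    proof (rule inj_onI)
      fix s t assume st: "s \<in> T" "t \<in> T" "h s = h t"
      then show "s = t" using linear_total[OF T(2) st(1,2)] hiff lt_irrefl L hQ by metis
    qed
    have "iso (T, rT) (elts Y, lt)" unfolding Y
      by (rule isoI[OF dh T(1)]) (use hinj hiff in \<open>auto simp: bij_betw_def\<close>)
    then have iso: "iso (elts Y, lt) (T, rT)" by (rule iso_sym) (rule T(1))
    have left1: "left t2" "\<not> left t3"
      using t linear_irrefl[OF T(2)] linear_trans[OF T(2), of t2 t3 t2] unfolding left_def by blast+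
    have "elts Y = f ` {t \<in> T. left t} \<union> g ` {t \<in> T. \<not> left t}" unfolding Y h_def by auto
    then have sc: "split_colour Y \<longleftrightarrow> (\<exists>x\<in>f ` {t \<in> T. left t}. \<exists>x'\<in>f ` {t \<in> T. left t}. lt x x' \<and>
     (\<forall>y\<in>g ` {t \<in> T. \<not> left t}. \<forall>y'\<in>g ` {t \<in> T. \<not> left t}. lt y y' \<longrightarrow> ei (dl x x') \<in> elts (ei (dl y y'))))"
    proof (rule split_colour_iff[where d = "dl z z'"])
      show "f ` {t \<in> T. left t} \<subseteq> L" "g ` {t \<in> T. \<not> left t} \<subseteq> L" using f(2) g(2) L by blast+
      show "f ` {t \<in> T. left t} \<noteq> {}" "g ` {t \<in> T. \<not> left t} \<noteq> {}" using t left1 by blast+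
      show "lt x y \<and> dl x y = dl z z'" if "x \<in> f ` {t \<in> T. left t}" "y \<in> g ` {t \<in> T. \<not> left t}" for x y
        using that f(2) g(2) by (intro cross) blast+
      show "dl z z' \<in> elts (dl x y)" if "x \<in> f ` {t \<in> T. left t}" "y \<in> f ` {t \<in> T. left t}" "lt x y" for x y
        using that(1,2) f(2) by (intro A[OF _ _ _ _ that(3)]) blast+
      show "dl z z' \<in> elts (dl x y)" if "x \<in> g ` {t \<in> T. \<not> left t}" "y \<in> g ` {t \<in> T. \<not> left t}" "lt x y" for x y
        using that(1,2) g(2) by (intro B[OF _ _ _ _ that(3)]) blast+
    qed
    have "elts Y \<subseteq> Q" unfolding Y by (rule image_subsetI) (rule hQ)
    then show ?thesis using iso sc by (intro exI[of _ Y] conjI)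
  qed
  have left: "left t1" "left t2" "\<not> left t3" "\<not> left t4"
  proof -
    have "rT t2 t4" using linear_trans[OF T(2), of t2 t3 t4] t by blast
    then show "left t1" "left t2" "\<not> left t3" "\<not> left t4"
      using t linear_irrefl[OF T(2)] linear_trans[OF T(2), of t2 t3 t2] linear_trans[OF T(2), of t2 t4 t2]
      unfolding left_def by blast+
  qed
  have itvI: "in_interval p q x" if "in_interval p q c" "in_interval p q d" "lt c d" "lt c x" "lt x d" "p \<in> L" "q \<in> L" "c \<in> L" "d \<in> L" "x \<in> L" "lt p q" for p q c d x
    by (rule in_interval_trans[of p q c d x]) (use that in \<open>auto simp: in_interval_def\<close>)
  have itvJ: "in_interval p q x" if "lt p x" "lt x q" for p q x using that by (simp add: in_interval_def)
  show ?thesis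
  proof (cases c)
    case True
    obtain f where f: "dfun f" "\<And>t. t \<in> T \<Longrightarrow> f t \<in> Q \<and> lt a (f t) \<and> lt (f t) z" "\<And>s t. s \<in> T \<Longrightarrow> t \<in> T \<Longrightarrow> rT s t \<Longrightarrow> lt (f s) (f t)"
      using emb[OF az(1,2,5)] by blast
    let ?x = "f t1" and ?x' = "f t2"
    have xx: "lt ?x ?x'" "?x \<in> L" "?x' \<in> L" using f t L by blast+
    \<comment> \<open>The successor excludes the index of the pair \<open>f t1\<close>,
      \<open>f t2\<close> itself, as the colour asks for a strict inequality.\<close>
    define n where "n = succ (ei (dl ?x ?x'))"
    have e: "ei (dl ?x ?x') \<in> Omega" using ei_Omega dl_al' xx by blast
    then have nO: "n \<in> Omega" unfolding n_def by simp
    obtain c d where cd: "c \<in> Q" "d \<in> Q" "in_interval z' b c" "in_interval z' b d" "lt c d"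
      "\<And>x y. x \<in> Q \<Longrightarrow> y \<in> Q \<Longrightarrow> in_interval c d x \<Longrightarrow> in_interval c d y \<Longrightarrow> lt x y \<Longrightarrow> ei (dl x y) \<notin> elts n"
      using dense_shrink[OF Q dense az(3,4,7) nO] by blast
    obtain g where g: "dfun g" "\<And>t. t \<in> T \<Longrightarrow> g t \<in> Q \<and> lt c (g t) \<and> lt (g t) d" "\<And>s t. s \<in> T \<Longrightarrow> t \<in> T \<Longrightarrow> rT s t \<Longrightarrow> lt (g s) (g t)"
      using emb[OF cd(1,2,5)] by blast
    have big: "ei (dl ?x ?x') \<in> elts (ei (dl (g y) (g y')))" if y: "y \<in> T" "y' \<in> T" "lt (g y) (g y')" for y y'
    proof -
      have "ei (dl (g y) (g y')) \<notin> elts n" using cd(6) g(2) y itvJ by blast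
      moreover have "ei (dl (g y) (g y')) \<in> Omega" using ei_Omega dl_al' g(2) y L by blast
      ultimately show ?thesis using Omega_tri[OF e, of "ei (dl (g y) (g y'))"] unfolding n_def by auto
    qed
    have gi: "\<And>t. t \<in> T \<Longrightarrow> g t \<in> Q \<and> in_interval z' b (g t)" using itvI[OF cd(3,4,5)] g(2) LL cd(1,2) L az(7) by blast
    have fi: "\<And>t. t \<in> T \<Longrightarrow> f t \<in> Q \<and> in_interval a z (f t)" using itvJ f(2) by blast
    have "\<exists>x\<in>f ` {t \<in> T. left t}. \<exists>x'\<in>f ` {t \<in> T. left t}. lt x x' \<and>
     (\<forall>y\<in>g ` {t \<in> T. \<not> left t}. \<forall>y'\<in>g ` {t \<in> T. \<not> left t}. lt y y' \<longrightarrow> ei (dl x x') \<in> elts (ei (dl y y')))"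
      using left t xx big by blast
    then show ?thesis using glue[OF f(1) fi f(3) g(1) gi g(3)] True by blast
  next
    case False
    obtain g where g: "dfun g" "\<And>t. t \<in> T \<Longrightarrow> g t \<in> Q \<and> lt z' (g t) \<and> lt (g t) b" "\<And>s t. s \<in> T \<Longrightarrow> t \<in> T \<Longrightarrow> rT s t \<Longrightarrow> lt (g s) (g t)"
      using emb[OF az(3,4,7)] by blast
    let ?y = "g t3" and ?y' = "g t4"
    have yy: "lt ?y ?y'" "?y \<in> L" "?y' \<in> L" using g t L by blast+
    \<comment> \<open>No successor here: to refute the colour it is enough that no level on the left
      has an index strictly below that of the pair \<open>g t3\<close>, \<open>g t4\<close>.\<close>
    define n where "n = ei (dl ?y ?y')"
    have nO: "n \<in> Omega" unfolding n_def using ei_Omega dl_al' yy by blast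
    obtain c d where cd: "c \<in> Q" "d \<in> Q" "in_interval a z c" "in_interval a z d" "lt c d"
      "\<And>x y. x \<in> Q \<Longrightarrow> y \<in> Q \<Longrightarrow> in_interval c d x \<Longrightarrow> in_interval c d y \<Longrightarrow> lt x y \<Longrightarrow> ei (dl x y) \<notin> elts n"
      using dense_shrink[OF Q dense az(1,2,5) nO] by blast
    obtain f where f: "dfun f" "\<And>t. t \<in> T \<Longrightarrow> f t \<in> Q \<and> lt c (f t) \<and> lt (f t) d" "\<And>s t. s \<in> T \<Longrightarrow> t \<in> T \<Longrightarrow> rT s t \<Longrightarrow> lt (f s) (f t)"
      using emb[OF cd(1,2,5)] by blast
    have big: "ei (dl (f x) (f x')) \<notin> elts (ei (dl ?y ?y'))" if "x \<in> T" "x' \<in> T" "lt (f x) (f x')" for x x'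
      using cd(6) f(2) that itvJ unfolding n_def by blast
    have fi: "\<And>t. t \<in> T \<Longrightarrow> f t \<in> Q \<and> in_interval a z (f t)" using itvI[OF cd(3,4,5)] f(2) LL cd(1,2) L az(5) by blast
    have gi: "\<And>t. t \<in> T \<Longrightarrow> g t \<in> Q \<and> in_interval z' b (g t)" using itvJ g(2) by blast
    have "\<not> (\<exists>x\<in>f ` {t \<in> T. left t}. \<exists>x'\<in>f ` {t \<in> T. left t}. lt x x' \<and>
     (\<forall>y\<in>g ` {t \<in> T. \<not> left t}. \<forall>y'\<in>g ` {t \<in> T. \<not> left t}. lt y y' \<longrightarrow> ei (dl x x') \<in> elts (ei (dl y y'))))"
      using left t yy big by blast
    then show ?thesis using glue[OF f(1) fi f(3) g(1) gi g(3)] False by blast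
  qed
qed

end

subsection \<open>Colourings\<close>

lemma small_subsets:
  assumes "small L" "drel lt" "small T" "drel rT" shows "small (subsets_of_type (L, lt) (T, rT))"
  by (rule small_sub[OF small_Pow[OF assms(1)]])
    (auto simp: subsets_of_type_def intro!: fo fo_iso assms)

lemma colouring_exists:
  assumes "small S" "fo (\<lambda>s. P (s 0))"
  shows "\<exists>F. maps F S {zero, one} \<and> (\<forall>X\<in>S. app F X = (if P X then zero else one))"
proof -
  have "dfun (\<lambda>X. if P X then zero else one)" by (rule dfunI) (intro fo fo1[OF assms(2)])
  from maps_graph[OF this assms(1), of "{zero, one}"] show ?thesis using maps_ap(1) by fastforce
qed

lemma zero_neq_one [simp]: "zero \<noteq> one" "one \<noteq> zero"
  by (metis elts_one elts_zero insert_not_empty)+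

lemma not_arrowsI:
  assumes "small L" "drel lt" "small T" "drel rT" and P: "fo (\<lambda>s. P (s 0))"
    and H: "\<And>H. elts H \<subseteq> L \<Longrightarrow> iso (elts H, lt) (T, rT) \<Longrightarrow>
      (\<exists>X. elts X \<subseteq> elts H \<and> iso (elts X, lt) (T, rT) \<and> P X) \<and> (\<exists>X. elts X \<subseteq> elts H \<and> iso (elts X, lt) (T, rT) \<and> \<not> P X)"
  shows "\<not> arrows (L, lt) (T, rT) (T, rT)"
proof
  assume a: "arrows (L, lt) (T, rT) (T, rT)"
  obtain F where F: "maps F (subsets_of_type (L, lt) (T, rT)) {zero, one}"
    "\<And>X. X \<in> subsets_of_type (L, lt) (T, rT) \<Longrightarrow> app F X = (if P X then zero else one)"
    using colouring_exists[OF small_subsets[OF assms(1-4)] P] by blast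
  obtain H c where h: "H \<in> subsets_of_type (L, lt) (T, rT)"
    "\<And>X. X \<in> subsets_of_type (elts H, lt) (T, rT) \<Longrightarrow> app F X = c"
    using a F(1) unfolding arrows_def by (metis snd_conv)
  have *: "elts H \<subseteq> L" "iso (elts H, lt) (T, rT)" using h(1) by (auto simp: subsets_of_type_def)
  then have "(if P X then zero else one) = c" if "elts X \<subseteq> elts H" "iso (elts X, lt) (T, rT)" for X
    using h(2)[of X] F(2)[of X] that by (auto simp: subsets_of_type_def)
  then show False using H[OF *] zero_neq_one by metis
qed

lemma omega_plus_finite_iso:
  assumes r: "drel r" "drel r'" and A: "small A" and i: "iso (A, r) (B, r')" and o: "omega_plus_finite r A"
  shows "omega_plus_finite r' B"
proof -
  obtain f where f: "dfun f" "bij_betw f A B" "\<And>x y. x \<in> A \<Longrightarrow> y \<in> A \<Longrightarrow> r x y \<longleftrightarrow> r' (f x) (f y)"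
    by (rule isoE[OF i]) (rule that; assumption)
  have B: "B = f ` A" using f(2) by (simp add: bij_betw_def)
  have inj: "inj_on f A" using f(2) by (simp add: bij_betw_def)
  have lof: "below r' B (f x) = f ` below r A x" if "x \<in> A" for x
    unfolding below_def B using f(3) that by blast
  have smlo: "small (below r A x)" for x unfolding below_def by (rule small_sub[OF A]) (intro fo A fo_drel[OF r(1)], auto)
  have fl: "fin (below r' B (f x)) \<longleftrightarrow> fin (below r A x)" if x: "x \<in> A" for x
  proof
    assume "fin (below r' B (f x))"
    then have "fin (f ` below r A x)" using lof[OF x] by simp
    then show "fin (below r A x)" by (rule fin_inj[OF inj_on_subset[OF inj] smlo f(1), rotated]) (auto simp: below_def)
  next
    assume "fin (below r A x)"
    then show "fin (below r' B (f x))" using fin_image[OF _ f(1)] lof[OF x] by simp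
  qed
  have 1: "{y \<in> B. fin (below r' B y)} = f ` {x \<in> A. fin (below r A x)}" using fl unfolding B by blast
  have 2: "{y \<in> B. \<not> fin (below r' B y)} = f ` {x \<in> A. \<not> fin (below r A x)}" using fl unfolding B by blast
  have "small {x \<in> A. fin (below r A x)}"
    unfolding below_def by (rule small_sub[OF A]) (intro fo A fo_drel[OF r(1)], auto)
  then show ?thesis using o fin_inj[OF inj_on_subset[OF inj] _ f(1), of "{x \<in> A. fin (below r A x)}"] fin_image[OF _ f(1)]
    unfolding omega_plus_finite_def 1 2 by blast
qed

section \<open>Types that are not exceptional\<close>

context tree begin

text \<open>The ends of a copy depend on its position in the tree, so the cases are whether all
  copies of the type have two ends or some copy has at most one. In the second case that copy
  contains a dense set; density is invariant under isomorphism, so every copy contains one.\<close>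

theorem nonexceptional:
  assumes T: "small T" "linear (T, rT)" "drel rT" and j: "dfun j" "bij_betw j T Omega"
    and ne: "\<not> omega_plus_finite rT T" "\<not> omega_plus_finite (\<lambda>x y. rT y x) T"
  shows "\<not> arrows (L, lt) (T, rT) (T, rT)"
proof -
  have jj: "\<exists>i. dfun i \<and> inj_on i (elts H) \<and> i ` elts H \<subseteq> Omega \<and> \<not> fin (elts H)" if iH: "iso (elts H, lt) (T, rT)" for H
  proof -
    obtain f where f: "dfun f" "bij_betw f (elts H) T" by (rule isoE[OF iH]) (rule that; assumption)
    have b: "bij_betw (\<lambda>x. j (f x)) (elts H) Omega" using bij_betw_trans[OF f(2) j(2)] by (simp add: comp_def)
    have d: "dfun (\<lambda>x. j (f x))" by (rule dfun_comp[OF f(1) j(1)])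
    have "\<not> fin (elts H)" using fin_image[OF _ d, of "elts H"] b not_fin_Omega by (auto simp: bij_betw_def)
    then show ?thesis using d b by (auto simp: bij_betw_def)
  qed
  show ?thesis
  proof (cases "\<forall>H. elts H \<subseteq> L \<longrightarrow> iso (elts H, lt) (T, rT) \<longrightarrow> (\<exists>u v. infinite_end H u \<and> infinite_end H v \<and> \<not> same_end H u v)")
    case True
    show ?thesis
    proof (rule not_arrowsI[OF smL dlt T(1,3), of end_colour])
      show "fo (\<lambda>s. end_colour (s 0))" by (intro fo)
      fix H assume H: "elts H \<subseteq> L" "iso (elts H, lt) (T, rT)"
      interpret H: subtree L lt al dl ei bit H by unfold_locales (rule H)
      obtain u v where uv: "infinite_end H u" "infinite_end H v" "\<not> same_end H u v" using True H by blast
      obtain i where i: "dfun i" "inj_on i (elts H)" "i ` elts H \<subseteq> Omega" using jj[OF H(2)] by blast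
      have nvu: "\<not> same_end H v u" using uv(3) H.same_end_sym by blast
      have tr: "iso (elts Y, lt) (T, rT)" if "iso (elts Y, lt) (elts H, lt)" for Y
        using iso_trans[OF that H(2) small_elts] .
      have uvL: "u \<in> L" "v \<in> L" using uv H(1) unfolding infinite_end_def by blast+
      have "u \<noteq> v" using uv H.same_end_refl unfolding infinite_end_def by blast
      then have "lt u v \<and> \<not> lt v u \<or> lt v u \<and> \<not> lt u v" using lt_total[OF uvL] lt_asym uvL by blast
      then show "(\<exists>X. elts X \<subseteq> elts H \<and> iso (elts X, lt) (T, rT) \<and> end_colour X) \<and>
        (\<exists>X. elts X \<subseteq> elts H \<and> iso (elts X, lt) (T, rT) \<and> \<not> end_colour X)"
        using H.split_ends[OF i uv] H.split_ends[OF i uv(2,1) nvu] tr by blast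
    qed
  next
    case False
    then obtain H0 where H0: "elts H0 \<subseteq> L" "iso (elts H0, lt) (T, rT)"
      "\<And>u v. infinite_end H0 u \<Longrightarrow> infinite_end H0 v \<Longrightarrow> same_end H0 u v" by blast
    interpret H0: subtree L lt al dl ei bit H0 by unfold_locales (rule H0)
    obtain i where i: "\<not> fin (elts H0)" "dfun i" "inj_on i (elts H0)" "i ` elts H0 \<subseteq> Omega" using jj[OF H0(2)] by blast
    have "iso (elts H0, \<lambda>x y. lt y x) (T, \<lambda>x y. rT y x)"
      using H0(2) unfolding iso_giso giso_rev[of _ "elts H0" lt T rT] .
    then have "\<not> omega_plus_finite lt (elts H0)" "\<not> omega_plus_finite (\<lambda>x y. lt y x) (elts H0)"
      using omega_plus_finite_iso[OF dlt T(3) small_elts H0(2)] omega_plus_finite_iso[OF drel_rev[OF dlt] drel_rev[OF T(3)] small_elts] ne by blast+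
    then obtain Q a b where Q: "small Q" "Q \<subseteq> elts H0" "a \<in> Q" "b \<in> Q" "lt a b"
       "\<And>x y. x \<in> Q \<Longrightarrow> y \<in> Q \<Longrightarrow> lt x y \<Longrightarrow> \<exists>z\<in>Q. lt x z \<and> lt z y"
      using H0.few_ends_dense[OF i(1) H0(3) i(2-4)] by blast
    show ?thesis
    proof (rule not_arrowsI[OF smL dlt T(1,3), of split_colour])
      show "fo (\<lambda>s. split_colour (s 0))" by (intro fo)
      fix H assume H: "elts H \<subseteq> L" "iso (elts H, lt) (T, rT)"
      obtain i where i: "dfun i" "inj_on i (elts H)" "i ` elts H \<subseteq> Omega" using jj[OF H(2)] by blast
      have iHH: "iso (elts H0, lt) (elts H, lt)" using iso_trans[OF H0(2) iso_sym[OF H(2) small_elts] small_elts] .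
      obtain f where f: "dfun f" "bij_betw f (elts H0) (elts H)"
        "\<And>x y. x \<in> elts H0 \<Longrightarrow> y \<in> elts H0 \<Longrightarrow> lt x y \<longleftrightarrow> lt (f x) (f y)" by (rule isoE[OF iHH]) (rule that; assumption)
      let ?Q = "f ` Q"
      have QH: "?Q \<subseteq> elts H" using Q(2) f(2) by (auto simp: bij_betw_def)
      have smQ: "small ?Q" by (rule small_image[OF f(1) Q(1)])
      have ordQ: "lt (f x) (f y) \<longleftrightarrow> lt x y" if "x \<in> Q" "y \<in> Q" for x y using f(3) that Q(2) by blast
      have dense: "\<exists>z\<in>?Q. lt x z \<and> lt z y" if "x \<in> ?Q" "y \<in> ?Q" "lt x y" for x y
      proof -
        obtain x' y' where x': "x' \<in> Q" "y' \<in> Q" "x = f x'" "y = f y'" using \<open>x \<in> ?Q\<close> \<open>y \<in> ?Q\<close> by blast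
        then obtain z where "z \<in> Q" "lt x' z" "lt z y'" using Q(6)[of x' y'] ordQ \<open>lt x y\<close> by blast
        then show ?thesis using ordQ x' by blast
      qed
      have QL: "?Q \<subseteq> L" using QH H(1) by blast
      have ab: "f a \<in> ?Q" "f b \<in> ?Q" "lt (f a) (f b)" using Q ordQ by blast+
      have iQ: "dfun i" "inj_on i ?Q" "i ` ?Q \<subseteq> Omega" using i inj_on_subset QH by blast+
      \<comment> \<open>Together with \<open>f a\<close> and \<open>f b\<close>, two intermediate
        points are carried to \<open>T\<close> by \<open>h\<close>; this is the increasing quadruple
        required by \<open>dense_colours\<close>.\<close>
      obtain p where p: "p \<in> ?Q" "lt (f a) p" "lt p (f b)" using dense[OF ab] by (elim bexE conjE)
      obtain q where q: "q \<in> ?Q" "lt p q" "lt q (f b)" using dense[OF p(1) ab(2) p(3)] by (elim bexE conjE)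
      note pq = p(1) q(1) p(2) q(2,3)
      obtain h where h: "dfun h" "bij_betw h (elts H) T"
        "\<And>x y. x \<in> elts H \<Longrightarrow> y \<in> elts H \<Longrightarrow> lt x y \<longleftrightarrow> rT (h x) (h y)" by (rule isoE[OF H(2)]) (rule that; assumption)
      have hT: "h x \<in> T" if "x \<in> ?Q" for x using bij_betw_apply[OF h(2)] QH that by blast
      have hr: "rT (h x) (h y)" if "x \<in> ?Q" "y \<in> ?Q" "lt x y" for x y using h(3) QH that by blast
      have jT: "dfun j" "inj_on j T" "j ` T \<subseteq> Omega" using j by (auto simp: bij_betw_def)
      have "\<exists>Y. elts Y \<subseteq> ?Q \<and> iso (elts Y, lt) (T, rT) \<and> (split_colour Y \<longleftrightarrow> c)" for c
        by (rule dense_colours[OF smQ QL dense ab iQ T jT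
            hT[OF ab(1)] hT[OF pq(1)] hT[OF pq(2)] hT[OF ab(2)] hr[OF ab(1) pq(1,3)] hr[OF pq(1,2,4)] hr[OF pq(2) ab(2) pq(5)]])
      note dc = this
      obtain Y where Y: "elts Y \<subseteq> ?Q" "iso (elts Y, lt) (T, rT)" "split_colour Y \<longleftrightarrow> True"
        using dc[of True] by (elim exE conjE)
      obtain Y' where Y': "elts Y' \<subseteq> ?Q" "iso (elts Y', lt) (T, rT)" "split_colour Y' \<longleftrightarrow> False"
        using dc[of False] by (elim exE conjE)
      have "elts Y \<subseteq> elts H" "elts Y' \<subseteq> elts H" using Y(1) Y'(1) QH by (meson order_trans)+
      with Y Y' show "(\<exists>X. elts X \<subseteq> elts H \<and> iso (elts X, lt) (T, rT) \<and> split_colour X) \<and>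
        (\<exists>X. elts X \<subseteq> elts H \<and> iso (elts X, lt) (T, rT) \<and> \<not> split_colour X)" by blast
    qed
  qed
qed

end

section \<open>Colourings of the infinite subsets of \<omega>\<close>

definition inf_subsets :: "'v::zf set \<Rightarrow> 'v set" where
  "inf_subsets A = {Z. elts Z \<subseteq> A \<and> \<not> fin (elts Z)}"

lemma subsets_omega:
  assumes "A \<subseteq> Omega" shows "subsets_of_type (A, (\<^bold>\<in>)) omega = inf_subsets A"
proof -
  have "iso (elts Z, (\<^bold>\<in>)) (Omega, (\<^bold>\<in>)) \<longleftrightarrow> \<not> fin (elts Z)" if Z: "elts Z \<subseteq> Omega" for Z :: 'a
  proof
    assume "iso (elts Z, (\<^bold>\<in>)) (Omega, (\<^bold>\<in>))"
    then obtain f where f: "dfun f" "bij_betw f (elts Z) Omega" by (rule isoE) (rule that; assumption)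
    then show "\<not> fin (elts Z)" using fin_image[OF _ f(1), of "elts Z"] not_fin_Omega by (auto simp: bij_betw_def)
  next
    assume "\<not> fin (elts Z)"
    then show "iso (elts Z, (\<^bold>\<in>)) (Omega, (\<^bold>\<in>))"
      using omega_like_iso(1)[OF drel_mem linear_sub[OF linear_mem Z] small_elts omega_like_sub[OF drel_mem omega_like_Omega small_elts Z]] by blast
  qed
  then show ?thesis using assms unfolding subsets_of_type_def inf_subsets_def omega_def by auto
qed

lemma arrows_omega:
  "arrows (omega :: 'v::zf ord) omega omega \<longleftrightarrow>
    (\<forall>F :: 'v. maps F (inf_subsets Omega) {zero, one} \<longrightarrow>
      (\<exists>H\<in>inf_subsets Omega. \<exists>c\<in>{zero, one}. \<forall>Z\<in>inf_subsets (elts H). app F Z = c))"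
proof -
  have "subsets_of_type (elts H, (\<^bold>\<in>)) omega = inf_subsets (elts H)" if "H \<in> inf_subsets Omega" for H :: 'v
    by (rule subsets_omega) (use that in \<open>auto simp: inf_subsets_def\<close>)
  then show ?thesis
    using subsets_omega[of "Omega :: 'v set"] unfolding arrows_def by (simp add: omega_def)
qed

lemma small_inf_subsets: "small A \<Longrightarrow> small (inf_subsets A)"
  unfolding inf_subsets_def by (rule small_sub[OF small_Pow]) (auto intro!: fo)

section \<open>The initial part and the finite tail of an order\<close>

lemma part_less:
  assumes r: "drel r" and T: "linear (T, r)" "small T" and a: "a \<in> T" "fin (below r T a)" and b: "b \<in> T" "\<not> fin (below r T b)"
  shows "r a b"
proof (rule ccontr)
  assume "\<not> r a b"
  then have "r b a" using linear_total[OF T(1) a(1) b(1)] a b by blast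
  then have "below r T b \<subseteq> below r T a" using linear_trans[OF T(1) _ \<open>r b a\<close>] a b unfolding below_def by blast
  moreover have "fo (\<lambda>s. s 0 \<in> below r T b)" unfolding below_def by (intro fo T fo_drel[OF r])
  ultimately show False using fin_subset a b by blast
qed

lemma part_wl:
  assumes r: "drel r" and T: "small T"
  shows "omega_like r {x \<in> T. fin (below r T x)}"
  unfolding omega_like_def
proof
  fix x assume "x \<in> {x \<in> T. fin (below r T x)}"
  then have "fin (below r T x)" by blast
  then show "fin (below r {x \<in> T. fin (below r T x)} x)"
  proof (rule fin_subset)
    show "fo (\<lambda>s. s 0 \<in> below r {x \<in> T. fin (below r T x)} x)" unfolding below_def by (intro fo T fo_drel[OF r])
  qed (auto simp: below_def)
qed

text \<open>No point of \<open>B\<close> lies below a point of \<open>A\<close>, and every point of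
  \<open>B\<close> has the infinite set \<open>A\<close> below it.\<close>

lemma part_eq:
  assumes r: "drel r" and T: "linear (A \<union> B, r)" "small A" "small B" and AB: "\<And>a b. a \<in> A \<Longrightarrow> b \<in> B \<Longrightarrow> r a b"
    and A: "omega_like r A" "\<not> fin A"
  shows "{x \<in> A \<union> B. fin (below r (A \<union> B) x)} = A" "{x \<in> A \<union> B. \<not> fin (below r (A \<union> B) x)} = B"
proof -
  have nba: "\<not> r b a" if "a \<in> A" "b \<in> B" for a b
    using linear_trans[OF T(1) AB[OF that], of a] linear_irrefl[OF T(1), of a] that by blast
  have "fin (below r (A \<union> B) a)" if "a \<in> A" for a
  proof -
    have "below r (A \<union> B) a = below r A a" using nba that unfolding below_def by blast
    then show ?thesis using A(1) that by (simp add: omega_like_def)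
  qed
  moreover have "\<not> fin (below r (A \<union> B) b)" if "b \<in> B" for b
  proof
    assume "fin (below r (A \<union> B) b)"
    moreover have "A \<subseteq> below r (A \<union> B) b" using AB that unfolding below_def by blast
    ultimately show False using fin_sub T(2) A(2) by blast
  qed
  ultimately show "{x \<in> A \<union> B. fin (below r (A \<union> B) x)} = A" "{x \<in> A \<union> B. \<not> fin (below r (A \<union> B) x)} = B" by blast+
qed

text \<open>An instance of \<open>thinning\<close> whose classes are \<open>A\<close> and the single
  points of \<open>B\<close>; the latter are all kept.\<close>

lemma part_thin:
  assumes r: "drel r" and T: "linear (A \<union> B, r)" "small A" "small B" and AB: "\<And>a b. a \<in> A \<Longrightarrow> b \<in> B \<Longrightarrow> r a b"
    and A: "omega_like r A" and A': "A' \<subseteq> A" "small A'" "\<not> fin A'"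
  shows "iso (A' \<union> B, r) (A \<union> B, r)"
proof -
  define q where "q x y \<longleftrightarrow> x = y \<or> (x \<in> A \<and> y \<in> A)" for x y
  have nba: "\<not> r b a" if "a \<in> A" "b \<in> B" for a b
    using linear_trans[OF T(1) AB[OF that], of a] linear_irrefl[OF T(1), of a] that by blast
  have disj: "x \<notin> B" if "x \<in> A" for x using AB[OF that] linear_irrefl[OF T(1), of x] that by blast
  have smT: "small (A \<union> B)" using small_union T by blast
  have c1: "{y \<in> A \<union> B. q x y} = A" if "x \<in> A" for x using that unfolding q_def by blast
  have c2: "{y \<in> A \<union> B. q x y} = {x}" if "x \<in> B" for x using that disj unfolding q_def by blast
  have w1: "omega_like r {x}" if "x \<in> B" for x
  proof -
    have "below r {x} x = {}" using linear_irrefl[OF T(1), of x] that unfolding below_def by blast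
    then show ?thesis by (simp add: omega_like_def)
  qed
  obtain f where f: "dfun f" "bij_betw f (A \<union> B) (A' \<union> B)"
    "\<And>x y. x \<in> A \<union> B \<Longrightarrow> y \<in> A \<union> B \<Longrightarrow> r x y \<longleftrightarrow> r (f x) (f y)" "\<And>x. x \<in> A \<union> B \<Longrightarrow> q x (f x)"
  proof (rule thinning[OF r T(1) smT, of "A' \<union> B" q])
    show "drel q" unfolding drel_def q_def by (intro fo T)
    show "small (A' \<union> B)" using small_union A' T by blast
    show "A' \<union> B \<subseteq> A \<union> B" using A' by blast
    show "q x x" for x unfolding q_def by blast
    show "q y x" if "q x y" for x y using that unfolding q_def by blast
    show "q x z" if "q x y" "q y z" for x y z using that unfolding q_def by blast
    show "q x y" if xyz: "x \<in> A \<union> B" "y \<in> A \<union> B" "z \<in> A \<union> B" "r x y" "r y z" "q x z" for x y z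
    proof (cases "x = z")
      case True
      then show ?thesis using linear_trans[OF T(1) xyz(4,5)] linear_irrefl[OF T(1)] xyz by blast
    next
      case False
      then show ?thesis using xyz nba[of z y] unfolding q_def by blast
    qed
    show "omega_like r {y \<in> A \<union> B. q x y} \<or> omega_like (\<lambda>x y. r y x) {y \<in> A \<union> B. q x y}" if "x \<in> A \<union> B" for x
      using that c1[of x] c2[of x] A w1[of x] by auto
    show "{y \<in> A \<union> B. q x y} \<subseteq> A' \<union> B \<or> \<not> fin {y \<in> A' \<union> B. q x y}" if x: "x \<in> A \<union> B" for x
    proof (cases "x \<in> A")
      case True
      have "A' \<subseteq> {y \<in> A' \<union> B. q x y}" using True A'(1) unfolding q_def by blast
      then show ?thesis using fin_sub A' by blast
    next
      case False
      then show ?thesis using x c2[of x] by auto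
    qed
  qed (rule that; assumption)
  have "iso (A \<union> B, r) (A' \<union> B, r)" by (rule isoI[OF f(1) smT f(2)]) (rule f(3))
  then show ?thesis using iso_sym smT by blast
qed

text \<open>The greatest point moved upwards would be sent to a larger point that is also moved
  upwards. The same argument in the reversed order excludes points moved downwards.\<close>

lemma fin_rigid:
  assumes r: "drel r" and B: "fin B" "linear (B, r)" and f: "dfun f" "f ` B \<subseteq> B"
    "\<And>x y. x \<in> B \<Longrightarrow> y \<in> B \<Longrightarrow> r x y \<Longrightarrow> r (f x) (f y)" and x: "x \<in> B"
  shows "f x = x"
proof -
  have no: "\<not> q x (f x)" if q: "drel q" "linear (B, q)" "\<And>x y. x \<in> B \<Longrightarrow> y \<in> B \<Longrightarrow> q x y \<Longrightarrow> q (f x) (f y)" and x: "x \<in> B" for q x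
  proof
    assume a: "q x (f x)"
    let ?C = "{x \<in> B. q x (f x)}"
    have "fin ?C" by (rule fin_subset[OF B(1)]) (auto intro!: fo fo_drel[OF q(1)] fot_dfun[OF f(1)] fin_sm[OF B(1)])
    moreover have "?C \<noteq> {}" using x a by blast
    moreover have "linear (?C, q)" by (rule linear_sub[OF q(2)]) blast
    ultimately obtain m where m: "m \<in> ?C" "\<And>y. y \<in> ?C \<Longrightarrow> y = m \<or> q y m"
      using fin_max[OF _ _ q(1)[unfolded drel_def], of ?C] by blast
    then have mB: "m \<in> B" "f m \<in> B" "q m (f m)" using f(2) by blast+
    then have "f m \<in> ?C" using q(3) by blast
    then have "f m = m \<or> q (f m) m" by (rule m(2))
    then have "q m m" using mB linear_trans[OF q(2), of m "f m" m] by metis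
    then show False using linear_irrefl[OF q(2)] mB by blast
  qed
  have "\<not> r x (f x)" by (rule no[OF r B(2) f(3) x])
  moreover have "\<not> r (f x) x" using no[OF drel_rev[OF r] linear_rev[OF B(2)] _ x] f(3) by blast
  moreover have "f x \<in> B" using f(2) x by blast
  ultimately show ?thesis using linear_total[OF B(2) x \<open>f x \<in> B\<close>] by simp
qed

text \<open>In a fixed copy with initial part \<open>A\<close> and tail \<open>B\<close>, an
  infinite set \<open>Z\<close> of numbers determines the copy \<open>U Z\<close>, made of the
  points of \<open>A\<close> numbered by \<open>Z\<close> and of all of \<open>B\<close>. Colouring
  \<open>Z\<close> like \<open>U Z\<close> reduces the claim to \<omega>, because every subset of
  \<open>U Z\<close> of the right type has this form again.\<close>

theorem arrows_of_omega:
  assumes L: "small L" "drel lt" "linear (L, lt)" and T: "small T" "drel rT" and o: "omega_plus_finite rT T"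
    and H0: "elts H0 \<subseteq> L" "iso (elts H0, lt) (T, rT)"
    and ar: "arrows (omega :: 'v::zf ord) omega omega"
  shows "arrows (L, lt) (T :: 'v set, rT) (T, rT)"
  unfolding arrows_def
proof (intro allI impI)
  fix F assume F: "maps F (subsets_of_type (L, lt) (T, rT)) {zero, one}"
  have oH: "omega_plus_finite lt (elts H0)" using omega_plus_finite_iso[OF T(2) L(2) T(1) iso_sym[OF H0(2) small_elts] o] .
  have linH: "linear (elts H0, lt)" using linear_sub[OF L(3) H0(1)] .
  define A where "A = {x \<in> elts H0. fin (below lt (elts H0) x)}"
  define B where "B = {x \<in> elts H0. \<not> fin (below lt (elts H0) x)}"
  have AB: "elts H0 = A \<union> B" unfolding A_def B_def by blast
  have smA: "small A" unfolding A_def below_def by (rule small_sub[OF small_elts[of H0]]) (auto intro!: fo fo_drel[OF L(2)])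
  have finB: "fin B" and infA: "\<not> fin A" using oH unfolding omega_plus_finite_def A_def B_def by blast+
  have smB: "small B" using fin_sm[OF finB] .
  have wlA: "omega_like lt A" unfolding A_def by (rule part_wl[OF L(2) small_elts])
  have less: "lt a b" if "a \<in> A" "b \<in> B" for a b
    using part_less[OF L(2) linH small_elts] that unfolding A_def B_def by blast
  have disj: "x \<notin> B" if "x \<in> A" for x using that unfolding A_def B_def by blast
  have linA: "linear (A, lt)" using linear_sub[OF linH] AB by blast
  have linAB: "linear (A \<union> B, lt)" using linH AB by simp
  obtain f where f: "dfun f" "bij_betw f A Omega" "\<And>x y. x \<in> A \<Longrightarrow> y \<in> A \<Longrightarrow> lt x y \<longleftrightarrow> f x \<^bold>\<in> f y"
    by (rule isoE[OF omega_like_iso(1)[OF L(2) linA smA wlA infA]]) (rule that; assumption)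
  define U where "U Z = st ({x \<in> A. f x \<in> elts Z} \<union> B)" for Z
  have smU: "small {x \<in> A. f x \<in> elts Z}" for Z
    by (rule small_sub[OF smA]) (auto intro!: fo fot_dfun[OF f(1)] smA)
  have U: "elts (U Z) = {x \<in> A. f x \<in> elts Z} \<union> B" for Z
    unfolding U_def by (rule elts_st[OF small_union[OF smU smB]])
  have fU: "fot t \<Longrightarrow> fot (\<lambda>s. U (t s))" for t
    by (rule fot1[of U]) (unfold U_def, intro fo fot_dfun[OF f(1)] smA smB)
  have UL: "elts (U Z) \<subseteq> L" for Z using AB H0(1) unfolding U by blast
  have UT: "iso (elts (U Z), lt) (T, rT)" if Z: "Z \<in> inf_subsets Omega" for Z
  proof -
    have "f ` {x \<in> A. f x \<in> elts Z} = elts Z"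
    proof
      show "elts Z \<subseteq> f ` {x \<in> A. f x \<in> elts Z}"
      proof
        fix n assume n: "n \<in> elts Z"
        then have "n \<in> f ` A" using f(2) Z by (auto simp: bij_betw_def inf_subsets_def)
        then show "n \<in> f ` {x \<in> A. f x \<in> elts Z}" using n by blast
      qed
    qed blast
    then have "\<not> fin {x \<in> A. f x \<in> elts Z}"
      using fin_image[OF _ f(1), of "{x \<in> A. f x \<in> elts Z}"] Z by (auto simp: inf_subsets_def)
    then have "iso (elts (U Z), lt) (elts H0, lt)" unfolding U AB
      using part_thin[OF L(2) linAB smA smB less wlA _ smU] by blast
    then show ?thesis using iso_trans[OF _ H0(2) small_elts] by blast
  qed
  have US: "U Z \<in> subsets_of_type (L, lt) (T, rT)" if "Z \<in> inf_subsets Omega" for Z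
    using UL UT[OF that] by (simp add: subsets_of_type_def)
  have dU: "dfun (\<lambda>Z. ap F (U Z))" by (rule dfunI) (intro fo fU)
  have iU: "(\<lambda>Z. ap F (U Z)) ` inf_subsets Omega \<subseteq> {zero, one}" using maps_ap(3)[OF F US] by blast
  obtain G where G: "maps G (inf_subsets Omega) {zero, one}" "\<And>Z. Z \<in> inf_subsets Omega \<Longrightarrow> ap G Z = ap F (U Z)"
    using maps_graph[OF dU small_inf_subsets[OF small_Omega] iU] by (elim exE conjE) simp
  then obtain Z0 c where Z0: "Z0 \<in> inf_subsets Omega" "c \<in> {zero, one}" "\<And>Z. Z \<in> inf_subsets (elts Z0) \<Longrightarrow> app G Z = c"
    using ar unfolding arrows_omega by blast
  have "app F X = c" if X: "X \<in> subsets_of_type (elts (U Z0), lt) (T, rT)" for X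
  proof -
    have XU: "elts X \<subseteq> elts (U Z0)" and iX: "iso (elts X, lt) (T, rT)" using X by (auto simp: subsets_of_type_def)
    have "iso (elts H0, lt) (elts X, lt)" using iso_trans[OF H0(2) iso_sym[OF iX small_elts] small_elts] .
    then obtain p where p: "dfun p" "bij_betw p (elts H0) (elts X)"
      "\<And>x y. x \<in> elts H0 \<Longrightarrow> y \<in> elts H0 \<Longrightarrow> lt x y \<longleftrightarrow> lt (p x) (p y)" by (rule isoE) (rule that; assumption)
    have pX: "p x \<in> elts X" if "x \<in> elts H0" for x using bij_betw_apply[OF p(2) that] .
    have XH: "elts X \<subseteq> elts H0" using XU unfolding U AB by blast
    \<comment> \<open>\<open>p\<close> is an isomorphism onto a subset of \<open>H0\<close>: the
      infinitely many predecessors of \<open>b\<close> are mapped below \<open>p b\<close>, which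
      therefore belongs to the tail. By \<open>fin_rigid\<close> each point of \<open>B\<close> is
      then fixed, so \<open>B\<close> is contained in \<open>X\<close>.\<close>
    have pB: "p b \<in> B" if b: "b \<in> B" for b
    proof (rule ccontr)
      assume "p b \<notin> B"
      have bH: "b \<in> elts H0" using b AB by blast
      then have "p b \<in> A" using pX XH \<open>p b \<notin> B\<close> AB by blast
      then have fl: "fin (below lt (elts H0) (p b))" unfolding A_def by blast
      have "p ` below lt (elts H0) b \<subseteq> below lt (elts H0) (p b)"
        using p(3)[OF _ bH] pX XH unfolding below_def by blast
      moreover have smlo: "small (below lt (elts H0) b)"
        unfolding below_def by (rule small_sub[OF small_elts[of H0]]) (auto intro!: fo fo_drel[OF L(2)])
      ultimately have "fin (p ` below lt (elts H0) b)" using fin_sub[OF fl] small_image[OF p(1)] by blast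
      moreover have "inj_on p (below lt (elts H0) b)"
        by (rule inj_on_subset[OF bij_betw_imp_inj_on[OF p(2)]]) (auto simp: below_def)
      ultimately have "fin (below lt (elts H0) b)" using fin_inj[OF _ smlo p(1)] by blast
      then show False using b unfolding B_def by blast
    qed
    have "p b = b" if b: "b \<in> B" for b
    proof (rule fin_rigid[OF L(2) finB _ p(1) _ _ b])
      show "linear (B, lt)" using linear_sub[OF linH] AB by blast
      show "p ` B \<subseteq> B" using pB by blast
      show "lt (p x) (p y)" if "x \<in> B" "y \<in> B" "lt x y" for x y using p(3) that AB by blast
    qed
    then have BX: "B \<subseteq> elts X" using pX AB by (metis UnCI subsetI)
    define Z where "Z = st (f ` (elts X \<inter> A))"
    have smXA: "small (elts X \<inter> A)" by (rule small_sub[OF smA]) (auto intro!: fo smA)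
    have Z: "elts Z = f ` (elts X \<inter> A)" unfolding Z_def by (rule elts_st[OF small_image[OF f(1) smXA]])
    have injf: "inj_on f A" using f(2) by (simp add: bij_betw_def)
    have "{x \<in> A. f x \<in> elts Z} = elts X \<inter> A" unfolding Z using injf by (auto dest: inj_onD)
    then have "elts (U Z) = elts X" unfolding U using BX XH AB by blast
    then have UZ: "U Z = X" by (simp add: elts_inject)
    have "\<not> fin (elts X \<inter> A)"
    proof
      assume "fin (elts X \<inter> A)"
      then have "fin ((elts X \<inter> A) \<union> B)" using fin_Un finB by blast
      moreover have "(elts X \<inter> A) \<union> B = elts X" using BX XH AB by blast
      ultimately have "fin (p ` elts H0)" using p(2) by (simp add: bij_betw_def)
      then have "fin (elts H0)" using fin_inj[OF bij_betw_imp_inj_on[OF p(2)] small_elts p(1)] by blast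
      then show False using fin_sub[OF _ _ smA] infA AB by blast
    qed
    then have "\<not> fin (elts Z)" unfolding Z using fin_inj[OF inj_on_subset[OF injf] smXA f(1)] by blast
    moreover have "elts Z \<subseteq> elts Z0" unfolding Z using XU disj unfolding U by blast
    ultimately have Zi: "Z \<in> inf_subsets (elts Z0)" "Z \<in> inf_subsets Omega" using Z0(1) unfolding inf_subsets_def by blast+
    have "app F X = ap F (U Z)" using maps_ap(1)[OF F US[OF Zi(2)]] UZ by simp
    also have "\<dots> = app G Z" using G(2)[OF Zi(2)] maps_ap(1)[OF G(1) Zi(2)] by simp
    finally show ?thesis using Z0(3)[OF Zi(1)] by simp
  qed
  then show "\<exists>H\<in>subsets_of_type (L, lt) (T, rT). \<exists>c\<in>{zero, one}.
      \<forall>X\<in>subsets_of_type (elts H, snd (L, lt)) (T, rT). app F X = c"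
    using US[OF Z0(1)] Z0(2) by auto
qed

section \<open>Levels at which an increasing sequence leaves its limit\<close>

context tree begin

definition omega_part :: "'v \<Rightarrow> 'v set" where "omega_part X = {x \<in> elts X. fin (below lt (elts X) x)}"

lemma fo_omega_part [fo]: "fot t \<Longrightarrow> fot u \<Longrightarrow> fo (\<lambda>s. t s \<in> omega_part (u s))"
  by (rule fo2[of "\<lambda>x y. x \<in> omega_part y"]) (unfold omega_part_def below_def, intro fo)

text \<open>As \<open>y\<close> increases in \<open>A\<close>, \<open>dl x y\<close> can only
  decrease (\<open>tri\<close>); its least value is the level at which \<open>x\<close> leaves the
  limit of \<open>A\<close>. The locale asserts no completeness, hence a description without the
  limit point.\<close>

definition limit_level :: "'v set \<Rightarrow> 'v \<Rightarrow> 'v \<Rightarrow> bool" where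
  "limit_level A x d \<longleftrightarrow> (\<exists>y\<in>A. lt x y \<and> dl x y = d) \<and> (\<forall>y\<in>A. lt x y \<longrightarrow> le d (dl x y))"

definition limit_levels :: "'v \<Rightarrow> 'v set" where
  "limit_levels X = {n. \<exists>x\<in>omega_part X. \<exists>d. limit_level (omega_part X) x d \<and> ei d = n}"

lemma fo_limit_levels [fo]: "fot t \<Longrightarrow> fot u \<Longrightarrow> fo (\<lambda>s. t s \<in> limit_levels (u s))"
  by (rule fo2[of "\<lambda>x y. x \<in> limit_levels y"]) (unfold limit_levels_def limit_level_def le_def, intro fo)

context
  fixes A
  assumes A: "small A" "A \<subseteq> L" "omega_like lt A" "\<not> fin A"
begin

lemma omega_like_unbounded: "x \<in> A \<Longrightarrow> \<exists>y\<in>A. lt x y"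
proof (rule ccontr)
  assume x: "x \<in> A" and "\<not> (\<exists>y\<in>A. lt x y)"
  then have "A \<subseteq> insert x (below lt A x)" using lt_total A(2) unfolding below_def by blast
  moreover have "fin (insert x (below lt A x))" using A(3) x fin_insert unfolding omega_like_def by blast
  ultimately show False using fin_sub A by blast
qed

lemma limit_level_ex:
  assumes x: "x \<in> A" shows "\<exists>d\<in>al. limit_level A x d"
proof -
  let ?D = "{d. \<exists>y\<in>A. lt x y \<and> d = dl x y}"
  have "?D \<subseteq> al" using dl_al' A(2) x by blast
  moreover have "?D \<noteq> {}" using omega_like_unbounded[OF x] by blast
  moreover have "fo (\<lambda>s. s 0 \<in> ?D)" by (intro fo A)
  ultimately obtain d where d: "d \<in> ?D" "\<And>d'. d' \<in> ?D \<Longrightarrow> d' = d \<or> d \<in> elts d'" "d \<in> al"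
    using al_least[of ?D] by blast
  have "le d (dl x y)" if "y \<in> A" "lt x y" for y using d(2)[of "dl x y"] that unfolding le_def by blast
  then have "limit_level A x d" using d(1) unfolding limit_level_def by blast
  then show ?thesis using d(3) by blast
qed

lemma limit_level_al: "x \<in> A \<Longrightarrow> limit_level A x d \<Longrightarrow> d \<in> al"
  unfolding limit_level_def using dl_al' A(2) by blast

lemma limit_level_unique:
  assumes "x \<in> A" "limit_level A x d" "limit_level A x d'" shows "d = d'"
proof -
  have "le d d'" "le d' d" using assms unfolding limit_level_def by blast+
  then show ?thesis using al_asym[of d d'] limit_level_al assms unfolding le_def by blast
qed

text \<open>If \<open>y\<close> attains the level \<open>d\<close> of \<open>x\<close>, and
  \<open>z\<close> attains the level \<open>d'\<close> of \<open>y\<close>, then \<open>d\<close>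
  and \<open>d'\<close> differ and \<open>dl x z\<close> is the smaller one; it cannot be below
  \<open>d\<close>.\<close>

lemma limit_level_grows:
  assumes "x \<in> A" "limit_level A x d" shows "\<exists>y\<in>A. \<exists>d'. limit_level A y d' \<and> d \<in> elts d'"
proof -
  obtain y where y: "y \<in> A" "lt x y" "dl x y = d" using assms unfolding limit_level_def by blast
  obtain d' where d': "limit_level A y d'" using limit_level_ex[OF y(1)] by blast
  then obtain z where z: "z \<in> A" "lt y z" "dl y z = d'" unfolding limit_level_def by blast
  have L: "x \<in> L" "y \<in> L" "z \<in> L" using A(2) assms y z by blast+
  have "le d (dl x z)" using assms(2) z lt_trans[OF y(2) z(2) L] unfolding limit_level_def by blast
  moreover have "d \<in> al" "d' \<in> al" using limit_level_al assms y d' by blast+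
  ultimately have "d \<in> elts d'" using tri[OF L y(2) z(2)] y z al_asym[of d' d] unfolding le_def by auto
  then show ?thesis using d' y by blast
qed

text \<open>The value \<open>d\<close> attained at \<open>y\<close> persists at all later points,
  and an infinite \<open>A'\<close> reaches \<open>y\<close> or a point beyond it. Thinning thus
  selects levels without altering them.\<close>

lemma limit_level_sub:
  assumes A': "A' \<subseteq> A" "small A'" "\<not> fin A'" and x: "x \<in> A'"
  shows "limit_level A' x d \<longleftrightarrow> limit_level A x d"
proof -
  have 1: "limit_level A' x d" if d: "limit_level A x d" for d
  proof -
    obtain y where y: "y \<in> A" "lt x y" "dl x y = d" using d unfolding limit_level_def by blast
    have "\<exists>z\<in>A'. y = z \<or> lt y z"
    proof (rule ccontr)
      assume "\<not> ?thesis"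
      then have "A' \<subseteq> below lt A y" using lt_total A(2) A'(1) y(1) unfolding below_def by blast
      then show False using fin_sub A' A(3) y(1) unfolding omega_like_def by blast
    qed
    then obtain z where z: "z \<in> A'" "y = z \<or> lt y z" by blast
    have L: "x \<in> L" "y \<in> L" "z \<in> L" using A(2) A'(1) x y z by blast+
    have xz: "lt x z" using z(2) y(2) lt_trans[OF y(2) _ L] by blast
    have "le (dl x z) d" using z(2) tri_le(1)[OF L y(2)] y(3) unfolding le_def by auto
    moreover have "le d (dl x z)" using d xz z A'(1) unfolding limit_level_def by blast
    moreover have "dl x z \<in> al" "d \<in> al" using dl_al' L xz limit_level_al d x A'(1) by blast+
    ultimately have "dl x z = d" using al_asym[of d "dl x z"] unfolding le_def by blast
    then show ?thesis using d z xz A'(1) unfolding limit_level_def by blast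
  qed
  have xA: "x \<in> A" using x A'(1) by blast
  obtain d0 where d0: "limit_level A x d0" using limit_level_ex[OF xA] by blast
  show ?thesis
  proof
    assume d: "limit_level A' x d"
    have "le d d0" "le d0 d" using d 1[OF d0] unfolding limit_level_def by blast+
    moreover have "d0 \<in> al" "d \<in> al" using limit_level_al[OF xA d0] d dl_al' A(2) A'(1) x unfolding limit_level_def by blast+
    ultimately have "d = d0" using al_asym[of d d0] unfolding le_def by blast
    then show "limit_level A x d" using d0 by simp
  qed (rule 1)
qed

lemma small_levels: "small {n. \<exists>x\<in>A. \<exists>d. limit_level A x d \<and> ei d = n}"
  by (rule small_sub[OF small_Omega]) (unfold limit_level_def le_def, intro fo A, use ei_Omega dl_al' A(2) in blast)

text \<open>By \<open>limit_level_grows\<close> the levels have no greatest element, as a non-empty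
  finite set of levels would.\<close>

lemma levels_infinite: "\<not> fin {n. \<exists>x\<in>A. \<exists>d. limit_level A x d \<and> ei d = n}"
proof
  let ?D = "{d \<in> al. \<exists>x\<in>A. limit_level A x d}"
  assume f: "fin {n. \<exists>x\<in>A. \<exists>d. limit_level A x d \<and> ei d = n}"
  have fD: "fo (\<lambda>s. s 0 \<in> ?D)" unfolding limit_level_def le_def by (intro fo A small_al)
  have smD: "small ?D" by (rule small_sub[OF small_al fD]) blast
  have inj: "inj_on ei ?D" by (rule inj_on_subset[OF bij_betw_imp_inj_on[OF bij_ei]]) blast
  have "fin (ei ` ?D)" by (rule fin_sub[OF f _ small_image[OF dei smD]]) blast
  then have finD: "fin ?D" by (rule fin_inj[OF inj smD dei])
  have "A \<noteq> {}" using A(4) fin_empty by metis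
  then have "?D \<noteq> {}" using limit_level_ex by blast
  then obtain d where d: "d \<in> ?D" "\<And>d'. d' \<in> ?D \<Longrightarrow> d' = d \<or> d' \<^bold>\<in> d"
    using fin_max[OF finD _ drel_mem[unfolded drel_def]] linear_sub[OF lin_al, of ?D] by blast
  obtain x where "x \<in> A" "limit_level A x d" using d(1) by blast
  then obtain y d' where d': "y \<in> A" "limit_level A y d'" "d \<in> elts d'" using limit_level_grows by blast
  have al: "d \<in> al" "d' \<in> al" using d(1) limit_level_al[OF d'(1,2)] by blast+
  then have "d' = d \<or> d' \<in> elts d" using d(2)[of d'] d' by (auto simp: mem_iff)
  then show False using al_asym[OF d'(3) al] d'(3) by auto
qed

end

text \<open>A copy \<open>X\<close> receives the colour that \<open>G\<close> gives to
  \<open>limit_levels X\<close>. In a homogeneous copy \<open>H\<close>, every infinite subset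
  \<open>Z\<close> of \<open>limit_levels H\<close> is the level set of a smaller copy: the points
  whose level has its index in \<open>Z\<close>, together with the tail.\<close>

theorem omega_of_arrows:
  assumes T: "small T" "drel rT" "omega_plus_finite rT T" and ar: "arrows (L, lt) (T, rT) (T, rT)"
  shows "arrows (omega :: 'v ord) omega omega"
  unfolding arrows_omega
proof (intro allI impI)
  fix G :: 'v assume G: "maps G (inf_subsets Omega) {zero, one}"
  have parts: "small (omega_part X) \<and> omega_part X \<subseteq> L \<and> omega_like lt (omega_part X) \<and> \<not> fin (omega_part X)"
    if X: "elts X \<subseteq> L" "iso (elts X, lt) (T, rT)" for X
  proof -
    have "omega_plus_finite lt (elts X)" using omega_plus_finite_iso[OF T(2) dlt T(1) iso_sym[OF X(2) small_elts] T(3)] .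
    moreover have "small (omega_part X)" by (rule small_sub[OF small_elts[of X]]) (intro fo, auto simp: omega_part_def)
    moreover have "omega_like lt (omega_part X)" unfolding omega_part_def by (rule part_wl[OF dlt small_elts])
    ultimately show ?thesis using X(1) unfolding omega_part_def omega_plus_finite_def by blast
  qed
  have lv: "st (limit_levels X) \<in> inf_subsets Omega \<and> elts (st (limit_levels X)) = limit_levels X" if X: "elts X \<subseteq> L" "iso (elts X, lt) (T, rT)" for X
  proof -
    note p = parts[OF X]
    have "small (limit_levels X)" unfolding limit_levels_def using small_levels p by blast
    moreover have "\<not> fin (limit_levels X)" unfolding limit_levels_def using levels_infinite p by blast
    moreover have "limit_levels X \<subseteq> Omega" unfolding limit_levels_def using limit_level_al[of "omega_part X"] p ei_Omega by blast
    ultimately show ?thesis by (simp add: inf_subsets_def elts_st)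
  qed
  have fP: "fo (\<lambda>s. ap G (st (limit_levels (s 0))) = zero)" by (intro fo)
  obtain F where F: "maps F (subsets_of_type (L, lt) (T, rT)) {zero, one}"
    "\<And>X. X \<in> subsets_of_type (L, lt) (T, rT) \<Longrightarrow> app F X = (if ap G (st (limit_levels X)) = zero then zero else one)"
    using colouring_exists[OF small_subsets[OF smL dlt T(1,2)] fP] by blast
  obtain H c where H: "H \<in> subsets_of_type (L, lt) (T, rT)" "c \<in> {zero, one}"
    "\<And>X. X \<in> subsets_of_type (elts H, lt) (T, rT) \<Longrightarrow> app F X = c"
    using ar F(1) unfolding arrows_def by (metis snd_conv)
  have HL: "elts H \<subseteq> L" "iso (elts H, lt) (T, rT)" using H(1) by (auto simp: subsets_of_type_def)
  define A where "A = omega_part H"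
  define B where "B = {x \<in> elts H. \<not> fin (below lt (elts H) x)}"
  have pA: "small A" "A \<subseteq> L" "omega_like lt A" "\<not> fin A" using parts[OF HL] unfolding A_def by blast+
  have AB: "elts H = A \<union> B" unfolding A_def B_def omega_part_def by blast
  have linH: "linear (A \<union> B, lt)" using linear_sub[OF linL HL(1)] AB by simp
  have smB: "small B" unfolding B_def below_def by (rule small_sub[OF small_elts[of H]]) (auto intro!: fo)
  have less: "lt a b" if "a \<in> A" "b \<in> B" for a b
    using part_less[OF dlt linear_sub[OF linL HL(1)] small_elts] that unfolding A_def B_def omega_part_def by blast
  have "app G Z = c" if Z: "Z \<in> inf_subsets (elts (st (limit_levels H)))" for Z
  proof -
    have ZH: "elts Z \<subseteq> limit_levels H" "\<not> fin (elts Z)" using Z lv[OF HL] unfolding inf_subsets_def by auto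
    define A' where "A' = {x \<in> A. \<exists>d. limit_level A x d \<and> ei d \<in> elts Z}"
    have smA': "small A'" unfolding A'_def limit_level_def le_def by (rule small_sub[OF pA(1)]) (intro fo pA, blast)
    have A'A: "A' \<subseteq> A" unfolding A'_def by blast
    have infA': "\<not> fin A'"
    proof
      assume f: "fin A'"
      \<comment> \<open>Several points may leave the limit at the same level, so \<open>v\<close>
        need not be injective; since it maps \<open>A'\<close> onto a superset of \<open>Z\<close>,
        a finite \<open>A'\<close> is impossible.\<close>
      define v where "v x = ei (the0 (\<lambda>d. limit_level A x d))" for x
      have dv: "dfun v" unfolding v_def limit_level_def le_def by (rule dfunI) (intro fo pA)
      have vx: "v x = ei d" if "x \<in> A" "limit_level A x d" for x d
      proof -
        have "the0 (\<lambda>d. limit_level A x d) = d"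
          by (rule the0_eq[of "\<lambda>d. limit_level A x d", OF that(2)]) (rule limit_level_unique[OF pA that(1) _ that(2)])
        then show ?thesis unfolding v_def by simp
      qed
      have "elts Z \<subseteq> v ` A'"
      proof
        fix n assume n: "n \<in> elts Z"
        then obtain x d where xd: "x \<in> A" "limit_level A x d" "ei d = n" using ZH(1) unfolding limit_levels_def A_def by blast
        then have "x \<in> A'" using n unfolding A'_def by blast
        moreover have "v x = n" using vx[OF xd(1,2)] xd(3) by simp
        ultimately show "n \<in> v ` A'" by blast
      qed
      then show False using fin_sub[OF fin_image[OF f dv] _ small_elts] ZH(2) by blast
    qed
    define Y where "Y = st (A' \<union> B)"
    have Y: "elts Y = A' \<union> B" unfolding Y_def by (rule elts_st[OF small_union[OF smA' smB]])
    have YH: "elts Y \<subseteq> elts H" using Y AB A'A by blast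
    have "iso (elts Y, lt) (elts H, lt)" unfolding Y AB
      by (rule part_thin[OF dlt linH pA(1) smB less pA(3) A'A smA' infA'])
    then have iY: "iso (elts Y, lt) (T, rT)" using iso_trans[OF _ HL(2) small_elts] by blast
    have lY: "omega_part Y = A'"
    proof -
      have "linear (A' \<union> B, lt)" by (rule linear_sub[OF linH]) (use A'A in blast)
      then show ?thesis unfolding omega_part_def Y
        by (rule part_eq(1)[OF dlt _ smA' smB _ omega_like_sub[OF dlt pA(3) smA' A'A] infA']) (use less A'A in blast)
    qed
    have dY: "limit_level A' x d \<longleftrightarrow> limit_level A x d" if "x \<in> A'" for x d
      by (rule limit_level_sub[OF pA A'A smA' infA' that])
    have "limit_levels Y = elts Z"
    proof
      show "limit_levels Y \<subseteq> elts Z"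
      proof
        fix n assume "n \<in> limit_levels Y"
        then obtain x d where x: "x \<in> A'" "limit_level A' x d" "ei d = n" unfolding limit_levels_def lY by blast
        then have xA: "x \<in> A" "limit_level A x d" using dY A'A by blast+
        obtain d' where d': "limit_level A x d'" "ei d' \<in> elts Z" using x(1) unfolding A'_def by blast
        have "d = d'" by (rule limit_level_unique[OF pA xA(1,2) d'(1)])
        then show "n \<in> elts Z" using d' x by simp
      qed
      show "elts Z \<subseteq> limit_levels Y"
      proof
        fix n assume n: "n \<in> elts Z"
        then obtain x d where xd: "x \<in> A" "limit_level A x d" "ei d = n" using ZH(1) unfolding limit_levels_def A_def by blast
        then have xA': "x \<in> A'" using n unfolding A'_def by blast
        then have "limit_level A' x d" using dY xd by blast
        then show "n \<in> limit_levels Y" using xA' xd(3) unfolding limit_levels_def lY by blast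
      qed
    qed
    then have sZ: "st (limit_levels Y) = Z" by simp
    have "Y \<in> subsets_of_type (elts H, lt) (T, rT)" "Y \<in> subsets_of_type (L, lt) (T, rT)"
      using YH HL iY by (auto simp: subsets_of_type_def)
    then have e: "(if ap G Z = zero then zero else one) = c" using H(3) F(2) sZ by metis
    have ZO: "Z \<in> inf_subsets Omega" using Z lv[OF HL] unfolding inf_subsets_def by auto
    then show ?thesis using e maps_ap(1,3)[OF G ZO] zero_neq_one by (auto split: if_splits)
  qed
  then show "\<exists>H\<in>inf_subsets Omega. \<exists>c\<in>{zero, one}. \<forall>Z\<in>inf_subsets (elts H). app G Z = c"
    using lv[OF HL] H(2) by blast
qed

end

section \<open>Concatenations and exceptional types\<close>

lemma concat_isoI:
  assumes A: "small A" "small B" and AB: "\<And>a b. a \<in> A \<Longrightarrow> b \<in> B \<Longrightarrow> r a b \<and> \<not> r b a"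
    and iA: "iso (A, r) (P, p)" and iB: "iso (B, r) (Q, q)"
  shows "iso (A \<union> B, r) (concat_ord (P, p) (Q, q))"
proof -
  obtain f where f: "dfun f" "bij_betw f A P" "\<And>x y. x \<in> A \<Longrightarrow> y \<in> A \<Longrightarrow> r x y \<longleftrightarrow> p (f x) (f y)"
    by (rule isoE[OF iA]) (rule that; assumption)
  obtain g where g: "dfun g" "bij_betw g B Q" "\<And>x y. x \<in> B \<Longrightarrow> y \<in> B \<Longrightarrow> r x y \<longleftrightarrow> q (g x) (g y)"
    by (rule isoE[OF iB]) (rule that; assumption)
  have disj: "x \<notin> A" if "x \<in> B" for x using AB[of x x] that by blast
  define h where "h x = (if x \<in> A then opair zero (f x) else opair one (g x))" for x
  have hA: "h x = opair zero (f x)" if "x \<in> A" for x using that by (simp add: h_def)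
  have hB: "h x = opair one (g x)" if "x \<in> B" for x using that disj by (simp add: h_def)
  have dh: "dfun h" unfolding h_def by (rule dfunI) (intro fo A fot_dfun[OF f(1)] fot_dfun[OF g(1)])
  have fP: "f x \<in> P" if "x \<in> A" for x using bij_betw_apply[OF f(2) that] .
  have gQ: "g x \<in> Q" if "x \<in> B" for x using bij_betw_apply[OF g(2) that] .
  have inj: "inj_on h (A \<union> B)"
  proof (rule inj_onI)
    fix x y assume xy: "x \<in> A \<union> B" "y \<in> A \<union> B" "h x = h y"
    then consider "x \<in> A" "y \<in> A" | "x \<in> B" "y \<in> B" | "x \<in> A" "y \<in> B" | "x \<in> B" "y \<in> A" by blast
    then show "x = y"
    proof cases
      case 1
      then have "f x = f y" using xy(3) hA by simp
      then show ?thesis using inj_onD[OF bij_betw_imp_inj_on[OF f(2)] _ 1] by blast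
    next
      case 2
      then have "g x = g y" using xy(3) hB by simp
      then show ?thesis using inj_onD[OF bij_betw_imp_inj_on[OF g(2)] _ 2] by blast
    next
      case 3
      then show ?thesis using xy(3) hA[of x] hB[of y] by simp
    next
      case 4
      then show ?thesis using xy(3) hA[of y] hB[of x] by simp
    qed
  qed
  have "h ` (A \<union> B) = {opair zero a | a. a \<in> P} \<union> {opair one b | b. b \<in> Q}"
  proof -
    have "h ` A = (opair zero) ` f ` A" using hA by (auto simp: image_image)
    moreover have "h ` B = (opair one) ` g ` B" using hB by (auto simp: image_image)
    ultimately show ?thesis using f(2) g(2) unfolding image_Un by (auto simp: bij_betw_def)
  qed
  then have "bij_betw h (A \<union> B) (fst (concat_ord (P, p) (Q, q)))"
    using inj by (simp add: bij_betw_def concat_ord_def)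
  then have "iso (A \<union> B, r) (fst (concat_ord (P, p) (Q, q)), snd (concat_ord (P, p) (Q, q)))"
  proof (rule isoI[OF dh small_union[OF A]])
    fix x y assume "x \<in> A \<union> B" "y \<in> A \<union> B"
    then consider "x \<in> A" "y \<in> A" | "x \<in> B" "y \<in> B" | "x \<in> A" "y \<in> B" | "x \<in> B" "y \<in> A" by blast
    then show "r x y \<longleftrightarrow> snd (concat_ord (P, p) (Q, q)) (h x) (h y)"
    proof cases
      case 1 then show ?thesis using f(3)[OF 1] hA by (simp add: concat_ord_def)
    next
      case 2 then show ?thesis using g(3)[OF 2] hB by (simp add: concat_ord_def)
    next
      case 3 then show ?thesis using AB[OF 3] hA hB by (simp add: concat_ord_def)
    next
      case 4 then show ?thesis using AB[OF 4(2,1)] hA hB by (simp add: concat_ord_def)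
    qed
  qed
  then show ?thesis by simp
qed

lemma concat_isoE:
  assumes T: "small T" and i: "iso (T, r) (concat_ord (P, p) (Q, q))"
  shows "\<exists>A B. small A \<and> small B \<and> T = A \<union> B \<and> (\<forall>a\<in>A. \<forall>b\<in>B. r a b) \<and> iso (A, r) (P, p) \<and> iso (B, r) (Q, q)"
proof -
  let ?C = "concat_ord (P, p) (Q, q)"
  have i': "iso (T, r) (fst ?C, snd ?C)" using i by simp
  obtain f where f: "dfun f" "bij_betw f T (fst ?C)" "\<And>x y. x \<in> T \<Longrightarrow> y \<in> T \<Longrightarrow> r x y \<longleftrightarrow> snd ?C (f x) (f y)"
    by (rule isoE[OF i']) (rule that; assumption)
  define S where "S t X = {x \<in> T. \<exists>a. f x = opair t a}" for t and X :: "'a set"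
  define un where "un t x = the0 (\<lambda>a. f x = opair t a)" for t x
  have smS: "small (S t X)" for t X unfolding S_def by (rule small_sub[OF T]) (auto intro!: fo T fot_dfun[OF f(1)])
  have du: "dfun (un t)" for t unfolding un_def by (rule dfunI) (intro fo fot_dfun[OF f(1)])
  have un: "f x = opair t (un t x)" if "x \<in> S t X" for t x X
  proof -
    obtain a where a: "f x = opair t a" using \<open>x \<in> S t X\<close> unfolding S_def by blast
    have "un t x = a" unfolding un_def by (rule the0_eq) (use a in auto)
    then show ?thesis using a by simp
  qed
  have C: "fst ?C = {opair zero a | a. a \<in> P} \<union> {opair one b | b. b \<in> Q}" by (simp add: concat_ord_def)
  have part: "iso (S t X, r) (X, k)" if X: "\<And>a. opair t a \<in> fst ?C \<longleftrightarrow> a \<in> X"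
     and k: "\<And>a b. snd ?C (opair t a) (opair t b) \<longleftrightarrow> k a b" for t X k
  proof (rule isoI[OF du[of t] smS])
    show "bij_betw (un t) (S t X) X"
    proof (rule bij_betwI')
      fix x y assume xy: "x \<in> S t X" "y \<in> S t X"
      then have "x \<in> T" "y \<in> T" by (auto simp: S_def)
      then show "un t x = un t y \<longleftrightarrow> x = y"
        using un[OF xy(1)] un[OF xy(2)] inj_onD[OF bij_betw_imp_inj_on[OF f(2)], of x y] by auto
    next
      fix x assume x: "x \<in> S t X"
      then have "f x \<in> fst ?C" using bij_betw_apply[OF f(2)] by (auto simp: S_def)
      then show "un t x \<in> X" using un[OF x] X by simp
    next
      fix a assume "a \<in> X"
      then have "opair t a \<in> f ` T" using X bij_betw_imp_surj_on[OF f(2)] by simp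
      then obtain x where x: "x \<in> T" "f x = opair t a" by force
      then have "x \<in> S t X" by (auto simp: S_def)
      moreover from this have "a = un t x" using un x(2) by auto
      ultimately show "\<exists>x\<in>S t X. a = un t x" by blast
    qed
    fix x y assume xy: "x \<in> S t X" "y \<in> S t X"
    then have "x \<in> T" "y \<in> T" by (auto simp: S_def)
    then show "r x y \<longleftrightarrow> k (un t x) (un t y)" using f(3)[of x y] un[OF xy(1)] un[OF xy(2)] k by simp
  qed
  have iP: "iso (S zero P, r) (P, p)" by (rule part) (auto simp: concat_ord_def)
  have iQ: "iso (S one Q, r) (Q, q)" by (rule part) (auto simp: concat_ord_def)
  have "T = S zero P \<union> S one Q"
    using bij_betw_apply[OF f(2)] unfolding C S_def by blast
  moreover have "r a b" if "a \<in> S zero P" "b \<in> S one Q" for a b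
    using f(3)[of a b] that un[OF that(1)] un[OF that(2)] by (auto simp: S_def concat_ord_def)
  ultimately show ?thesis using smS iP iQ by blast
qed

lemma iso_rev: "iso (A, \<lambda>x y. r y x) (B, \<lambda>x y. r' y x) \<longleftrightarrow> iso (A, r) (B, r')"
  unfolding iso_def fst_conv snd_conv by blast

lemma omega_like_of_iso:
  assumes "drel r" "small A" "iso (A, r) (Omega, (\<^bold>\<in>))" shows "omega_like r A" "\<not> fin A"
proof -
  obtain f where f: "dfun f" "bij_betw f A Omega" "\<And>x y. x \<in> A \<Longrightarrow> y \<in> A \<Longrightarrow> r x y \<longleftrightarrow> f x \<^bold>\<in> f y"
    by (rule isoE[OF assms(3)]) (rule that; assumption)
  show "\<not> fin A" using fin_image[OF _ f(1), of A] f(2) not_fin_Omega by (auto simp: bij_betw_def)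
  have "fin (below r A x)" if x: "x \<in> A" for x
  proof -
    have sml: "small (below r A x)" unfolding below_def by (rule small_sub[OF assms(2)]) (auto intro!: fo assms fo_drel[OF assms(1)])
    have "f ` below r A x \<subseteq> elts (f x)" using f(3)[OF _ x] unfolding below_def mem_iff by blast
    moreover have "fin (elts (f x))" using fin_Omega_elem bij_betw_apply[OF f(2) x] by blast
    ultimately have "fin (f ` below r A x)" using fin_sub small_image[OF f(1) sml] by blast
    then show ?thesis using fin_inj[OF inj_on_subset[OF bij_betw_imp_inj_on[OF f(2)]] sml f(1)]
      unfolding below_def by blast
  qed
  then show "omega_like r A" by (simp add: omega_like_def)
qed

lemma omega_plus_finite_decompose:
  assumes r: "drel r" and T: "linear (T, r)" "small T" and o: "omega_plus_finite r T"
  obtains A B where "T = A \<union> B" "small A" "small B" "fin B" "\<And>a b. a \<in> A \<Longrightarrow> b \<in> B \<Longrightarrow> r a b \<and> \<not> r b a"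
    "iso (A, r) (Omega, (\<^bold>\<in>))"
proof -
  let ?A = "{x \<in> T. fin (below r T x)}" and ?B = "{x \<in> T. \<not> fin (below r T x)}"
  have smA: "small ?A" unfolding below_def by (rule small_sub[OF T(2)]) (auto intro!: fo T fo_drel[OF r])
  have "r a b" if "a \<in> ?A" "b \<in> ?B" for a b using part_less[OF r T] that by blast
  then have less: "r a b \<and> \<not> r b a" if "a \<in> ?A" "b \<in> ?B" for a b
    using linear_trans[OF T(1), of a b a] linear_irrefl[OF T(1), of a] that by blast
  have "iso (?A, r) (Omega, (\<^bold>\<in>))"
    by (rule omega_like_iso(1)[OF r linear_sub[OF T(1)] smA part_wl[OF r T(2)]]) (use o in \<open>auto simp: omega_plus_finite_def\<close>)
  moreover have "fin ?B" using o by (simp add: omega_plus_finite_def)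
  moreover have "T = ?A \<union> ?B" by blast
  ultimately show ?thesis using that[of ?A ?B, OF _ smA fin_sm] less by blast
qed

lemma fin_iso:
  assumes r: "drel r" and B: "linear (B, r)" "fin B" shows "\<exists>k\<in>Omega. iso (B, r) (elts k, (\<^bold>\<in>))"
proof -
  have "omega_like r B" unfolding omega_like_def
  proof
    fix x
    show "fin (below r B x)"
      by (rule fin_subset[OF B(2)]) (auto simp: below_def intro!: fo fin_sm[OF B(2)] fo_drel[OF r])
  qed
  then show ?thesis using omega_like_iso(2)[OF r B(1) fin_sm[OF B(2)]] B(2) by blast
qed

text \<open>\<open>q\<close> is kept apart from \<open>r\<close> because the mirrored use supplies
  an isomorphism of \<open>B\<close> for the order opposite to \<open>r\<close>.\<close>

lemma omega_plus_finite_of_parts: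
  assumes r: "drel r" and T: "linear (A \<union> B, r)" "small A" "small B" and AB: "\<And>a b. a \<in> A \<Longrightarrow> b \<in> B \<Longrightarrow> r a b"
    and A: "iso (A, r) (Omega, (\<^bold>\<in>))" and B: "iso (B, q) (elts k, q')" "k \<in> Omega"
  shows "omega_plus_finite r (A \<union> B)"
proof -
  obtain f where f: "dfun f" "bij_betw f B (elts k)" by (rule isoE[OF B(1)]) (rule that; assumption)
  have "fin (f ` B)" using fin_Omega_elem[OF B(2)] f(2) by (simp add: bij_betw_def)
  then have "fin B" using fin_inj[OF bij_betw_imp_inj_on[OF f(2)] T(3) f(1)] by blast
  moreover note w = omega_like_of_iso[OF r T(2) A]
  ultimately show ?thesis unfolding omega_plus_finite_def using part_eq[OF r T AB w] w(2) by simp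
qed

text \<open>Reversal exchanges k + \<open>\<omega>\<^sup>*\<close> and \<omega> + k, the finite part
  being determined by its size, so one intrinsic notion and its mirror image cover both
  forms.\<close>

lemma exceptional_iff:
  assumes T: "small T" "linear (T, r)" "drel r"
  shows "exceptional (T, r) \<longleftrightarrow> omega_plus_finite r T \<or> omega_plus_finite (\<lambda>x y. r y x) T"
proof
  assume "exceptional (T, r)"
  then obtain k where k: "k \<in> Omega" "iso (T, r) (concat_ord (Omega, (\<^bold>\<in>)) (elts k, (\<^bold>\<in>))) \<or>
      iso (T, r) (concat_ord (elts k, (\<^bold>\<in>)) (Omega, \<lambda>x y. y \<^bold>\<in> x))"
    unfolding exceptional_def omega_def mem_ord_def rev_ord_def fst_conv snd_conv by blast
  from k(2) show "omega_plus_finite r T \<or> omega_plus_finite (\<lambda>x y. r y x) T"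
  proof
    assume "iso (T, r) (concat_ord (Omega, (\<^bold>\<in>)) (elts k, (\<^bold>\<in>)))"
    from concat_isoE[OF T(1) this]
    obtain A B where AB: "small A" "small B" "T = A \<union> B" "\<And>a b. a \<in> A \<Longrightarrow> b \<in> B \<Longrightarrow> r a b"
       "iso (A, r) (Omega, (\<^bold>\<in>))" "iso (B, r) (elts k, (\<^bold>\<in>))" by (elim exE conjE) simp
    have "omega_plus_finite r (A \<union> B)" by (rule omega_plus_finite_of_parts[OF T(3) _ AB(1,2,4,5,6) k(1)]) (use T AB in simp_all)
    then show ?thesis using AB(3) by simp
  next
    assume "iso (T, r) (concat_ord (elts k, (\<^bold>\<in>)) (Omega, \<lambda>x y. y \<^bold>\<in> x))"
    from concat_isoE[OF T(1) this]
    obtain A B where AB: "small A" "small B" "T = B \<union> A" "\<And>a b. a \<in> A \<Longrightarrow> b \<in> B \<Longrightarrow> r b a"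
       "iso (A, r) (Omega, \<lambda>x y. y \<^bold>\<in> x)" "iso (B, r) (elts k, (\<^bold>\<in>))" by (elim exE conjE) simp
    have iA: "iso (A, \<lambda>x y. r y x) (Omega, (\<^bold>\<in>))" using AB(5) iso_rev[of A r Omega "\<lambda>x y. y \<^bold>\<in> x"] by simp
    have T': "T = A \<union> B" using AB(3) by blast
    have "omega_plus_finite (\<lambda>x y. r y x) (A \<union> B)"
      by (rule omega_plus_finite_of_parts[OF drel_rev[OF T(3)] _ AB(1,2) AB(4) iA AB(6) k(1)]) (use linear_rev[OF T(2)] T' in simp_all)
    then show ?thesis using T' by simp
  qed
next
  assume "omega_plus_finite r T \<or> omega_plus_finite (\<lambda>x y. r y x) T"
  then show "exceptional (T, r)"
  proof
    assume o: "omega_plus_finite r T"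
    obtain A B where AB: "T = A \<union> B" "small A" "small B" "fin B" "\<And>a b. a \<in> A \<Longrightarrow> b \<in> B \<Longrightarrow> r a b \<and> \<not> r b a"
      "iso (A, r) (Omega, (\<^bold>\<in>))" by (rule omega_plus_finite_decompose[OF T(3,2,1) o]) (rule that; assumption)
    obtain k where k: "k \<in> Omega" "iso (B, r) (elts k, (\<^bold>\<in>))"
      using fin_iso[OF T(3) linear_sub[OF T(2)] AB(4)] AB(1) by blast
    have "iso (A \<union> B, r) (concat_ord (Omega, (\<^bold>\<in>)) (elts k, (\<^bold>\<in>)))" by (rule concat_isoI[OF AB(2,3,5,6) k(2)])
    then show ?thesis using k(1) AB(1) unfolding exceptional_def omega_def mem_ord_def by blast
  next
    assume o: "omega_plus_finite (\<lambda>x y. r y x) T"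
    obtain A B where AB: "T = A \<union> B" "small A" "small B" "fin B" "\<And>a b. a \<in> A \<Longrightarrow> b \<in> B \<Longrightarrow> r b a \<and> \<not> r a b"
      "iso (A, \<lambda>x y. r y x) (Omega, (\<^bold>\<in>))"
      by (rule omega_plus_finite_decompose[OF drel_rev[OF T(3)] linear_rev[OF T(2)] T(1) o]) (rule that; assumption)
    obtain k where k: "k \<in> Omega" "iso (B, r) (elts k, (\<^bold>\<in>))"
      using fin_iso[OF T(3) linear_sub[OF T(2)] AB(4)] AB(1) by blast
    have iA: "iso (A, r) (Omega, \<lambda>x y. y \<^bold>\<in> x)" using AB(6) iso_rev[of A r Omega "\<lambda>x y. y \<^bold>\<in> x"] by simp
    have "iso (B \<union> A, r) (concat_ord (elts k, (\<^bold>\<in>)) (Omega, \<lambda>x y. y \<^bold>\<in> x))"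
      by (rule concat_isoI[OF AB(3,2) _ k(2) iA]) (rule AB(5))
    moreover have "T = B \<union> A" using AB(1) by blast
    ultimately show ?thesis using k(1) unfolding exceptional_def omega_def mem_ord_def rev_ord_def fst_conv snd_conv by blast
  qed
qed

subsection \<open>The lexicographic order\<close>

text \<open>The parameters \<open>c'\<close>, \<open>c\<close> are the two values \<open>0\<close>, \<open>1\<close>, \<open>c'\<close> counting as the smaller one, so
  that exchanging them reverses the order.\<close>

definition lex_less :: "'v::zf \<Rightarrow> 'v \<Rightarrow> 'v \<Rightarrow> 'v \<Rightarrow> 'v \<Rightarrow> bool" where
  "lex_less \<alpha> c' c x y \<longleftrightarrow> (\<exists>\<delta>\<in>elts \<alpha>. ap x \<delta> = c' \<and> ap y \<delta> = c \<and> (\<forall>\<gamma>\<in>elts \<delta>. ap x \<gamma> = ap y \<gamma>))"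

definition lex_split :: "'v::zf \<Rightarrow> 'v \<Rightarrow> 'v \<Rightarrow> 'v" where
  "lex_split \<alpha> x y = the0 (\<lambda>\<delta>. \<delta> \<in> elts \<alpha> \<and> ap x \<delta> \<noteq> ap y \<delta> \<and> (\<forall>\<gamma>\<in>elts \<delta>. ap x \<gamma> = ap y \<gamma>))"

definition cube :: "'v::zf \<Rightarrow> 'v set" where "cube \<alpha> = {x. maps x (elts \<alpha>) {zero, one}}"

context
  fixes \<alpha> c' c :: "'v::zf"
  assumes ord: "ordinal \<alpha>" and cc: "(c' = zero \<and> c = one) \<or> (c' = one \<and> c = zero)"
begin

lemma ord_sub: "\<delta> \<in> elts \<alpha> \<Longrightarrow> \<gamma> \<in> elts \<delta> \<Longrightarrow> \<gamma> \<in> elts \<alpha>"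
  using ord unfolding ordinal_def by blast

lemma ord_linear: "linear (elts \<alpha>, (\<^bold>\<in>))"
  using ord unfolding ordinal_def mem_ord_def by blast

lemma ord_trans: "\<gamma> \<in> elts \<delta> \<Longrightarrow> \<delta> \<in> elts \<epsilon> \<Longrightarrow> \<epsilon> \<in> elts \<alpha> \<Longrightarrow> \<gamma> \<in> elts \<epsilon>"
  using linear_trans[OF ord_linear, of \<gamma> \<delta> \<epsilon>] ord_sub by (metis mem_iff)

lemma ord_total: "\<gamma> \<in> elts \<alpha> \<Longrightarrow> \<delta> \<in> elts \<alpha> \<Longrightarrow> \<gamma> = \<delta> \<or> \<gamma> \<in> elts \<delta> \<or> \<delta> \<in> elts \<gamma>"
  using linear_total[OF ord_linear, of \<gamma> \<delta>] by (simp add: mem_iff)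

text \<open>\<open>ordinal\<close> speaks of least members of elements of the model only, so the
  class \<open>A\<close> first has to become a set by separation.\<close>

lemma ord_least:
  assumes "A \<subseteq> elts \<alpha>" "A \<noteq> {}" "fo (\<lambda>s. s 0 \<in> A)" shows "\<exists>m\<in>A. \<forall>x\<in>A. x = m \<or> m \<in> elts x"
proof -
  have "small A" by (rule small_sub[OF small_elts assms(3,1)])
  then obtain X where X: "elts X = A" by (auto simp: small_def)
  then have "\<exists>m\<in>elts X. \<forall>x\<in>elts X. x \<noteq> m \<longrightarrow> m \<^bold>\<in> x" using ord assms unfolding ordinal_def by blast
  then show ?thesis unfolding X mem_iff by blast
qed

lemma cube_val: "x \<in> cube \<alpha> \<Longrightarrow> \<delta> \<in> elts \<alpha> \<Longrightarrow> ap x \<delta> = c' \<or> ap x \<delta> = c"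
  using maps_ap(3)[of x "elts \<alpha>" "{zero, one}" \<delta>] cc unfolding cube_def by auto

lemma lex_split_spec:
  assumes "x \<in> cube \<alpha>" "y \<in> cube \<alpha>" "x \<noteq> y"
  shows "lex_split \<alpha> x y \<in> elts \<alpha>" "ap x (lex_split \<alpha> x y) \<noteq> ap y (lex_split \<alpha> x y)"
    "\<And>\<gamma>. \<gamma> \<in> elts (lex_split \<alpha> x y) \<Longrightarrow> ap x \<gamma> = ap y \<gamma>"
proof -
  let ?D = "{\<delta> \<in> elts \<alpha>. ap x \<delta> \<noteq> ap y \<delta>}"
  have "?D \<noteq> {}" using maps_ext[of x "elts \<alpha>" _ y] assms unfolding cube_def by blast
  moreover have "fo (\<lambda>s. s 0 \<in> ?D)" by (intro fo)
  ultimately obtain m where m: "m \<in> ?D" "\<And>\<delta>. \<delta> \<in> ?D \<Longrightarrow> \<delta> = m \<or> m \<in> elts \<delta>" using ord_least[of ?D] by blast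
  have below: "ap x \<gamma> = ap y \<gamma>" if "\<gamma> \<in> elts m" for \<gamma>
  proof (rule ccontr)
    assume "ap x \<gamma> \<noteq> ap y \<gamma>"
    then have "\<gamma> = m \<or> m \<in> elts \<gamma>" using m(2)[of \<gamma>] ord_sub[OF _ that] m(1) by blast
    then show False using that ord_trans[of m \<gamma> m] m(1) by auto
  qed
  have "lex_split \<alpha> x y = m" unfolding lex_split_def
  proof (rule the0_eq)
    fix \<delta> assume d: "\<delta> \<in> elts \<alpha> \<and> ap x \<delta> \<noteq> ap y \<delta> \<and> (\<forall>\<gamma>\<in>elts \<delta>. ap x \<gamma> = ap y \<gamma>)"
    then have "\<delta> = m \<or> m \<in> elts \<delta>" using m(2)[of \<delta>] by blast
    then show "\<delta> = m" using d m(1) by blast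
  qed (use m below in blast)
  then show "lex_split \<alpha> x y \<in> elts \<alpha>" "ap x (lex_split \<alpha> x y) \<noteq> ap y (lex_split \<alpha> x y)"
    "\<And>\<gamma>. \<gamma> \<in> elts (lex_split \<alpha> x y) \<Longrightarrow> ap x \<gamma> = ap y \<gamma>" using m(1) below by blast+
qed

lemma lex_split_eq:
  assumes "\<delta> \<in> elts \<alpha>" "ap x \<delta> \<noteq> ap y \<delta>" "\<And>\<gamma>. \<gamma> \<in> elts \<delta> \<Longrightarrow> ap x \<gamma> = ap y \<gamma>"
  shows "lex_split \<alpha> x y = \<delta>"
  unfolding lex_split_def
proof (rule the0_eq)
  fix \<epsilon> assume e: "\<epsilon> \<in> elts \<alpha> \<and> ap x \<epsilon> \<noteq> ap y \<epsilon> \<and> (\<forall>\<gamma>\<in>elts \<epsilon>. ap x \<gamma> = ap y \<gamma>)"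
  then show "\<epsilon> = \<delta>" using ord_total[of \<epsilon> \<delta>] assms by blast
qed (use assms in blast)

lemma lex_less_D: "lex_less \<alpha> c' c x y \<Longrightarrow> lex_split \<alpha> x y \<in> elts \<alpha> \<and> ap x (lex_split \<alpha> x y) = c' \<and> ap y (lex_split \<alpha> x y) = c \<and>
    (\<forall>\<gamma>\<in>elts (lex_split \<alpha> x y). ap x \<gamma> = ap y \<gamma>)"
proof -
  assume "lex_less \<alpha> c' c x y"
  then obtain \<delta> where d: "\<delta> \<in> elts \<alpha>" "ap x \<delta> = c'" "ap y \<delta> = c" "\<And>\<gamma>. \<gamma> \<in> elts \<delta> \<Longrightarrow> ap x \<gamma> = ap y \<gamma>"
    unfolding lex_less_def by blast
  then have "lex_split \<alpha> x y = \<delta>" using lex_split_eq[of \<delta> x y] cc by auto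
  then show ?thesis using d by simp
qed

text \<open>At a common splitting level \<open>y\<close> would have the value \<open>c\<close>,
  being above \<open>x\<close>, and the value \<open>c'\<close>, being below \<open>z\<close>. So
  the levels differ, and the smaller one decides between \<open>x\<close> and
  \<open>z\<close>.\<close>

lemma lex_less_tri:
  assumes xy: "lex_less \<alpha> c' c x y" and yz: "lex_less \<alpha> c' c y z"
  shows "lex_less \<alpha> c' c x z \<and> ((lex_split \<alpha> x y \<in> elts (lex_split \<alpha> y z) \<and> lex_split \<alpha> x z = lex_split \<alpha> x y) \<or>
     (lex_split \<alpha> y z \<in> elts (lex_split \<alpha> x y) \<and> lex_split \<alpha> x z = lex_split \<alpha> y z))"
proof -
  let ?d = "lex_split \<alpha> x y" and ?e = "lex_split \<alpha> y z"
  have d: "?d \<in> elts \<alpha>" "ap x ?d = c'" "ap y ?d = c" "\<And>\<gamma>. \<gamma> \<in> elts ?d \<Longrightarrow> ap x \<gamma> = ap y \<gamma>" using lex_less_D[OF xy] by blast+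
  have e: "?e \<in> elts \<alpha>" "ap y ?e = c'" "ap z ?e = c" "\<And>\<gamma>. \<gamma> \<in> elts ?e \<Longrightarrow> ap y \<gamma> = ap z \<gamma>" using lex_less_D[OF yz] by blast+
  have ne: "c' \<noteq> c" using cc by auto
  then have "?d \<noteq> ?e" using d e by metis
  then consider "?d \<in> elts ?e" | "?e \<in> elts ?d" using ord_total d e by blast
  then show ?thesis
  proof cases
    case 1
    have z: "ap z ?d = c" using e(4)[OF 1] d(3) by simp
    have below: "ap x \<gamma> = ap z \<gamma>" if "\<gamma> \<in> elts ?d" for \<gamma>
      using d(4)[OF that] e(4)[OF ord_trans[OF that 1 e(1)]] by simp
    have "lex_split \<alpha> x z = ?d" by (rule lex_split_eq[OF d(1) _ below]) (use z d ne in auto)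
    moreover have "lex_less \<alpha> c' c x z" unfolding lex_less_def using d(1,2) z below by blast
    ultimately show ?thesis using 1 by blast
  next
    case 2
    have x: "ap x ?e = c'" using d(4)[OF 2] e(2) by simp
    have below: "ap x \<gamma> = ap z \<gamma>" if "\<gamma> \<in> elts ?e" for \<gamma>
      using e(4)[OF that] d(4)[OF ord_trans[OF that 2 d(1)]] by simp
    have "lex_split \<alpha> x z = ?e" by (rule lex_split_eq[OF e(1) _ below]) (use x e ne in auto)
    moreover have "lex_less \<alpha> c' c x z" unfolding lex_less_def using e(1,3) x below by blast
    ultimately show ?thesis using 2 by blast
  qed
qed

lemma small_cube: "small (cube \<alpha>)"
proof -
  have p: "{opair a b | a b. a \<in> elts \<alpha> \<and> b \<in> {zero, one}} = (\<lambda>a. opair a zero) ` elts \<alpha> \<union> (\<lambda>a. opair a one) ` elts \<alpha>" by auto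
  have smP: "small {opair a b | a b. a \<in> elts \<alpha> \<and> b \<in> {zero, one}}" unfolding p
    by (intro small_union small_image small_elts dfunI fo)
  show ?thesis
  proof (rule small_sub[OF small_Pow[OF smP]])
    show "fo (\<lambda>s. s 0 \<in> cube \<alpha>)" unfolding cube_def maps_def by (intro fo smP)
    show "cube \<alpha> \<subseteq> {z. elts z \<subseteq> {opair a b | a b. a \<in> elts \<alpha> \<and> b \<in> {zero, one}}}"
      unfolding cube_def maps_def by blast
  qed
qed

lemma lex_less_linear: "linear (cube \<alpha>, lex_less \<alpha> c' c)"
proof (rule linearI)
  show "\<not> lex_less \<alpha> c' c x x" for x using cc unfolding lex_less_def by auto
  show "lex_less \<alpha> c' c x z" if "lex_less \<alpha> c' c x y" "lex_less \<alpha> c' c y z" for x y z using lex_less_tri[OF that] by blast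
  fix x y assume xy: "x \<in> cube \<alpha>" "y \<in> cube \<alpha>" "x \<noteq> y"
  note d = lex_split_spec[OF xy]
  have "(ap x (lex_split \<alpha> x y) = c' \<and> ap y (lex_split \<alpha> x y) = c) \<or> (ap y (lex_split \<alpha> x y) = c' \<and> ap x (lex_split \<alpha> x y) = c)"
    using cube_val[OF xy(1) d(1)] cube_val[OF xy(2) d(1)] d(2) by auto
  then show "lex_less \<alpha> c' c x y \<or> lex_less \<alpha> c' c y x" unfolding lex_less_def using d(1,3) by metis
qed

lemma lex_less_drel: "drel (lex_less \<alpha> c' c)"
  unfolding drel_def lex_less_def by (intro fo)

lemma lex_tree:
  assumes g: "bijection g (elts \<alpha>) Omega"
  shows "tree (cube \<alpha>) (lex_less \<alpha> c' c) (elts \<alpha>) (lex_split \<alpha>) (ap g) ap"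
proof
  show "small (cube \<alpha>)" by (rule small_cube)
  show "drel (lex_less \<alpha> c' c)" by (rule lex_less_drel)
  show "linear (cube \<alpha>, lex_less \<alpha> c' c)" by (rule lex_less_linear)
  show "fo (\<lambda>s. s 0 = lex_split \<alpha> (s (Suc 0)) (s (Suc (Suc 0))))" unfolding lex_split_def by (intro fo)
  show "lex_split \<alpha> x y \<in> elts \<alpha>" if "x \<in> cube \<alpha>" "y \<in> cube \<alpha>" "x \<noteq> y" for x y using lex_split_spec[OF that] by blast
  show "lex_split \<alpha> x y = lex_split \<alpha> y x" for x y
  proof -
    have "(\<lambda>\<delta>. \<delta> \<in> elts \<alpha> \<and> ap x \<delta> \<noteq> ap y \<delta> \<and> (\<forall>\<gamma>\<in>elts \<delta>. ap x \<gamma> = ap y \<gamma>)) =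
      (\<lambda>\<delta>. \<delta> \<in> elts \<alpha> \<and> ap y \<delta> \<noteq> ap x \<delta> \<and> (\<forall>\<gamma>\<in>elts \<delta>. ap y \<gamma> = ap x \<gamma>))" by (rule ext) metis
    then show ?thesis unfolding lex_split_def by simp
  qed
  show "small (elts \<alpha>)" by simp
  show "linear (elts \<alpha>, (\<^bold>\<in>))" by (rule ord_linear)
  show "\<exists>m\<in>A. \<forall>x\<in>A. x = m \<or> m \<in> elts x" if "A \<subseteq> elts \<alpha>" "A \<noteq> {}" "fo (\<lambda>s. s 0 \<in> A)" for A
    by (rule ord_least[OF that])
  show "dfun (ap g)" by (rule dfun_ap)
  show "bij_betw (ap g) (elts \<alpha>) Omega" using bijE(1)[OF g] .
  show "fo (\<lambda>s. s 0 = ap (s (Suc 0)) (s (Suc (Suc 0))))" by (intro fo)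
  show "ap x d = zero \<or> ap x d = one" if "x \<in> cube \<alpha>" "d \<in> elts \<alpha>" for x d
    using maps_ap(3)[of x "elts \<alpha>" "{zero, one}" d] that unfolding cube_def by auto
  show "ap x (lex_split \<alpha> x y) \<noteq> ap y (lex_split \<alpha> x y)" if "x \<in> cube \<alpha>" "y \<in> cube \<alpha>" "x \<noteq> y" for x y
    using lex_split_spec[OF that] by blast
  show "(lex_split \<alpha> x y \<in> elts (lex_split \<alpha> y z) \<and> lex_split \<alpha> x z = lex_split \<alpha> x y) \<or>
     (lex_split \<alpha> y z \<in> elts (lex_split \<alpha> x y) \<and> lex_split \<alpha> x z = lex_split \<alpha> y z)"
    if "lex_less \<alpha> c' c x y" "lex_less \<alpha> c' c y z" for x y z using lex_less_tri[OF that] by blast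
qed

text \<open>The least element of \<alpha> above \<open>n\<close> is the successor of
  \<open>n\<close>, and there is such an element because \<alpha> is infinite. This makes the finite
  levels available to \<open>lex_embedding\<close>.\<close>

lemma Omega_sub:
  assumes g: "bijection g (elts \<alpha>) Omega" and n: "n \<in> Omega" shows "n \<in> elts \<alpha>"
proof -
  have inf: "\<not> fin (elts \<alpha>)"
    using fin_image[OF _ dfun_ap[of g], of "elts \<alpha>"] bijE(1)[OF g] not_fin_Omega by (auto simp: bij_betw_def)
  show ?thesis using n
  proof (induction n rule: Omega_induct)
    case definable show ?case by (intro fo)
  next
    case zero
    have "elts \<alpha> \<noteq> {}" using inf by auto
    then obtain m where m: "m \<in> elts \<alpha>" "\<And>x. x \<in> elts \<alpha> \<Longrightarrow> x = m \<or> m \<in> elts x"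
      using ord_least[of "elts \<alpha>"] fo_elts[OF fot_var fot_const] by blast
    have "x \<notin> elts m" for x
    proof
      assume x: "x \<in> elts m"
      then have "x = m \<or> m \<in> elts x" using m ord_sub by blast
      then show False using x ord_trans[of m x m] m(1) by auto
    qed
    then have "elts m = elts zero" by auto
    then show ?case using m(1) unfolding elts_inject by simp
  next
    case (succ n)
    let ?A = "{x \<in> elts \<alpha>. n \<in> elts x}"
    show ?case
    proof (cases "?A = {}")
      case True
      have "elts \<alpha> \<subseteq> insert n (elts n)" using ord_total succ(2) True by blast
      then have "fin (elts \<alpha>)" using fin_sub[OF fin_insert[OF fin_Omega_elem[OF succ(1)]] _ small_elts] by blast
      then show ?thesis using inf by blast
    next
      case False
      moreover have "fo (\<lambda>s. s 0 \<in> ?A)" by (intro fo)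
      ultimately obtain m where m: "m \<in> ?A" "\<And>x. x \<in> ?A \<Longrightarrow> x = m \<or> m \<in> elts x" using ord_least[of ?A] by blast
      have "elts m = insert n (elts n)"
      proof
        show "insert n (elts n) \<subseteq> elts m" using m(1) ord_trans[of _ n m] by blast
        show "elts m \<subseteq> insert n (elts n)"
        proof
          fix x assume x: "x \<in> elts m"
          then have xa: "x \<in> elts \<alpha>" using ord_sub m(1) by blast
          have "n \<notin> elts x"
          proof
            assume "n \<in> elts x"
            then have "x = m \<or> m \<in> elts x" using m(2) xa by blast
            then show False using x ord_trans[of m x m] m(1) by auto
          qed
          then show "x \<in> insert n (elts n)" using ord_total[OF xa succ(2)] by blast
        qed
      qed
      then have "m = ins n n" using elts_inject[of m "ins n n"] by simp
      then show ?thesis using m(1) by simp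
    qed
  qed
qed

text \<open>\<open>arrows_of_omega\<close> starts from a copy of the type in the cube, and this one
  can be written down.\<close>

lemma lex_embedding:
  assumes g: "bijection g (elts \<alpha>) Omega" and T: "small T" "linear (T, r)" "drel r" "omega_plus_finite r T"
  shows "\<exists>H. elts H \<subseteq> cube \<alpha> \<and> iso (elts H, lex_less \<alpha> c' c) (T, r)"
proof -
  note Oa = Omega_sub[OF g]
  \<comment> \<open>Level 0 carries \<open>i\<close> and separates the initial part from the tail.
    On the levels 1 to \<open>n\<close> the value is \<open>c\<close>, which counts as the larger
    one, and afterwards \<open>c'\<close>. Points with the same \<open>i\<close> first differ at the
    successor of the smaller number, so they are ordered like their numbers.\<close>
  define val where "val i n d = (if d = zero then i else if d \<in> elts (succ n) then c else c')" for i n d :: 'v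
  define pt where "pt i n = st {z. \<exists>d\<in>elts \<alpha>. z = opair d (val i n d)}" for i n
  have dval: "dfun (\<lambda>d. opair d (val i n d))" for i n unfolding val_def by (rule dfunI) (intro fo)
  have "{z. \<exists>d\<in>elts \<alpha>. z = opair d (val i n d)} = (\<lambda>d. opair d (val i n d)) ` elts \<alpha>" for i n by blast
  then have "small {z. \<exists>d\<in>elts \<alpha>. z = opair d (val i n d)}" for i n using small_image[OF dval small_elts] by metis
  then have pt: "elts (pt i n) = {z. \<exists>d\<in>elts \<alpha>. z = opair d (val i n d)}" for i n unfolding pt_def by (rule elts_st)
  have pmaps: "maps (pt i n) (elts \<alpha>) {zero, one}" if "i = c \<or> i = c'" for i n
    using that cc unfolding maps_def mem_iff pt val_def by auto
  have pcube: "pt i n \<in> cube \<alpha>" if "i = c \<or> i = c'" for i n using pmaps[OF that] unfolding cube_def by blast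
  have pval: "ap (pt i n) d = val i n d" if "i = c \<or> i = c'" "d \<in> elts \<alpha>" for i n d
    using maps_opair[OF pmaps[OF that(1), of n], of d "val i n d"] that(2) unfolding pt by auto
  have fpt: "fot t \<Longrightarrow> fot (\<lambda>s. pt i (t s))" for t i
    by (rule fot1[of "pt i"]) (unfold pt_def val_def, intro fo)
  have less1: "lex_less \<alpha> c' c (pt i n) (pt i m)" if i: "i = c \<or> i = c'" and nm: "m \<in> Omega" "n \<in> elts m" for i n m
  proof -
    have n: "n \<in> Omega" using Omega_mem nm by blast
    have sa: "succ n \<in> elts \<alpha>" using Oa succ_Omega n by blast
    have sz: "succ n \<noteq> zero" using elts_inject[of "succ n" zero] by auto
    have ss: "succ n \<in> elts (succ m)" using succ_mono[OF nm(1)] nm(2) by auto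
    have "ap (pt i n) (succ n) = c'" "ap (pt i m) (succ n) = c"
      unfolding pval[OF i sa] val_def using sz ss not_mem_self[of "succ n"] by auto
    moreover have "ap (pt i n) \<gamma> = ap (pt i m) \<gamma>" if y: "\<gamma> \<in> elts (succ n)" for \<gamma>
    proof -
      have "\<gamma> \<in> elts \<alpha>" using ord_sub[OF sa y] .
      moreover have "\<gamma> \<in> elts (succ m)" using y nm(2) Omega_less_trans[OF nm] by auto
      ultimately show ?thesis using y unfolding val_def pval[OF i \<open>\<gamma> \<in> elts \<alpha>\<close>] by simp
    qed
    ultimately show ?thesis unfolding lex_less_def using sa by blast
  qed
  have less2: "lex_less \<alpha> c' c (pt c' n) (pt c m)" for n m
  proof -
    have "zero \<in> elts \<alpha>" using Oa zero_Omega by blast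
    then show ?thesis unfolding lex_less_def using pval[of c' zero n] pval[of c zero m] by (auto simp: val_def)
  qed
  obtain A B where AB: "T = A \<union> B" "small A" "small B" "fin B" "\<And>a b. a \<in> A \<Longrightarrow> b \<in> B \<Longrightarrow> r a b \<and> \<not> r b a"
    "iso (A, r) (Omega, (\<^bold>\<in>))" by (rule omega_plus_finite_decompose[OF T(3,2,1,4)]) (rule that; assumption)
  obtain f where f: "dfun f" "bij_betw f A Omega" "\<And>x y. x \<in> A \<Longrightarrow> y \<in> A \<Longrightarrow> r x y \<longleftrightarrow> f x \<^bold>\<in> f y"
    by (rule isoE[OF AB(6)]) (rule that; assumption)
  have linB: "linear (B, r)" using linear_sub[OF T(2)] AB(1) by blast
  obtain k where k: "k \<in> Omega" "iso (B, r) (elts k, (\<^bold>\<in>))" using fin_iso[OF T(3) linB AB(4)] by blast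
  obtain h where h: "dfun h" "bij_betw h B (elts k)" "\<And>x y. x \<in> B \<Longrightarrow> y \<in> B \<Longrightarrow> r x y \<longleftrightarrow> h x \<^bold>\<in> h y"
    by (rule isoE[OF k(2)]) (rule that; assumption)
  have fO: "f x \<in> Omega" if "x \<in> A" for x using bij_betw_apply[OF f(2) that] .
  have hO: "h x \<in> Omega" if "x \<in> B" for x using bij_betw_apply[OF h(2) that] Omega_mem[OF k(1)] by blast
  define e where "e x = (if x \<in> A then pt c' (f x) else pt c (h x))" for x
  have disj: "x \<notin> A" if "x \<in> B" for x using AB(5)[of x x] that by blast
  have eA: "e x = pt c' (f x)" if "x \<in> A" for x using that by (simp add: e_def)
  have eB: "e x = pt c (h x)" if "x \<in> B" for x using that disj by (simp add: e_def)
  have de: "dfun e" unfolding e_def by (rule dfunI) (intro fo AB fpt fot_dfun[OF f(1)] fot_dfun[OF h(1)])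
  have mono: "lex_less \<alpha> c' c (e x) (e y)" if xy: "x \<in> T" "y \<in> T" "r x y" for x y
  proof -
    consider "x \<in> A" "y \<in> A" | "x \<in> B" "y \<in> B" | "x \<in> A" "y \<in> B" | "x \<in> B" "y \<in> A" using xy AB(1) by blast
    then show ?thesis
    proof cases
      case 1
      then show ?thesis using less1[of c' "f y" "f x"] fO f(3)[OF 1] xy(3) eA by (simp add: mem_iff)
    next
      case 2
      then show ?thesis using less1[of c "h y" "h x"] hO h(3)[OF 2] xy(3) eB by (simp add: mem_iff)
    next
      case 3 then show ?thesis using less2 eA eB by simp
    next
      case 4 then show ?thesis using AB(5)[OF 4(2,1)] xy(3) by blast
    qed
  qed
  have ecube: "e x \<in> cube \<alpha>" if "x \<in> T" for x using that AB(1) eA eB pcube by auto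
  have eiff: "r x y \<longleftrightarrow> lex_less \<alpha> c' c (e x) (e y)" if xy: "x \<in> T" "y \<in> T" for x y
  proof
    assume l: "lex_less \<alpha> c' c (e x) (e y)"
    note ex = ecube[OF xy(1)] and ey = ecube[OF xy(2)]
    have "x \<noteq> y" using l linear_irrefl[OF lex_less_linear ex] by blast
    moreover have "\<not> r y x" using mono[OF xy(2,1)] linear_trans[OF lex_less_linear l, of "e x"] linear_irrefl[OF lex_less_linear ex] ex ey by blast
    ultimately show "r x y" using linear_total[OF T(2) xy] by blast
  qed (rule mono[OF xy])
  have inj: "inj_on e T"
  proof (rule inj_onI)
    fix x y assume xy: "x \<in> T" "y \<in> T" "e x = e y"
    have "\<not> lex_less \<alpha> c' c (e x) (e y)" "\<not> lex_less \<alpha> c' c (e y) (e x)" using xy(3) linear_irrefl[OF lex_less_linear ecube[OF xy(1)]] by simp_all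
    then show "x = y" using linear_total[OF T(2) xy(1,2)] eiff xy(1,2) by blast
  qed
  have smE: "small (e ` T)" by (rule small_image[OF de T(1)])
  define H where "H = st (e ` T)"
  have H: "elts H = e ` T" unfolding H_def by (rule elts_st[OF smE])
  have "iso (T, r) (elts H, lex_less \<alpha> c' c)" unfolding H
    by (rule isoI[OF de T(1)]) (simp add: bij_betw_def inj, rule eiff)
  then have "iso (elts H, lex_less \<alpha> c' c) (T, r)" by (rule iso_sym) (rule T(1))
  moreover have "elts H \<subseteq> cube \<alpha>" unfolding H by (rule image_subsetI) (rule ecube)
  ultimately show ?thesis by blast
qed

end

section \<open>The two orientations of the lexicographic order\<close>

lemma lex_less_flip: "lex_less \<alpha> one zero = (\<lambda>x y. lex_less \<alpha> zero one y x)"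
  unfolding lex_less_def by (intro ext) metis

lemma lex_eq:
  assumes "x \<in> cube \<alpha>" "y \<in> cube \<alpha>" "ordinal \<alpha>"
  shows "snd (lex_ord \<alpha>) x y \<longleftrightarrow> lex_less \<alpha> zero one x y"
proof -
  have a: "app x \<delta> = ap x \<delta>" "app y \<delta> = ap y \<delta>" "ap x \<delta> \<in> {zero, one}" "ap y \<delta> \<in> {zero, one}" if "\<delta> \<in> elts \<alpha>" for \<delta>
    using maps_ap[of x "elts \<alpha>" "{zero, one}" \<delta>] maps_ap[of y "elts \<alpha>" "{zero, one}" \<delta>] assms that unfolding cube_def by auto
  have b: "\<gamma> \<in> elts \<alpha>" if "\<delta> \<in> elts \<alpha>" "\<gamma> \<in> elts \<delta>" for \<gamma> \<delta> using that assms(3) unfolding ordinal_def by blast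
  have "app x \<delta> \<^bold>\<in> app y \<delta> \<longleftrightarrow> ap x \<delta> = zero \<and> ap y \<delta> = one" if "\<delta> \<in> elts \<alpha>" for \<delta>
    using a[OF that] by (auto simp: mem_iff)
  then show ?thesis unfolding lex_ord_def lex_less_def snd_conv using a b by auto
qed

lemma arrows_cong:
  assumes "\<And>H. elts H \<subseteq> L \<Longrightarrow> iso (elts H, r) S \<longleftrightarrow> iso (elts H, r') S'"
  shows "arrows (L, r) S S \<longleftrightarrow> arrows (L, r') S' S'"
proof -
  have "subsets_of_type (A, r) S = subsets_of_type (A, r') S'" if "A \<subseteq> L" for A
    unfolding subsets_of_type_def fst_conv snd_conv using assms that by auto
  moreover from this have "elts H \<subseteq> L" if "H \<in> subsets_of_type (L, r') S'" for H
    using that by (auto simp: subsets_of_type_def)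
  ultimately show ?thesis unfolding arrows_def by simp
qed

theorem theorem3:
  fixes \<alpha> T R :: "'v::zf"
  assumes "ordinal \<alpha>" and "countably_infinite \<alpha>"
    and "linear (set_ord T R)" and "countably_infinite T"
  shows "(\<not> exceptional (set_ord T R) \<longrightarrow>
            \<not> arrows (lex_ord \<alpha>) (set_ord T R) (set_ord T R)) \<and>
         (exceptional (set_ord T R) \<longrightarrow>
            (arrows (lex_ord \<alpha>) (set_ord T R) (set_ord T R) \<longleftrightarrow>
             arrows (omega :: 'v ord) omega omega))"
proof -
  define r where "r x y \<longleftrightarrow> opair x y \<^bold>\<in> R" for x y
  have so: "set_ord T R = (elts T, r)" unfolding set_ord_def r_def by simp
  have dr: "drel r" unfolding drel_def r_def by (intro fo)
  have lin: "linear (elts T, r)" using assms(3) unfolding so .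
  obtain g where g: "bijection g (elts \<alpha>) Omega" using assms(2) unfolding countably_infinite_def by blast
  obtain h where h: "bijection h (elts T) Omega" using assms(4) unfolding countably_infinite_def by blast
  note T = small_elts[of T] lin dr and Tr = small_elts[of T] linear_rev[OF lin] drel_rev[OF dr]
  have lex: "arrows (lex_ord \<alpha>) (elts T, r) (elts T, r) \<longleftrightarrow> arrows (cube \<alpha>, lex_less \<alpha> zero one) (elts T, r) (elts T, r)"
  proof -
    have "lex_ord \<alpha> = (cube \<alpha>, snd (lex_ord \<alpha>))" unfolding lex_ord_def cube_def by simp
    moreover have "arrows (cube \<alpha>, snd (lex_ord \<alpha>)) (elts T, r) (elts T, r) \<longleftrightarrow>
        arrows (cube \<alpha>, lex_less \<alpha> zero one) (elts T, r) (elts T, r)"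
    proof (rule arrows_cong)
      fix H assume "elts H \<subseteq> cube \<alpha>"
      then show "iso (elts H, snd (lex_ord \<alpha>)) (elts T, r) \<longleftrightarrow> iso (elts H, lex_less \<alpha> zero one) (elts T, r)"
        using lex_eq[OF _ _ assms(1)] by (intro iso_cong_rel) blast
    qed
    ultimately show ?thesis by simp
  qed
  \<comment> \<open>Reversing both orders leaves the arrow relation unchanged. A type k +
    \<open>\<omega>\<^sup>*\<close> thus becomes a type \<omega> + k in the order with 0 and 1
    exchanged, which is the tree \<open>D\<close>.\<close>
  have flip: "arrows (cube \<alpha>, lex_less \<alpha> one zero) (elts T, \<lambda>x y. r y x) (elts T, \<lambda>x y. r y x) \<longleftrightarrow>
      arrows (cube \<alpha>, lex_less \<alpha> zero one) (elts T, r) (elts T, r)"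
    unfolding lex_less_flip by (rule arrows_cong) (rule iso_rev)
  interpret U: tree "cube \<alpha>" "lex_less \<alpha> zero one" "elts \<alpha>" "lex_split \<alpha>" "ap g" ap
    by (rule lex_tree[OF assms(1) _ g]) simp
  interpret D: tree "cube \<alpha>" "lex_less \<alpha> one zero" "elts \<alpha>" "lex_split \<alpha>" "ap g" ap
    by (rule lex_tree[OF assms(1) _ g]) simp
  show ?thesis unfolding so lex exceptional_iff[OF T]
  proof (intro conjI impI)
    assume "\<not> (omega_plus_finite r (elts T) \<or> omega_plus_finite (\<lambda>x y. r y x) (elts T))"
    then show "\<not> arrows (cube \<alpha>, lex_less \<alpha> zero one) (elts T, r) (elts T, r)"
      using U.nonexceptional[OF T dfun_ap bijE(1)[OF h]] by blast
  next
    assume "omega_plus_finite r (elts T) \<or> omega_plus_finite (\<lambda>x y. r y x) (elts T)"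
    then show "arrows (cube \<alpha>, lex_less \<alpha> zero one) (elts T, r) (elts T, r) \<longleftrightarrow> arrows (omega :: 'v ord) omega omega"
    proof
      assume o: "omega_plus_finite r (elts T)"
      obtain H where "elts H \<subseteq> cube \<alpha>" "iso (elts H, lex_less \<alpha> zero one) (elts T, r)"
        using lex_embedding[OF assms(1) _ g T o, of zero one] by blast
      then show ?thesis
        using arrows_of_omega[OF U.smL U.dlt U.linL T(1,3) o] U.omega_of_arrows[OF T(1,3) o] by blast
    next
      assume o: "omega_plus_finite (\<lambda>x y. r y x) (elts T)"
      obtain H where "elts H \<subseteq> cube \<alpha>" "iso (elts H, lex_less \<alpha> one zero) (elts T, \<lambda>x y. r y x)"
        using lex_embedding[OF assms(1) _ g Tr o, of one zero] by blast
      then show ?thesis unfolding flip[symmetric]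
        using arrows_of_omega[OF D.smL D.dlt D.linL Tr(1,3) o] D.omega_of_arrows[OF Tr(1,3) o] by blast
    qed
  qed
qed

end
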